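(* Let $A\subset\mathbb{R}^2$ be a set with $\dim_H(A)=t>1$, and let $\mathcal{L}$ be a set of lines in $\mathbb{R}^2$ such that $\dim_H(A\cap\ell)>t-1$ for all $\ell\in\mathcal{L}$. Then $\dim_H(\mathcal{L})\le 3-t$.
   Context: $\dim_H$ denotes Hausdorff dimension. The Hausdorff dimension of a set of lines is taken with respect to the usual metric on the 2-dimensional manifold of affine lines in $\mathbb{R}^2$ (equivalently, for non-vertical lines $y=mx+k$, the Hausdorff dimension of the set of parameters $(m,k)\in\mathbb{R}^2$). *)

theory Defs
  imports "HOL-Analysis.Analysis"
begin

section \<open>Hausdorff measure and Hausdorff dimension\<close>

text \<open>
  The summand is the power \<open>(diam U)\<^sup>s\<close> with the usual conventions that empty
  sets contribute nothing and that \<open>0\<^sup>0 = 1\<close> for a nonempty set, so that the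
  0-dimensional measure counts points (in Isabelle, \<open>0 powr 0 = 0\<close>).
\<close>

definition hausdorff_gauge :: "real \<Rightarrow> 'a::metric_space set \<Rightarrow> ennreal" where
  "hausdorff_gauge s U =
     (if U = {} then 0 else if s = 0 then 1 else ennreal (diameter U powr s))"

text \<open>
  The covering sets are required to be bounded because \<^const>\<open>diameter\<close> is
  meaningless for unbounded sets.
\<close>

definition hausdorff_premeasure :: "real \<Rightarrow> real \<Rightarrow> 'a::metric_space set \<Rightarrow> ennreal" where
  "hausdorff_premeasure s \<delta> A =
     (INF U \<in> {U :: nat \<Rightarrow> 'a set.
                 A \<subseteq> (\<Union>i. U i) \<and> (\<forall>i. bounded (U i) \<and> diameter (U i) \<le> \<delta>)}.
        \<Sum>i. hausdorff_gauge s (U i))"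

definition hausdorff_measure :: "real \<Rightarrow> 'a::metric_space set \<Rightarrow> ennreal" where
  "hausdorff_measure s A = (SUP \<delta> \<in> {0<..}. hausdorff_premeasure s \<delta> A)"

definition hausdorff_dim :: "'a::metric_space set \<Rightarrow> ereal" where
  "hausdorff_dim A = Inf {ereal s | s. 0 \<le> s \<and> hausdorff_measure s A = 0}"

section \<open>The metric space of affine lines in the plane\<close>

typedef line = "{l :: (real ^ 2) set. affine l \<and> aff_dim l = 1}"
  morphisms line_points Abs_line
proof -
  obtain b :: "real ^ 2" where "b \<in> Basis" using nonempty_Basis by blast
  then have "b \<noteq> 0" by auto
  then have "aff_dim (affine hull {0, b}) = 1" by simp
  then show ?thesis using affine_affine_hull by blast
qed

definition direction :: "line \<Rightarrow> (real ^ 2) set" where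
  "direction l = {x - y | x y. x \<in> line_points l \<and> y \<in> line_points l}"

lemma line_points_affine: "affine (line_points l)" and line_points_aff_dim: "aff_dim (line_points l) = 1"
  using line_points[of l] by auto

lemma line_points_nonempty: "line_points l \<noteq> {}"
  using line_points_aff_dim[of l] by auto

lemma line_points_closed: "closed (line_points l)"
  using closed_affine_hull[of "line_points l"] affine_hull_eq[of "line_points l"] line_points_affine by metis

lemma line_points_eq_translated_direction:
  assumes "a \<in> line_points l"
  shows "line_points l = (+) a ` direction l"
proof -
  have "direction l = (\<lambda>x. - a + x) ` line_points l"
  proof (intro equalityI subsetI)
    fix z assume "z \<in> direction l"
    then obtain x y where z: "z = x - y" "x \<in> line_points l" "y \<in> line_points l"
      by (auto simp: direction_def)
    have "a + x - y \<in> line_points l"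
      using mem_affine_3_minus[OF line_points_affine assms z(2) z(3), of 1] by (simp add: algebra_simps)
    then show "z \<in> (\<lambda>x. - a + x) ` line_points l"
      by (rule rev_image_eqI) (simp add: z)
  next
    fix z assume "z \<in> (\<lambda>x. - a + x) ` line_points l"
    then show "z \<in> direction l" using assms by (force simp: direction_def)
  qed
  then show ?thesis by (simp add: image_image)
qed

lemma direction_subspace: "subspace (direction l)"
proof -
  obtain a where a: "a \<in> line_points l" using line_points_nonempty by blast
  have "direction l = (\<lambda>x. - a + x) ` line_points l"
    by (subst line_points_eq_translated_direction[OF a]) (simp add: image_image)
  then show ?thesis using affine_diffs_subspace[OF line_points_affine a] by simp
qed

lemma closest_point_subspace_eqI:
  fixes V :: "'a::euclidean_space set"
  assumes "subspace V" "y \<in> V" "\<And>v. v \<in> V \<Longrightarrow> (x - y) \<bullet> v = 0"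
  shows "closest_point V x = y"
proof -
  have "dist x y \<le> dist x v" if "v \<in> V" for v
  proof -
    have "(x - y) \<bullet> (y - v) = 0"
      using assms that by (simp add: subspace_diff)
    then have "(norm (x - v))\<^sup>2 = (norm (x - y))\<^sup>2 + (norm (y - v))\<^sup>2"
      using norm_add_Pythagorean[of "x - y" "y - v"] by (simp add: orthogonal_def)
    then have "(norm (x - y))\<^sup>2 \<le> (norm (x - v))\<^sup>2" by simp
    then show ?thesis by (simp add: dist_norm power2_le_iff_abs_le)
  qed
  then show ?thesis
    using closest_point_unique[of V y x] assms subspace_imp_convex closed_subspace by metis
qed

lemma closest_point_subspace:
  fixes V :: "'a::euclidean_space set"
  assumes "subspace V"
  shows "closest_point V x \<in> V" "v \<in> V \<Longrightarrow> (x - closest_point V x) \<bullet> v = 0"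
proof -
  have sp: "span V = V" using assms by (simp add: span_eq_iff)
  obtain y z where yz: "y \<in> span V" "\<And>w. w \<in> span V \<Longrightarrow> orthogonal z w" "x = y + z"
    using orthogonal_subspace_decomp_exists[of V x] by blast
  have "closest_point V x = y"
    using closest_point_subspace_eqI[OF assms, of y x] yz sp by (auto simp: orthogonal_def)
  then show "closest_point V x \<in> V" "v \<in> V \<Longrightarrow> (x - closest_point V x) \<bullet> v = 0"
    using yz sp by (auto simp: orthogonal_def)
qed

lemma bounded_linear_closest_point_subspace:
  fixes V :: "'a::euclidean_space set"
  assumes "subspace V"
  shows "bounded_linear (closest_point V)"
proof -
  note cp = closest_point_subspace[OF assms]
  have "linear (closest_point V)"
  proof (rule linearI)
    show "closest_point V (x + y) = closest_point V x + closest_point V y" for x y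
    proof (rule closest_point_subspace_eqI[OF assms])
      show "closest_point V x + closest_point V y \<in> V"
        using cp assms by (simp add: subspace_add)
      show "(x + y - (closest_point V x + closest_point V y)) \<bullet> v = 0" if "v \<in> V" for v
        using cp(2)[OF that, of x] cp(2)[OF that, of y] by (simp add: inner_simps)
    qed
    show "closest_point V (c *\<^sub>R x) = c *\<^sub>R closest_point V x" for c x
    proof (rule closest_point_subspace_eqI[OF assms])
      show "c *\<^sub>R closest_point V x \<in> V"
        using cp assms by (simp add: subspace_scale)
      show "(c *\<^sub>R x - c *\<^sub>R closest_point V x) \<bullet> v = 0" if "v \<in> V" for v
        using cp(2)[OF that, of x] by (simp add: inner_simps)
    qed
  qed
  then show ?thesis by (simp add: linear_conv_bounded_linear)
qed

instantiation line :: metric_space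
begin

text \<open>
  \<^term>\<open>closest_point (direction l)\<close> is the orthogonal projection onto the direction of
  \<open>l\<close>, and \<^term>\<open>closest_point (line_points l) 0\<close> is the point where \<open>l\<close> meets the
  orthogonal complement of its direction. The distance of \<open>V + a\<close> and \<open>W + b\<close>,
  with \<open>a\<close> orthogonal to \<open>V\<close> and \<open>b\<close> orthogonal to \<open>W\<close>, is thus
  \<open>\<parallel>\<pi>\<^sub>V - \<pi>\<^sub>W\<parallel> + \<bar>a - b\<bar>\<close>, the standard metric on the affine Grassmannian.
\<close>

definition dist_line :: "line \<Rightarrow> line \<Rightarrow> real" where
  "dist_line l m =
     onorm (\<lambda>x. closest_point (direction l) x - closest_point (direction m) x)
     + dist (closest_point (line_points l) 0) (closest_point (line_points m) 0)"

definition uniformity_line :: "(line \<times> line) filter" where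
  "uniformity_line = (INF e\<in>{0<..}. principal {(x, y). dist x y < e})"

definition open_line :: "line set \<Rightarrow> bool" where
  "open_line U = (\<forall>x\<in>U. eventually (\<lambda>(x', y). x' = x \<longrightarrow> y \<in> U) uniformity)"

instance
proof
  note bl = bounded_linear_closest_point_subspace[OF direction_subspace]
  fix l m k :: line
  let ?P = "\<lambda>l. closest_point (direction l)"
  show "dist l m = 0 \<longleftrightarrow> l = m"
  proof
    assume "dist l m = 0"
    moreover have "0 \<le> onorm (\<lambda>x. ?P l x - ?P m x)"
      by (intro onorm_pos_le bounded_linear_sub bl)
    ultimately have on: "onorm (\<lambda>x. ?P l x - ?P m x) = 0"
      and "dist (closest_point (line_points l) 0) (closest_point (line_points m) 0) = 0"
      using zero_le_dist[of "closest_point (line_points l) 0" "closest_point (line_points m) 0"]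
      unfolding dist_line_def by linarith+
    then have pt: "closest_point (line_points l) 0 = closest_point (line_points m) 0" by simp
    have "?P l x = ?P m x" for x
      using on onorm_eq_0[OF bounded_linear_sub[OF bl bl], of l m] by simp
    then have "direction l = direction m"
      using closest_point_subspace(1)[OF direction_subspace] closest_point_self
      by (metis subsetI subset_antisym)
    moreover have "closest_point (line_points l) 0 \<in> line_points l" "closest_point (line_points m) 0 \<in> line_points m"
      by (simp_all add: closest_point_in_set line_points_closed line_points_nonempty)
    ultimately have "line_points l = line_points m"
      using line_points_eq_translated_direction pt by metis
    then show "l = m" by (simp add: line_points_inject)
  next
    assume "l = m"
    then show "dist l m = 0" by (simp add: dist_line_def onorm_zero)
  qed
  have sym: "onorm (\<lambda>x. ?P l x - ?P k x) = onorm (\<lambda>x. ?P k x - ?P l x)" for l k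
    using onorm_neg[of "\<lambda>x. ?P k x - ?P l x"] by simp
  have "onorm (\<lambda>x. ?P l x - ?P m x)
      \<le> onorm (\<lambda>x. ?P l x - ?P k x) + onorm (\<lambda>x. ?P k x - ?P m x)"
    using onorm_triangle[OF bounded_linear_sub[OF bl bl] bounded_linear_sub[OF bl bl], of l k k m]
    by simp
  then show "dist l m \<le> dist l k + dist m k"
    using sym[of m k]
      dist_triangle2[of "closest_point (line_points l) 0" "closest_point (line_points m) 0"
        "closest_point (line_points k) 0"]
    by (simp add: dist_line_def)
qed (simp_all only: uniformity_line_def open_line_def)

end

end

theory Submission
  imports Defs "HOL-Probability.Distributions"
begin

text \<open>
  Suppose that \<open>L\<close> had dimension larger than \<open>3 - t\<close>. Then there are exponents \<open>s > t - 1\<close>,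
  \<open>\<tau> > 3 - t\<close> and \<open>u\<close> with \<open>t < u < s + 1\<close>, hence \<open>s + \<tau> > 2\<close>, such that \<open>A\<close> is
  \<open>u\<close>-null, while a part of \<open>L\<close> that is not \<open>\<tau>\<close>-null consists of lines on which \<open>A\<close> has
  \<open>s\<close>-dimensional content at least \<open>c > 0\<close>. Put a measure \<open>\<mu>\<close> on these lines that gives mass
  \<open>\<lesssim> r\<^sup>\<tau>\<close> to balls of radius \<open>r\<close>. A cover of \<open>A\<close> by sets \<open>U\<^sub>i\<close> covers each
  \<open>A \<inter> l\<close>, so integration over \<open>\<mu>\<close> yields
  \<open>c \<mu>(L) \<le> \<Sum>\<^sub>i (diam U\<^sub>i)\<^sup>s \<mu>{l. l meets U\<^sub>i}\<close>.
  If the lines through every ball of radius \<open>r\<close> had mass \<open>\<lesssim> r\<close>, the right-hand side would be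
  \<open>\<lesssim> \<Sum>\<^sub>i (diam U\<^sub>i)\<^bsup>s+1\<^esup>\<close>, which contradicts that \<open>A\<close> is \<open>u\<close>-null with
  \<open>u < s + 1\<close>.

  Some points do lie on too many lines, but there are few of them. Let \<open>G\<^sub>r(p)\<close> be the density at
  scale \<open>r\<close> of lines passing near \<open>p\<close>, smoothed by a Gaussian profile of width \<open>r\<close>. If the
  density first becomes large at scale \<open>r\<close>, then the difference \<open>D\<^sub>r\<close> of the densities at two
  neighbouring scales is at least \<open>1\<close> on the whole cell of size \<open>\<sim> r\<close> around \<open>p\<close>. The
  second moment of \<open>D\<^sub>r\<close> is small by cancellation: the profile of \<open>D\<^sub>r\<close> across a line has
  integral zero, and the integral over the plane of the product of two such profiles around two
  transversal lines factorises, so it would vanish without the weight \<open>exp (- x\<^sup>2)\<close>. With the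
  weight all integrals are again Gaussian and explicit, and the product for lines at distance \<open>d\<close>
  is \<open>\<lesssim> r\<^sup>2 / (r + d)\<^sup>3\<close>; this gives \<open>\<integral> D\<^sub>r\<^sup>2 \<lesssim> r\<^bsup>\<tau>-1\<^esup>\<close>
  (lemma \<open>energy_le\<close>). Hence the cells of high density contribute
  \<open>\<lesssim> r\<^bsup>s+\<tau>-2\<^esup>\<close> to the sum above (lemma \<open>bad_cells_mass\<close>), which is summable over
  geometric scales and negligible from a sufficiently small scale on, because \<open>s + \<tau> > 2\<close>.

  \<open>A\<close> and \<open>L\<close> may fail to be measurable, so \<open>\<mu>\<close> is replaced by finitely many
  weighted lines that satisfy the mass bound down to one fixed scale \<open>B\<^bsup>-J\<^esup>\<close> (lemma
  \<open>discrete_frostman\<close>). The scale is found by the pigeonhole principle: a fraction \<open>2\<^bsup>-J\<^esup>\<close> of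
  the content of many lines, and then a fraction \<open>2\<^bsup>-J\<^esup>\<close> of the lines, is covered by the
  members of size \<open>B\<^bsup>-J\<^esup>\<close> of a cover of \<open>A\<close>. These losses, as well as a growth factor \<open>8\<close> of
  the admissible density per scale, are arbitrarily small powers of \<open>B\<^sup>J\<close> when the base \<open>B\<close> is
  large.
\<close>

section \<open>Hausdorff content\<close>

lemma ennreal_le_suminf: "f i \<le> (\<Sum>i. f i)" for f :: "nat \<Rightarrow> ennreal"
  using sum_le_suminf[of f "{i}"] by simp

text \<open>
  Without a bound on the diameters of the covering sets the infimum is finite on bounded sets, and
  for positive exponents it has the same null sets as the Hausdorff measure. All hypotheses and
  conclusions on dimensions are therefore translated into statements about this content.
\<close>

definition hcontent :: "real \<Rightarrow> 'a::metric_space set \<Rightarrow> ennreal" where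
  "hcontent s A = (INF U \<in> {U :: nat \<Rightarrow> 'a set. A \<subseteq> (\<Union>i. U i) \<and> (\<forall>i. bounded (U i))}.
      \<Sum>i. ennreal (diameter (U i) powr s))"

lemma hcontent_le:
  fixes U :: "nat \<Rightarrow> 'a::metric_space set"
  assumes "A \<subseteq> (\<Union>i. U i)" "\<And>i. bounded (U i)"
  shows "hcontent s A \<le> (\<Sum>i. ennreal (diameter (U i) powr s))"
  unfolding hcontent_def using assms by (intro INF_lower) auto

lemma hcontent_less_cover:
  assumes "hcontent s A < e"
  shows "\<exists>U :: nat \<Rightarrow> 'a::metric_space set. A \<subseteq> (\<Union>i. U i) \<and> (\<forall>i. bounded (U i)) \<and>
    (\<Sum>i. ennreal (diameter (U i) powr s)) < e"
  using assms unfolding hcontent_def INF_less_iff by auto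

lemma hcontent_mono: "A \<subseteq> B \<Longrightarrow> hcontent s A \<le> hcontent s B"
  unfolding hcontent_def by (intro INF_superset_mono) auto

lemma hausdorff_gauge_pos_exponent:
  "0 < s \<Longrightarrow> hausdorff_gauge s U = ennreal (diameter U powr s)"
  by (auto simp: hausdorff_gauge_def)

text \<open>
  A cover whose sum is small consists of sets of small diameter, because the exponent is positive.
\<close>

lemma hausdorff_measure_eq_0_iff_hcontent:
  fixes A :: "'a::metric_space set"
  assumes s: "0 < s"
  shows "hausdorff_measure s A = 0 \<longleftrightarrow> hcontent s A = 0"
proof
  assume "hausdorff_measure s A = 0"
  moreover have "hausdorff_premeasure s 1 A \<le> hausdorff_measure s A"
    unfolding hausdorff_measure_def by (rule SUP_upper) simp
  ultimately have "hausdorff_premeasure s 1 A = 0" by simp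
  moreover have "hcontent s A \<le> hausdorff_premeasure s 1 A"
    unfolding hcontent_def hausdorff_premeasure_def hausdorff_gauge_pos_exponent[OF s]
    by (intro INF_superset_mono) auto
  ultimately show "hcontent s A = 0" by simp
next
  assume h: "hcontent s A = 0"
  have "hausdorff_premeasure s d A \<le> 0" if d: "0 < d" for d
  proof (rule ennreal_le_epsilon)
    fix e :: real assume e: "0 < e"
    define e' where "e' = min e (d powr s)"
    have e': "0 < e'" using e d by (simp add: e'_def)
    have less: "hcontent s A < ennreal e'" using h e' by simp
    obtain U :: "nat \<Rightarrow> 'a set" where cover: "A \<subseteq> (\<Union>i. U i) \<and> (\<forall>i. bounded (U i)) \<and>
        (\<Sum>i. ennreal (diameter (U i) powr s)) < ennreal e'"
      using hcontent_less_cover[OF less] ..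
    note U = cover[THEN conjunct1] cover[THEN conjunct2, THEN conjunct1, rule_format]
      cover[THEN conjunct2, THEN conjunct2]
    have "diameter (U i) \<le> d" for i
    proof -
      have "ennreal (diameter (U i) powr s) \<le> (\<Sum>i. ennreal (diameter (U i) powr s))"
        by (rule ennreal_le_suminf)
      also have "\<dots> < ennreal e'" by (rule U)
      finally have "diameter (U i) powr s < d powr s"
        by (simp add: ennreal_less_iff e'_def)
      then show ?thesis using powr_mono2[of s d "diameter (U i)"] s d by linarith
    qed
    then have "hausdorff_premeasure s d A \<le> (\<Sum>i. ennreal (diameter (U i) powr s))"
      unfolding hausdorff_premeasure_def hausdorff_gauge_pos_exponent[OF s]
      using U by (intro INF_lower) auto
    also have "\<dots> \<le> ennreal e'" using U(3) by (rule less_imp_le)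
    also have "\<dots> \<le> ennreal e" by (intro ennreal_leI) (simp add: e'_def)
    finally show "hausdorff_premeasure s d A \<le> 0 + ennreal e" by simp
  qed
  then have "hausdorff_measure s A \<le> 0"
    unfolding hausdorff_measure_def by (intro SUP_least) auto
  then show "hausdorff_measure s A = 0" by simp
qed

lemma hcontent_bounded_le:
  assumes s: "0 < s" and "bounded U" "diameter U \<le> \<rho>"
  shows "hcontent s U \<le> ennreal (\<rho> powr s)"
proof -
  have "hcontent s U \<le> (\<Sum>i. ennreal (diameter (if i = 0 then U else {}) powr s))"
    by (rule hcontent_le) (use assms in \<open>auto split: if_splits\<close>)
  also have "\<dots> = (\<Sum>i\<in>{0::nat}. ennreal (diameter (if i = 0 then U else {}) powr s))"
    by (rule suminf_finite) auto
  also have "\<dots> = ennreal (diameter U powr s)" by simp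
  also have "\<dots> \<le> ennreal (\<rho> powr s)"
    using assms diameter_ge_0[of U] by (intro ennreal_leI powr_mono2) auto
  finally show ?thesis .
qed

lemma hcontent_UN:
  fixes A :: "nat \<Rightarrow> 'a::metric_space set"
  shows "hcontent s (\<Union>i. A i) \<le> (\<Sum>i. hcontent s (A i))"
proof (rule ennreal_le_epsilon)
  fix e :: real assume fin: "(\<Sum>i. hcontent s (A i)) < top" and e: "0 < e"
  have half: "(\<Sum>i. (1/2 :: ennreal) ^ Suc i) = 1"
  proof -
    have "(\<Sum>i. ennreal ((1/2) ^ Suc i)) = ennreal 1"
      by (rule suminf_ennreal_eq[OF _ power_half_series]) simp
    moreover have "ennreal ((1/2) ^ Suc i) = (1/2) ^ Suc i" for i
      using divide_ennreal[of 1 2] by (subst ennreal_power[symmetric]) simp_all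
    ultimately show ?thesis by simp
  qed
  have pos: "0 < ennreal e * (1/2) ^ Suc i" for i
    using e 
  proof -
    have "ennreal ((1/2) ^ Suc i) = (1/2) ^ Suc i"
      using divide_ennreal[of 1 2] by (subst ennreal_power[symmetric]) simp_all
    moreover have "0 < ennreal ((1/2) ^ Suc i)" by simp
    ultimately show ?thesis using e by (simp only: ennreal_zero_less_mult_iff) simp
  qed
  have lt: "hcontent s (A i) < hcontent s (A i) + ennreal e * (1/2) ^ Suc i" for i
  proof -
    have "hcontent s (A i) \<le> (\<Sum>i. hcontent s (A i))"
      by (rule ennreal_le_suminf)
    then have "hcontent s (A i) \<noteq> top" using fin by (auto simp: top_unique)
    then show ?thesis using pos[of i] ennreal_add_left_cancel_less[of "hcontent s (A i)" 0] by simp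
  qed
  have "\<exists>U :: nat \<Rightarrow> 'a set. A i \<subseteq> (\<Union>j. U j) \<and> (\<forall>j. bounded (U j)) \<and>
      (\<Sum>j. ennreal (diameter (U j) powr s)) < hcontent s (A i) + ennreal e * (1/2) ^ Suc i" for i
    by (rule hcontent_less_cover[OF lt[of i]])
  then obtain U :: "nat \<Rightarrow> nat \<Rightarrow> 'a set" where U: "\<And>i. A i \<subseteq> (\<Union>j. U i j)" "\<And>i j. bounded (U i j)"
      "\<And>i. (\<Sum>j. ennreal (diameter (U i j) powr s)) < hcontent s (A i) + ennreal e * (1/2) ^ Suc i"
    by metis
  define V where "V n = (case prod_decode n of (i, j) \<Rightarrow> U i j)" for n
  have "hcontent s (\<Union>i. A i) \<le> (\<Sum>n. ennreal (diameter (V n) powr s))"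
  proof (rule hcontent_le)
    show "(\<Union>i. A i) \<subseteq> (\<Union>n. V n)"
    proof
      fix x assume "x \<in> (\<Union>i. A i)"
      then obtain i j where "x \<in> U i j" using U(1) by blast
      then have "x \<in> V (prod_encode (i, j))" by (simp add: V_def)
      then show "x \<in> (\<Union>n. V n)" by blast
    qed
    show "bounded (V n)" for n by (simp add: V_def U split: prod.split)
  qed
  also have "\<dots> = (\<Sum>i. \<Sum>j. ennreal (diameter (U i j) powr s))"
  proof -
    have "(\<Sum>n. (\<lambda>(i,j). ennreal (diameter (U i j) powr s)) (prod_decode n))
        = (\<Sum>i. \<Sum>j. ennreal (diameter (U i j) powr s))"
      by (rule suminf_ennreal_2dimen) simp
    moreover have "ennreal (diameter (V n) powr s)
        = (\<lambda>(i,j). ennreal (diameter (U i j) powr s)) (prod_decode n)" for n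
      by (simp add: V_def split: prod.split)
    ultimately show ?thesis by simp
  qed
  also have "\<dots> \<le> (\<Sum>i. hcontent s (A i) + ennreal e * (1/2) ^ Suc i)"
    using U(3) by (intro suminf_le) (auto intro: less_imp_le)
  also have "\<dots> = (\<Sum>i. hcontent s (A i)) + (\<Sum>i. ennreal e * (1/2) ^ Suc i)"
    by (rule suminf_add[symmetric]) auto
  also have "(\<Sum>i. ennreal e * (1/2) ^ Suc i) = ennreal e"
    by (simp only: ennreal_suminf_cmult half mult_1_right)
  finally show "hcontent s (\<Union>i. A i) \<le> (\<Sum>i. hcontent s (A i)) + ennreal e" .
qed

lemma hcontent_empty [simp]: "0 < s \<Longrightarrow> hcontent s {} = 0"
  using hcontent_bounded_le[of s "{}" 0] by simp

lemma hcontent_Un: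
  assumes "0 < s" shows "hcontent s (A \<union> B) \<le> hcontent s A + hcontent s B"
proof -
  have "A \<union> B = (\<Union>i::nat. if i = 0 then A else if i = 1 then B else {})"
    by (auto split: if_splits)
  then have "hcontent s (A \<union> B) \<le> (\<Sum>i::nat. hcontent s (if i = 0 then A else if i = 1 then B else {}))"
    by (metis hcontent_UN)
  also have "\<dots> = (\<Sum>i\<in>{0,1::nat}. hcontent s (if i = 0 then A else if i = 1 then B else {}))"
    using assms by (intro suminf_finite) auto
  finally show ?thesis by simp
qed

lemma hcontent_UN_finite:
  assumes "0 < s" "finite I"
  shows "hcontent s (\<Union>i\<in>I. A i) \<le> (\<Sum>i\<in>I. hcontent s (A i))"
  using assms(2)
proof induction
  case (insert i I)
  have "hcontent s (\<Union>i\<in>insert i I. A i) \<le> hcontent s (A i) + hcontent s (\<Union>i\<in>I. A i)"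
    using hcontent_Un[OF assms(1)] by simp
  also have "\<dots> \<le> hcontent s (A i) + (\<Sum>i\<in>I. hcontent s (A i))"
    by (rule add_left_mono) (rule insert.IH)
  finally show ?case using insert.hyps by simp
qed (simp add: assms)

lemma hcontent_UN_null:
  fixes A :: "nat \<Rightarrow> 'a::metric_space set"
  shows "(\<And>i. hcontent s (A i) = 0) \<Longrightarrow> hcontent s (\<Union>i. A i) = 0"
  using hcontent_UN[of s A] by simp

lemma diameter_dist_le:
  fixes S :: "'a::metric_space set"
  assumes "0 \<le> d" "\<And>x y. x \<in> S \<Longrightarrow> y \<in> S \<Longrightarrow> dist x y \<le> d"
  shows "diameter S \<le> d"
proof (cases "S = {}")
  case False
  then have "(SUP (x, y)\<in>S \<times> S. dist x y) \<le> d" using assms by (intro cSUP_least) auto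
  then show ?thesis using False by (simp add: diameter_def)
qed (simp add: assms)

lemma hcontent_lipschitz_null:
  fixes f :: "'a::metric_space \<Rightarrow> 'b::metric_space"
  assumes s: "0 < s" and f: "C-lipschitz_on A f" and A: "hcontent s A = 0"
  shows "hcontent s (f ` A) = 0"
proof -
  have C: "0 \<le> C" using f by (rule lipschitz_on_nonneg)
  have "hcontent s (f ` A) \<le> 0"
  proof (rule ennreal_le_epsilon)
    fix e :: real assume e: "0 < e"
    define e' where "e' = e / (C powr s + 1)"
    have e': "0 < e'" using e by (simp add: e'_def add_nonneg_pos)
    have less: "hcontent s A < ennreal e'" using A e' by simp
    obtain U :: "nat \<Rightarrow> 'a set" where cover: "A \<subseteq> (\<Union>i. U i) \<and> (\<forall>i. bounded (U i)) \<and>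
        (\<Sum>i. ennreal (diameter (U i) powr s)) < ennreal e'"
      using hcontent_less_cover[OF less] ..
    note U = cover[THEN conjunct1] cover[THEN conjunct2, THEN conjunct1, rule_format]
      cover[THEN conjunct2, THEN conjunct2]
    have D: "dist (f x) (f y) \<le> C * diameter (U i)" if "x \<in> A \<inter> U i" "y \<in> A \<inter> U i" for x y i
    proof -
      have "dist (f x) (f y) \<le> C * dist x y" using f that by (auto intro: lipschitz_onD)
      also have "\<dots> \<le> C * diameter (U i)"
        using that by (intro mult_left_mono diameter_bounded_bound U C) auto
      finally show ?thesis .
    qed
    have bd: "bounded (f ` (A \<inter> U i))" for i
      unfolding bounded_two_points using D by (auto intro!: exI[of _ "C * diameter (U i)"])
    have dm: "diameter (f ` (A \<inter> U i)) \<le> C * diameter (U i)" for i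
      using D C diameter_ge_0[OF U(2)] by (intro diameter_dist_le) auto
    have "A = (\<Union>i. A \<inter> U i)" using U(1) by blast
    then have "f ` A = (\<Union>i. f ` (A \<inter> U i))" by (metis image_UN)
    then have "hcontent s (f ` A) \<le> (\<Sum>i. ennreal (diameter (f ` (A \<inter> U i)) powr s))"
      by (intro hcontent_le bd) simp
    also have "\<dots> \<le> (\<Sum>i. ennreal (C powr s) * ennreal (diameter (U i) powr s))"
    proof (intro suminf_le allI)
      fix i
      have "diameter (f ` (A \<inter> U i)) powr s \<le> (C * diameter (U i)) powr s"
        using s dm diameter_ge_0[OF bd] by (intro powr_mono2) auto
      also have "\<dots> = C powr s * diameter (U i) powr s"
        using C diameter_ge_0[OF U(2)] by (simp add: powr_mult)
      finally show "ennreal (diameter (f ` (A \<inter> U i)) powr s) \<le> ennreal (C powr s) * ennreal (diameter (U i) powr s)"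
        by (simp add: ennreal_mult[symmetric] ennreal_leI)
    qed auto
    also have "\<dots> = ennreal (C powr s) * (\<Sum>i. ennreal (diameter (U i) powr s))"
      by (rule ennreal_suminf_cmult)
    also have "\<dots> \<le> ennreal (C powr s) * ennreal e'"
      using U(3) by (intro mult_left_mono) auto
    also have "\<dots> = ennreal (C powr s * e')"
      using e' by (simp add: ennreal_mult)
    also have "\<dots> \<le> ennreal e"
    proof (rule ennreal_leI)
      have "C powr s * e' \<le> (C powr s + 1) * e'" using e' by (simp add: algebra_simps)
      also have "\<dots> = e"
        using powr_ge_zero[of C s] unfolding e'_def by (smt (verit) nonzero_eq_divide_eq mult.commute)
      finally show "C powr s * e' \<le> e" .
    qed
    finally show "hcontent s (f ` A) \<le> 0 + ennreal e" by simp
  qed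
  then show ?thesis by simp
qed

text \<open>
  The members of a cheap cover are sorted by the power of \<open>1 / B\<close> just above their diameter. Sets of
  diameter zero have no such level, so each summand is first enlarged by a summable positive amount
  \<open>\<epsilon> / 2 * (1 / 2) ^ Suc i\<close>. Since the enlarged sum stays below \<open>\<epsilon>\<close>, at most \<open>B\<^bsup>u j\<^esup>\<close> members have
  level \<open>j\<close>, and no member has a level below \<open>j0\<close>.
\<close>

lemma null_cover_levels:
  fixes A :: "'a::metric_space set"
  assumes u: "0 < u" and null: "hcontent u A = 0" and B: "2 \<le> B"
  shows "\<exists>\<U> :: nat \<Rightarrow> 'a set set. A \<subseteq> (\<Union>j\<in>{j0..}. \<Union>(\<U> j)) \<and>
    (\<forall>j. finite (\<U> j) \<and> real (card (\<U> j)) \<le> (real B powr u) ^ j \<and>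
      (\<forall>U\<in>\<U> j. bounded U \<and> diameter U \<le> 1 / real B ^ j))"
proof -
  define b where "b = real B powr u"
  have Bpos: "0 < real B" using B by simp
  have b1: "1 < b" unfolding b_def using B u by (simp add: gr_one_powr)
  have b0: "0 < b" using b1 by simp
  define \<epsilon> where "\<epsilon> = 1 / b ^ Suc j0"
  have eps: "0 < \<epsilon>" using b0 by (simp add: \<epsilon>_def)
  have "hcontent u A < ennreal (\<epsilon> / 2)" using null eps by simp
  from hcontent_less_cover[OF this] obtain U :: "nat \<Rightarrow> 'a set" where
    cover: "A \<subseteq> (\<Union>i. U i) \<and> (\<forall>i. bounded (U i)) \<and> (\<Sum>i. ennreal (diameter (U i) powr u)) < ennreal (\<epsilon> / 2)" ..
  define x where "x i = diameter (U i) powr u" for i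
  have x0: "0 \<le> x i" for i by (simp add: x_def)
  have lt: "(\<Sum>i. ennreal (x i)) < ennreal (\<epsilon> / 2)" using cover by (simp add: x_def)
  then have "(\<Sum>i. ennreal (x i)) \<noteq> top" by (auto simp: less_top[symmetric] intro: order_less_trans)
  then have sx: "summable x" by (rule summable_suminf_not_top[OF x0])
  have "ennreal (\<Sum>i. x i) < ennreal (\<epsilon> / 2)" using lt suminf_ennreal2[OF x0 sx] by simp
  then have sumx: "(\<Sum>i. x i) < \<epsilon> / 2" using suminf_nonneg[OF sx x0] by (simp add: ennreal_less_iff)
  define y where "y i = x i + \<epsilon> / 2 * (1 / 2) ^ Suc i" for i
  have y0: "0 < y i" for i using x0[of i] eps by (simp add: y_def add_nonneg_pos)
  have "(\<lambda>i. \<epsilon> / 2 * (1 / 2) ^ Suc i) sums (\<epsilon> / 2 * 1)" by (intro sums_mult power_half_series)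
  from sums_add[OF summable_sums[OF sx] this] have ys: "y sums ((\<Sum>i. x i) + \<epsilon> / 2)"
    by (simp only: y_def[abs_def] mult_1_right)
  have sum_y: "(\<Sum>i\<in>I. y i) < \<epsilon>" if "finite I" for I
  proof -
    have "(\<Sum>i\<in>I. y i) \<le> (\<Sum>i. y i)"
      using sums_summable[OF ys] that y0 by (intro sum_le_suminf) (auto intro: less_imp_le)
    also have "\<dots> = (\<Sum>i. x i) + \<epsilon> / 2" using sums_unique[OF ys] by simp
    finally show ?thesis using sumx by simp
  qed
  have eps1: "\<epsilon> \<le> 1" unfolding \<epsilon>_def using one_le_power[of b "Suc j0"] b1 by simp
  have ex: "\<exists>j. 1 / b ^ Suc j < y i" for i
  proof -
    have "\<exists>j. (1 / b) ^ j < y i" using b1 by (intro real_arch_pow_inv y0) simp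
    then obtain j where "(1 / b) ^ j < y i" ..
    moreover have "(1 / b) ^ Suc j \<le> (1 / b) ^ j" using b1 by (intro power_decreasing) auto
    ultimately have "1 / b ^ Suc j < y i" unfolding power_one_over by linarith
    then show ?thesis ..
  qed
  define level where "level i = (LEAST j. 1 / b ^ Suc j < y i)" for i
  have level_lower: "1 / b ^ Suc (level i) < y i" for i
    unfolding level_def by (rule LeastI_ex[OF ex])
  have level_upper: "y i \<le> 1 / b ^ level i" for i
  proof (cases "level i")
    case 0
    have "y i < 1" using sum_y[of "{i}"] eps1 by simp
    then show ?thesis using 0 by simp
  next
    case (Suc j)
    then have "\<not> 1 / b ^ Suc j < y i" using not_less_Least[of j "\<lambda>j. 1 / b ^ Suc j < y i"] by (simp add: level_def)
    then show ?thesis using Suc by simp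
  qed
  have card_le: "real (card I) \<le> b ^ j" if I: "finite I" "I \<subseteq> {i. level i = j}" for I j
  proof -
    have "real (card I) * (1 / b ^ Suc j) = (\<Sum>i\<in>I. 1 / b ^ Suc j)" by simp
    also have "\<dots> \<le> (\<Sum>i\<in>I. y i)" using I(2) level_lower by (intro sum_mono) (auto intro: less_imp_le)
    also have "\<dots> < \<epsilon>" by (rule sum_y[OF I(1)])
    finally have "real (card I) * (1 / b ^ Suc j) * b ^ Suc j \<le> \<epsilon> * b ^ Suc j"
      using b0 by (intro mult_right_mono) auto
    then have "real (card I) \<le> b ^ Suc j / b ^ Suc j0" using b0 by (simp add: \<epsilon>_def)
    also have "\<dots> = b ^ j / b ^ j0" using b0 by simp
    also have "\<dots> \<le> b ^ j / 1" using b1 one_le_power[of b j0] by (intro divide_left_mono) auto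
    finally show ?thesis by simp
  qed
  have level_ge: "j0 \<le> level i" for i
  proof (rule ccontr)
    assume "\<not> j0 \<le> level i"
    then have "b ^ Suc (level i) \<le> b ^ Suc j0" using b1 by (intro power_increasing) auto
    then have "\<epsilon> \<le> 1 / b ^ Suc (level i)" unfolding \<epsilon>_def using b0 by (intro divide_left_mono) auto
    then show False using level_lower[of i] sum_y[of "{i}"] by simp
  qed
  have fin: "finite {i. level i = j}" for j
  proof -
    obtain N :: nat where N: "b ^ j < real N" using reals_Archimedean2 by blast
    have "card I \<le> N" if "I \<subseteq> {i. level i = j}" "finite I" for I
      using card_le[OF that(2,1)] N by simp
    then show ?thesis using finite_if_finite_subsets_card_bdd by blast
  qed
  define \<U> where "\<U> j = U ` {i. level i = j}" for j
  have "A \<subseteq> (\<Union>j\<in>{j0..}. \<Union>(\<U> j))"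
  proof
    fix p assume "p \<in> A"
    then obtain i where "p \<in> U i" using cover by blast
    moreover have "U i \<in> \<U> (level i)" by (simp add: \<U>_def)
    moreover have "level i \<in> {j0..}" using level_ge by simp
    ultimately show "p \<in> (\<Union>j\<in>{j0..}. \<Union>(\<U> j))" by blast
  qed
  moreover have "finite (\<U> j)" for j by (simp add: \<U>_def fin)
  moreover have "real (card (\<U> j)) \<le> b ^ j" for j
    using card_image_le[OF fin, of U j] card_le[OF fin order_refl, of j] by (simp add: \<U>_def)
  moreover have "bounded V \<and> diameter V \<le> 1 / real B ^ j" if V: "V \<in> \<U> j" for V j
  proof -
    obtain i where i: "V = U i" "level i = j" using V unfolding \<U>_def by blast
    have bd: "bounded V" using cover i by blast
    have "0 < \<epsilon> / 2 * (1 / 2) ^ Suc i" using eps by simp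
    then have "diameter V powr u \<le> y i" by (simp add: y_def x_def i(1))
    also have "\<dots> \<le> 1 / b ^ j" using level_upper[of i] i(2) by simp
    also have "\<dots> = (1 / real B ^ j) powr u"
      using Bpos by (simp add: b_def powr_divide powr_realpow[symmetric] powr_powr mult.commute)
    finally have "diameter V powr u \<le> (1 / real B ^ j) powr u" .
    moreover have "0 \<le> 1 / real B ^ j" using Bpos by simp
    ultimately have "diameter V \<le> 1 / real B ^ j"
      using powr_less_mono2[OF u, of "1 / real B ^ j" "diameter V"] by linarith
    then show ?thesis using bd by simp
  qed
  ultimately show ?thesis unfolding b_def by blast
qed

lemma hcontent_pigeonhole:
  fixes Z :: "nat \<Rightarrow> 'a::metric_space set"
  assumes c: "0 < c" and "ennreal c \<le> hcontent s X" "X \<subseteq> (\<Union>j. Z j)"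
  shows "\<exists>j. ennreal (c * (1 / 2) ^ (j + 2)) \<le> hcontent s (Z j)"
proof (rule ccontr)
  assume "\<not> ?thesis"
  then have less: "hcontent s (Z j) \<le> ennreal (c / 2 * (1 / 2) ^ Suc j)" for j
    by (auto simp: not_le intro: less_imp_le)
  have sums: "(\<lambda>j. c / 2 * (1 / 2) ^ Suc j) sums (c / 2 * 1)" by (intro sums_mult power_half_series)
  have "ennreal c \<le> hcontent s (\<Union>j. Z j)" using assms(2,3) hcontent_mono order_trans by blast
  also have "\<dots> \<le> (\<Sum>j. hcontent s (Z j))" by (rule hcontent_UN)
  also have "\<dots> \<le> (\<Sum>j. ennreal (c / 2 * (1 / 2) ^ Suc j))" by (intro suminf_le less) auto
  also have "\<dots> = ennreal (c / 2 * 1)" using c by (intro suminf_ennreal_eq sums) auto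
  finally show False using c by (simp add: ennreal_le_iff)
qed

section \<open>Discrete Frostman weights\<close>

lemma sum_UN_le:
  fixes f :: "'a \<Rightarrow> real"
  assumes "finite I" "\<And>i. i \<in> I \<Longrightarrow> finite (A i)" "\<And>x. 0 \<le> f x"
  shows "sum f (\<Union>i\<in>I. A i) \<le> (\<Sum>i\<in>I. sum f (A i))"
  using assms(1,2)
proof induction
  case (insert i I)
  have "sum f (A i \<union> (\<Union>i\<in>I. A i)) \<le> sum f (A i) + sum f (\<Union>i\<in>I. A i)"
    using insert by (subst sum_Un) (auto intro!: sum_nonneg assms)
  then show ?case using insert by force
qed simp

text \<open>
  A finitary Frostman lemma for a nested sequence of partitions, where \<open>\<kappa> k\<close> maps a point to the name
  of its cell of level \<open>k\<close>. The weights are built from the finest level upwards: the weights obtained in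
  the cells of the next finer level are put together, and they are scaled down as soon as their total
  exceeds the capacity \<open>h i\<close>. The family \<open>C\<close> collects the cells that are filled exactly; it covers \<open>S\<close>,
  and its total capacity is at most the total weight. A lower bound for the cost of covers of \<open>S\<close> thus
  becomes a lower bound for the total weight.
\<close>

lemma discrete_frostman:
  fixes \<kappa> :: "nat \<Rightarrow> 'a \<Rightarrow> 'b" and h :: "nat \<Rightarrow> real"
  assumes refine: "\<And>i x y. \<kappa> (Suc i) x = \<kappa> (Suc i) y \<Longrightarrow> \<kappa> i x = \<kappa> i y"
    and h: "\<And>i. 0 < h i"
    and "i \<le> J" "finite (\<kappa> J ` S)" "\<And>x y. x \<in> S \<Longrightarrow> y \<in> S \<Longrightarrow> \<kappa> i x = \<kappa> i y"
  shows "\<exists>F w C. finite F \<and> F \<subseteq> S \<and> (\<forall>x. 0 \<le> w x) \<and>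
    (\<forall>k q. i \<le> k \<longrightarrow> k \<le> J \<longrightarrow> (\<Sum>x\<in>{x\<in>F. \<kappa> k x = q}. w x) \<le> h k) \<and>
    finite C \<and> (\<forall>x\<in>S. \<exists>(k, q)\<in>C. \<kappa> k x = q) \<and> (\<Sum>(k, q)\<in>C. h k) \<le> (\<Sum>x\<in>F. w x)"
  using assms(3-5)
proof (induction i arbitrary: S rule: inc_induct)
  case base
  show ?case
  proof (cases "S = {}")
    case True
    show ?thesis by (rule exI[of _ "{}"], rule exI[of _ "\<lambda>_. 0"], rule exI[of _ "{}"])
        (use True h in \<open>auto intro: less_imp_le\<close>)
  next
    case False
    then obtain x0 where x0: "x0 \<in> S" by blast
    have set_eq: "{x \<in> {x0}. \<kappa> k x = q} = (if \<kappa> k x0 = q then {x0} else {})" for k q by auto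
    have mass: "(\<Sum>x\<in>{x \<in> {x0}. \<kappa> k x = q}. h J) \<le> h k" if "J \<le> k" "k \<le> J" for k q
      unfolding set_eq using h[of J] that by simp
    have cov: "\<forall>x\<in>S. \<exists>(k, q)\<in>{(J, \<kappa> J x0)}. \<kappa> k x = q"
    proof
      fix x assume "x \<in> S"
      from base(2)[OF this x0] show "\<exists>(k, q)\<in>{(J, \<kappa> J x0)}. \<kappa> k x = q" by simp
    qed
    show ?thesis
      by (rule exI[of _ "{x0}"], rule exI[of _ "\<lambda>_. h J"], rule exI[of _ "{(J, \<kappa> J x0)}"],
          intro conjI allI impI; (rule cov mass | assumption | use h[of J] x0 in simp)+)
  qed
next
  case (step i)
  define T where "T = \<kappa> (Suc i) ` S"
  have refine_le: "\<kappa> k x = \<kappa> k y" if "k \<le> l" "\<kappa> l x = \<kappa> l y" for k l x y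
    using that by (induction rule: inc_induct) (auto intro: refine)
  have "finite T"
  proof (rule finite_surj[OF step.prems(1)])
    show "T \<subseteq> (\<lambda>q. \<kappa> (Suc i) (SOME x. x \<in> S \<and> \<kappa> J x = q)) ` \<kappa> J ` S"
    proof
      fix p assume "p \<in> T"
      then obtain x where x: "x \<in> S" "p = \<kappa> (Suc i) x" by (auto simp: T_def)
      define y where "y = (SOME y. y \<in> S \<and> \<kappa> J y = \<kappa> J x)"
      have "y \<in> S \<and> \<kappa> J y = \<kappa> J x" unfolding y_def by (rule someI[of _ x]) (use x in auto)
      then have "\<kappa> (Suc i) y = p" using refine_le[of "Suc i" J y x] step.hyps x by simp
      then show "p \<in> (\<lambda>q. \<kappa> (Suc i) (SOME x. x \<in> S \<and> \<kappa> J x = q)) ` \<kappa> J ` S"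
        using x(1) by (intro image_eqI[of _ _ "\<kappa> J x"]) (simp_all only: y_def image_eqI)
    qed
  qed
  define S' where "S' q = {x \<in> S. \<kappa> (Suc i) x = q}" for q
  define good where "good q F w C \<longleftrightarrow> finite F \<and> F \<subseteq> S' q \<and> (\<forall>x. 0 \<le> w x) \<and>
    (\<forall>k p. Suc i \<le> k \<longrightarrow> k \<le> J \<longrightarrow> (\<Sum>x\<in>{x\<in>F. \<kappa> k x = p}. w x) \<le> h k) \<and>
    finite C \<and> (\<forall>x\<in>S' q. \<exists>(k, p)\<in>C. \<kappa> k x = p) \<and> (\<Sum>(k, p)\<in>C. h k) \<le> (\<Sum>x\<in>F. w x)"
    for q F w and C :: "(nat \<times> 'b) set"
  have "\<exists>F w C. good q F w C" for q
  proof -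
    have "finite (\<kappa> J ` S' q)" by (rule finite_subset[OF _ step.prems(1)]) (auto simp: S'_def)
    then show ?thesis unfolding good_def by (rule step.IH) (auto simp: S'_def)
  qed
  then obtain F w C where "good q (F q) (w q) (C q)" for q by metis
  note g = this[unfolded good_def]
  have F: "finite (F q)" "F q \<subseteq> S' q" and w: "0 \<le> w q x"
    and C: "finite (C q)" "(\<Sum>(k, p)\<in>C q. h k) \<le> (\<Sum>x\<in>F q. w q x)" for q x
    using g[of q] by blast+
  have C_cover: "\<exists>(k, p)\<in>C q. \<kappa> k x = p" if "x \<in> S' q" for q x
    using g[of q] that by blast
  have mass: "(\<Sum>x\<in>{x\<in>F q. \<kappa> k x = p}. w q x) \<le> h k" if "Suc i \<le> k" "k \<le> J" for q k p
    using g[of q] that by blast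
  define F' where "F' = (\<Union>q\<in>T. F q)"
  define w' where "w' x = w (\<kappa> (Suc i) x) x" for x
  define m where "m = (\<Sum>x\<in>F'. w' x)"
  have F': "finite F'" "F' \<subseteq> S" using F \<open>finite T\<close> by (auto simp: F'_def S'_def)
  have w': "0 \<le> w' x" for x using w by (simp add: w'_def)
  have key: "\<kappa> (Suc i) x = q" if "x \<in> F q" for x q using F(2)[of q] that by (auto simp: S'_def)
  have w'_eq: "w' x = w q x" if "x \<in> F q" for x q using key[OF that] by (simp add: w'_def)
  have m_eq: "m = (\<Sum>q\<in>T. \<Sum>x\<in>F q. w q x)"
  proof -
    have "m = (\<Sum>q\<in>T. \<Sum>x\<in>F q. w' x)" unfolding m_def F'_def
      by (rule sum.UNION_disjoint) (use \<open>finite T\<close> F key in blast)+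
    also have "\<dots> = (\<Sum>q\<in>T. \<Sum>x\<in>F q. w q x)"
      by (intro sum.cong refl w'_eq)
    finally show ?thesis .
  qed
  have mass': "(\<Sum>x\<in>{x\<in>F'. \<kappa> k x = p}. w' x) \<le> h k" if k: "Suc i \<le> k" "k \<le> J" for k p
  proof (cases "{x\<in>F'. \<kappa> k x = p} = {}")
    case True
    then show ?thesis using less_imp_le[OF h] by (metis sum.empty)
  next
    case False
    then obtain y where y: "y \<in> F'" "\<kappa> k y = p" by blast
    define q where "q = \<kappa> (Suc i) y"
    have "{x\<in>F'. \<kappa> k x = p} = {x\<in>F q. \<kappa> k x = p}"
    proof (intro equalityI subsetI)
      fix x assume x: "x \<in> {x\<in>F'. \<kappa> k x = p}"
      then have "\<kappa> (Suc i) x = q" using refine_le[OF k(1), of x y] y by (simp add: q_def)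
      then show "x \<in> {x\<in>F q. \<kappa> k x = p}" using x key by (auto simp: F'_def)
    next
      fix x assume "x \<in> {x\<in>F q. \<kappa> k x = p}"
      moreover have "q \<in> T" using y key by (auto simp: F'_def q_def)
      ultimately show "x \<in> {x\<in>F'. \<kappa> k x = p}" by (auto simp: F'_def)
    qed
    moreover have "(\<Sum>x\<in>{x\<in>F q. \<kappa> k x = p}. w' x) = (\<Sum>x\<in>{x\<in>F q. \<kappa> k x = p}. w q x)"
      by (intro sum.cong refl w'_eq) simp
    ultimately show ?thesis using mass[OF k, of q p] by simp
  qed
  show ?case
  proof (cases "m \<le> h i")
    case True
    define C' where "C' = (\<Union>q\<in>T. C q)"
    have cov: "\<forall>x\<in>S. \<exists>(k, q)\<in>C'. \<kappa> k x = q"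
    proof
      fix x assume "x \<in> S"
      then have "x \<in> S' (\<kappa> (Suc i) x)" "\<kappa> (Suc i) x \<in> T" by (auto simp: S'_def T_def)
      then show "\<exists>(k, q)\<in>C'. \<kappa> k x = q" using C_cover unfolding C'_def by blast
    qed
    have "(\<Sum>(k, q)\<in>C'. h k) \<le> (\<Sum>q\<in>T. \<Sum>(k, q)\<in>C q. h k)"
      unfolding C'_def case_prod_unfold
      by (rule sum_UN_le) (use \<open>finite T\<close> C(1) h in \<open>auto intro: less_imp_le\<close>)
    also have "\<dots> \<le> m" unfolding m_eq by (intro sum_mono C)
    finally have le: "(\<Sum>(k, q)\<in>C'. h k) \<le> (\<Sum>x\<in>F'. w' x)" by (simp add: m_def)
    have mass'': "(\<Sum>x\<in>{x\<in>F'. \<kappa> k x = p}. w' x) \<le> h k" if k: "i \<le> k" "k \<le> J" for k p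
    proof (cases "k = i")
      case True
      have "(\<Sum>x\<in>{x\<in>F'. \<kappa> k x = p}. w' x) \<le> m"
        unfolding m_def using F' w' by (intro sum_mono2) auto
      then show ?thesis using \<open>m \<le> h i\<close> True by simp
    qed (use mass' k in auto)
    have "finite C'" using \<open>finite T\<close> C(1) by (auto simp: C'_def)
    show ?thesis
      by (rule exI[of _ F'], rule exI[of _ w'], rule exI[of _ C'], intro conjI allI impI;
          (rule F' w' mass'' cov le \<open>finite C'\<close> | assumption)+)
  next
    case False
    then have m: "0 < m" "h i < m" using h[of i] by auto
    define c where "c = h i / m"
    have c: "0 \<le> c" "c \<le> 1" "c * m = h i" using m h[of i] by (auto simp: c_def field_simps intro: less_imp_le)
    define v where "v x = c * w' x" for x
    have sum_v: "(\<Sum>x\<in>X. v x) = c * (\<Sum>x\<in>X. w' x)" for X by (simp add: v_def sum_distrib_left)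
    have mass'': "(\<Sum>x\<in>{x\<in>F'. \<kappa> k x = p}. v x) \<le> h k" if k: "i \<le> k" "k \<le> J" for k p
    proof (cases "k = i")
      case True
      have "(\<Sum>x\<in>{x\<in>F'. \<kappa> k x = p}. w' x) \<le> m"
        unfolding m_def using F' w' by (intro sum_mono2) auto
      then show ?thesis unfolding sum_v True c(3)[symmetric] using c(1) by (rule mult_left_mono)
    next
      case False
      then have "(\<Sum>x\<in>{x\<in>F'. \<kappa> k x = p}. w' x) \<le> h k" using mass' k by auto
      moreover have "0 \<le> (\<Sum>x\<in>{x\<in>F'. \<kappa> k x = p}. w' x)" using w' by (intro sum_nonneg) auto
      ultimately show ?thesis unfolding sum_v using c mult_left_le_one_le by (meson order_trans)
    qed
    have "F' \<noteq> {}" using m by (auto simp: m_def)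
    then obtain x0 where x0: "x0 \<in> S" using F' by blast
    have cov: "\<forall>x\<in>S. \<exists>(k, q)\<in>{(i, \<kappa> i x0)}. \<kappa> k x = q"
    proof
      fix x assume "x \<in> S"
      from step.prems(2)[OF this x0] show "\<exists>(k, q)\<in>{(i, \<kappa> i x0)}. \<kappa> k x = q" by simp
    qed
    have le: "(\<Sum>(k, q)\<in>{(i, \<kappa> i x0)}. h k) \<le> (\<Sum>x\<in>F'. v x)"
      unfolding sum_v using c(3) by (simp add: m_def)
    have v: "0 \<le> v x" for x using c(1) w' by (simp add: v_def)
    show ?thesis
      by (rule exI[of _ F'], rule exI[of _ v], rule exI[of _ "{(i, \<kappa> i x0)}"], intro conjI allI impI;
          (rule F' v mass'' cov le finite.intros | assumption)+)
  qed
qed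

section \<open>Gaussian kernels\<close>

text \<open>
  Up to the factor \<open>sqrt pi\<close>, this is the normal density of variance \<open>v / 2\<close>. The parameter is additive
  under convolution, which makes all integrals below explicit.
\<close>

definition gauss :: "real \<Rightarrow> real \<Rightarrow> real" where
  "gauss v z = exp (- z\<^sup>2 / v) / sqrt v"

lemma gauss_nonneg: "0 < v \<Longrightarrow> 0 \<le> gauss v z" by (simp add: gauss_def)

lemma gauss_minus [simp]: "gauss v (- z) = gauss v z" by (simp add: gauss_def)

lemma gauss_eq_normal_density: "0 < v \<Longrightarrow> gauss v z = sqrt pi * normal_density 0 (sqrt (v / 2)) z"
  by (simp add: gauss_def normal_density_def real_sqrt_mult)

lemma gauss_convolution_0:
  assumes a: "0 < a" and b: "0 < b"
  shows "has_bochner_integral lborel (\<lambda>y. gauss a (c - y) * gauss b y) (sqrt pi * gauss (a + b) c)"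
proof (rule has_bochner_integral_nn_integral)
  have "(\<integral>\<^sup>+y. ennreal (gauss a (c - y) * gauss b y) \<partial>lborel)
      = (\<integral>\<^sup>+y. ennreal pi * ennreal (normal_density 0 (sqrt (a / 2)) (c - y) * normal_density 0 (sqrt (b / 2)) y) \<partial>lborel)"
    by (intro nn_integral_cong) (simp add: gauss_eq_normal_density a b ennreal_mult[symmetric] field_simps)
  also have "\<dots> = ennreal pi * (\<integral>\<^sup>+y. ennreal (normal_density 0 (sqrt (a / 2)) (c - y) * normal_density 0 (sqrt (b / 2)) y) \<partial>lborel)"
    by (rule nn_integral_cmult) simp
  also have "(\<integral>\<^sup>+y. ennreal (normal_density 0 (sqrt (a / 2)) (c - y) * normal_density 0 (sqrt (b / 2)) y) \<partial>lborel)
      = ennreal (normal_density 0 (sqrt ((a + b) / 2)) c)"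
    using fun_cong[OF conv_normal_density_zero_mean[of "sqrt (a / 2)" "sqrt (b / 2)"], of c] a b
    by (simp add: add_divide_distrib)
  also have "ennreal pi * \<dots> = ennreal (sqrt pi * gauss (a + b) c)"
    using a b by (simp add: gauss_eq_normal_density ennreal_mult[symmetric])
  finally show "(\<integral>\<^sup>+y. ennreal (gauss a (c - y) * gauss b y) \<partial>lborel) = ennreal (sqrt pi * gauss (a + b) c)" .
  show "(\<lambda>y. gauss a (c - y) * gauss b y) \<in> borel_measurable lborel"
    unfolding gauss_def by measurable
  show "AE y in lborel. 0 \<le> gauss a (c - y) * gauss b y"
    using a b by (simp add: gauss_nonneg)
qed (use a b gauss_nonneg in auto)

lemma gauss_convolution:
  assumes a: "0 < a" and b: "0 < b"
  shows "has_bochner_integral lborel (\<lambda>y. gauss a (y - p) * gauss b (y - q)) (sqrt pi * gauss (a + b) (p - q))"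
proof -
  have "has_bochner_integral lborel (\<lambda>y. gauss a ((p - q) - (- q + y * 1)) * gauss b (- q + y * 1)) (sqrt pi * gauss (a + b) (p - q))"
    using lborel_has_bochner_integral_real_affine_iff[of 1 "\<lambda>y. gauss a ((p - q) - y) * gauss b y" _ "- q"]
      gauss_convolution_0[OF a b, of "p - q"] by (simp add: mult.commute)
  moreover have "gauss a ((p - q) - (- q + y * 1)) = gauss a (y - p)" for y
    using gauss_minus[of a "y - p"] by simp
  ultimately show ?thesis by simp
qed

text \<open>
  The weight \<open>exp (- x\<^sup>2)\<close> localises to a bounded part of the plane. Integration along the \<open>x\<close>-axis of
  the interaction of two lines whose slopes differ by \<open>\<theta>\<close> is again a convolution of Gaussian kernels,
  and it only adds \<open>\<theta>\<^sup>2\<close> to the parameter.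
\<close>

lemma gauss_affine_integral:
  assumes q: "0 < q"
  shows "has_bochner_integral lborel (\<lambda>x. exp (- x\<^sup>2) * gauss q (\<theta> * x + c)) (sqrt pi * gauss (q + \<theta>\<^sup>2) c)"
proof (cases "\<theta> = 0")
  case True
  have "has_bochner_integral lborel (\<lambda>x. exp (- x\<^sup>2)) (sqrt pi)"
    using has_bochner_integral_even_function[OF gaussian_moment_0] by simp
  then show ?thesis using True by (simp add: has_bochner_integral_mult_left)
next
  case False
  have t2: "0 < \<theta>\<^sup>2" using False by simp
  have "has_bochner_integral lborel (\<lambda>y. gauss q (- c - y) * gauss (\<theta>\<^sup>2) y) (sqrt pi * gauss (q + \<theta>\<^sup>2) (- c))"
    by (rule gauss_convolution_0[OF q t2])
  then have "has_bochner_integral lborel (\<lambda>x. gauss q (- c - (0 + \<theta> * x)) * gauss (\<theta>\<^sup>2) (0 + \<theta> * x))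
      ((sqrt pi * gauss (q + \<theta>\<^sup>2) (- c)) /\<^sub>R \<bar>\<theta>\<bar>)"
    using lborel_has_bochner_integral_real_affine_iff[of \<theta> "\<lambda>y. gauss q (- c - y) * gauss (\<theta>\<^sup>2) y" _ 0] False by blast
  then have "has_bochner_integral lborel (\<lambda>x. \<bar>\<theta>\<bar> * (gauss q (- c - (0 + \<theta> * x)) * gauss (\<theta>\<^sup>2) (0 + \<theta> * x)))
      (\<bar>\<theta>\<bar> * ((sqrt pi * gauss (q + \<theta>\<^sup>2) (- c)) /\<^sub>R \<bar>\<theta>\<bar>))"
    by (rule has_bochner_integral_mult_right) 
  moreover have "\<bar>\<theta>\<bar> * (gauss q (- c - (0 + \<theta> * x)) * gauss (\<theta>\<^sup>2) (0 + \<theta> * x)) = exp (- x\<^sup>2) * gauss q (\<theta> * x + c)" for x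
  proof -
    have "gauss q (- c - (0 + \<theta> * x)) = gauss q (\<theta> * x + c)"
      using gauss_minus[of q "\<theta> * x + c"] by (simp only: minus_add_distrib) (simp add: algebra_simps)
    then show ?thesis using False by (simp add: gauss_def power_mult_distrib)
  qed
  moreover have "\<bar>\<theta>\<bar> * ((sqrt pi * gauss (q + \<theta>\<^sup>2) (- c)) /\<^sub>R \<bar>\<theta>\<bar>) = sqrt pi * gauss (q + \<theta>\<^sup>2) c"
    using False by (simp add: field_simps)
  ultimately show ?thesis by (simp only:)
qed

lemma cube_exp_le: "(1 + x) ^ 3 * exp (- x) \<le> 27" if "0 \<le> x" for x :: real
proof -
  have "(1 + x) / 3 \<le> exp (x / 3)" using exp_ge_add_one_self[of "x / 3"] that by (simp add: field_simps)
  then have "((1 + x) / 3) ^ 3 \<le> exp (x / 3) ^ 3" using that by (intro power_mono) auto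
  also have "\<dots> = exp x" by (simp add: exp_of_nat_mult[symmetric])
  finally show ?thesis by (simp add: exp_minus field_simps power_divide)
qed

lemma gauss_variance_derivative:
  assumes "0 < v"
  shows "((\<lambda>v. gauss v c) has_real_derivative (c\<^sup>2 / v - 1 / 2) * exp (- c\<^sup>2 / v) / (v * sqrt v)) (at v)"
  unfolding gauss_def using assms
  by (auto intro!: derivative_eq_intros simp: field_simps power2_eq_square)

text \<open>
  By the mean value theorem it suffices to bound the derivative in the parameter \<open>v\<close>. With
  \<open>x = c\<^sup>2 / v\<close> it is \<open>(x - 1 / 2) * exp (- x) / (v * sqrt v)\<close>, and the exponential factor absorbs the
  powers of \<open>1 + x\<close> that turn \<open>v * sqrt v\<close> into \<open>sqrt (v + c\<^sup>2) ^ 3\<close>.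
\<close>

lemma gauss_variance_diff_le:
  assumes p: "0 < p" and pq: "p \<le> q"
  shows "\<bar>gauss q c - gauss p c\<bar> \<le> 27 * (q - p) / sqrt (p + c\<^sup>2) ^ 3"
proof -
  have bound: "\<bar>(c\<^sup>2 / v - 1 / 2) * exp (- c\<^sup>2 / v) / (v * sqrt v)\<bar> \<le> 27 / sqrt (p + c\<^sup>2) ^ 3" if v: "p \<le> v" for v
  proof -
    define x where "x = c\<^sup>2 / v"
    have v0: "0 < v" using v p by simp
    have x: "0 \<le> x" using v0 by (simp add: x_def)
    have "sqrt (p + c\<^sup>2) ^ 3 \<le> sqrt (v + c\<^sup>2) ^ 3" using v p by (intro power_mono) auto
    also have "v + c\<^sup>2 = v * (1 + x)" using v0 by (simp add: x_def field_simps)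
    also have "sqrt (v * (1 + x)) ^ 3 = (v * sqrt v) * ((1 + x) * sqrt (1 + x))"
    proof -
      have "sqrt (v * (1 + x)) ^ 3 = (sqrt (v * (1 + x)))\<^sup>2 * sqrt (v * (1 + x))"
        by (simp add: power3_eq_cube power2_eq_square)
      then show ?thesis using v0 x by (simp add: real_sqrt_mult power_mult_distrib)
    qed
    finally have s: "sqrt (p + c\<^sup>2) ^ 3 \<le> (v * sqrt v) * ((1 + x) * sqrt (1 + x))" .
    have "\<bar>x - 1 / 2\<bar> * exp (- x) * sqrt (p + c\<^sup>2) ^ 3
        \<le> \<bar>x - 1 / 2\<bar> * exp (- x) * ((v * sqrt v) * ((1 + x) * sqrt (1 + x)))"
      by (intro mult_left_mono s) auto
    also have "\<dots> \<le> (1 + x) * exp (- x) * ((v * sqrt v) * ((1 + x) * (1 + x)))"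
    proof -
      have "sqrt (1 + x) \<le> 1 + x" using x by (simp add: real_sqrt_le_iff' real_le_lsqrt power2_eq_square)
      then show ?thesis using x v0 by (intro mult_mono mult_left_mono mult_right_mono) auto
    qed
    also have "\<dots> = (v * sqrt v) * ((1 + x) ^ 3 * exp (- x))" by (simp add: power3_eq_cube)
    also have "\<dots> \<le> (v * sqrt v) * 27" using v0 cube_exp_le[OF x] by (intro mult_left_mono) auto
    finally have "\<bar>x - 1 / 2\<bar> * exp (- x) * sqrt (p + c\<^sup>2) ^ 3 \<le> (v * sqrt v) * 27" .
    moreover have "0 < sqrt (p + c\<^sup>2) ^ 3" using p by (simp add: add_pos_nonneg)
    ultimately have "\<bar>x - 1 / 2\<bar> * exp (- x) / (v * sqrt v) \<le> 27 / sqrt (p + c\<^sup>2) ^ 3"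
      using v0 by (simp add: field_simps)
    then show ?thesis using v0 by (simp add: x_def abs_mult abs_divide)
  qed
  show ?thesis
  proof (cases "p = q")
    case False
    then have "p < q" using pq by simp
    then have "\<exists>v>p. v < q \<and> gauss q c - gauss p c
        = (q - p) * ((c\<^sup>2 / v - 1 / 2) * exp (- c\<^sup>2 / v) / (v * sqrt v))"
      by (rule MVT2) (use p in \<open>intro gauss_variance_derivative, simp\<close>)
    then obtain v where v: "p < v" "v < q"
      "gauss q c - gauss p c = (q - p) * ((c\<^sup>2 / v - 1 / 2) * exp (- c\<^sup>2 / v) / (v * sqrt v))"
      by blast
    have "\<bar>gauss q c - gauss p c\<bar> = (q - p) * \<bar>(c\<^sup>2 / v - 1 / 2) * exp (- c\<^sup>2 / v) / (v * sqrt v)\<bar>"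
      using \<open>p < q\<close> by (simp only: v(3) abs_mult)
    also have "\<dots> \<le> (q - p) * (27 / sqrt (p + c\<^sup>2) ^ 3)"
      using v pq by (intro mult_left_mono bound) auto
    finally show ?thesis by (simp only: times_divide_eq_right mult.commute)
  qed simp
qed

section \<open>Energy of the line density\<close>

text \<open>
  A pair \<open>e\<close> stands for the line \<open>y = fst e * x + snd e\<close>. The sum is a smoothed
  version of the mass of the lines in \<open>F\<close> that pass within vertical distance \<open>sqrt v\<close> of \<open>(x, y)\<close>,
  divided by \<open>sqrt v\<close>.
\<close>

definition line_density :: "(real \<times> real) set \<Rightarrow> (real \<times> real \<Rightarrow> real) \<Rightarrow> real \<Rightarrow> real \<Rightarrow> real \<Rightarrow> real" where
  "line_density F w v x y = (\<Sum>e\<in>F. w e * gauss v (y - fst e * x - snd e))"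

text \<open>
  On a vertical line each summand is a Gaussian bump, so the square integral is a double sum of
  convolutions evaluated at the distance of the two bumps.
\<close>

lemma line_density_diff_square_integral:
  assumes a: "0 < a" and b: "0 < b"
  shows "has_bochner_integral lborel (\<lambda>y. (line_density F w a x y - line_density F w b x y)\<^sup>2)
    (\<Sum>e\<in>F. \<Sum>f\<in>F. w e * w f * (sqrt pi *
      (gauss (2 * a) ((fst e - fst f) * x + (snd e - snd f))
       - 2 * gauss (a + b) ((fst e - fst f) * x + (snd e - snd f))
       + gauss (2 * b) ((fst e - fst f) * x + (snd e - snd f)))))"
proof -
  define p where "p e = fst e * x + snd e" for e :: "real \<times> real"
  have sq: "(line_density F w a x y - line_density F w b x y)\<^sup>2 = (\<Sum>e\<in>F. \<Sum>f\<in>F. w e * w f *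
      (gauss a (y - p e) * gauss a (y - p f) - gauss a (y - p e) * gauss b (y - p f)
       - gauss b (y - p e) * gauss a (y - p f) + gauss b (y - p e) * gauss b (y - p f)))" for y
  proof -
    have eq: "line_density F w a x y - line_density F w b x y = (\<Sum>e\<in>F. w e * (gauss a (y - p e) - gauss b (y - p e)))"
      unfolding line_density_def sum_subtractf[symmetric] by (simp add: p_def algebra_simps)
    show ?thesis
      unfolding eq power2_eq_square sum_product
      by (intro sum.cong refl, simp add: algebra_simps)
  qed
  have "has_bochner_integral lborel (\<lambda>y. \<Sum>e\<in>F. \<Sum>f\<in>F. w e * w f *
      (gauss a (y - p e) * gauss a (y - p f) - gauss a (y - p e) * gauss b (y - p f)
       - gauss b (y - p e) * gauss a (y - p f) + gauss b (y - p e) * gauss b (y - p f)))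
     (\<Sum>e\<in>F. \<Sum>f\<in>F. w e * w f * (sqrt pi * gauss (a + a) (p e - p f) - sqrt pi * gauss (a + b) (p e - p f)
       - sqrt pi * gauss (b + a) (p e - p f) + sqrt pi * gauss (b + b) (p e - p f)))"
    by (intro has_bochner_integral_sum has_bochner_integral_mult_right has_bochner_integral_add
        has_bochner_integral_diff gauss_convolution a b)
  moreover have "p e - p f = (fst e - fst f) * x + (snd e - snd f)" for e f
    by (simp add: p_def algebra_simps)
  moreover have "sqrt pi * gauss (a + a) z - sqrt pi * gauss (a + b) z - sqrt pi * gauss (b + a) z + sqrt pi * gauss (b + b) z
      = sqrt pi * (gauss (2 * a) z - 2 * gauss (a + b) z + gauss (2 * b) z)" for z
    by (simp add: algebra_simps)
  ultimately show ?thesis unfolding sq by (simp only:)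
qed

lemma line_density_energy_integral:
  assumes a: "0 < a" and b: "0 < b"
  shows "has_bochner_integral lborel
    (\<lambda>x. exp (- x\<^sup>2) * (\<Sum>e\<in>F. \<Sum>f\<in>F. w e * w f * (sqrt pi *
      (gauss (2 * a) ((fst e - fst f) * x + (snd e - snd f))
       - 2 * gauss (a + b) ((fst e - fst f) * x + (snd e - snd f))
       + gauss (2 * b) ((fst e - fst f) * x + (snd e - snd f))))))
    (pi * (\<Sum>e\<in>F. \<Sum>f\<in>F. w e * w f *
      (gauss (2 * a + (fst e - fst f)\<^sup>2) (snd e - snd f)
       - 2 * gauss (a + b + (fst e - fst f)\<^sup>2) (snd e - snd f)
       + gauss (2 * b + (fst e - fst f)\<^sup>2) (snd e - snd f))))"
proof -
  let ?q = "\<lambda>v x e f. exp (- x\<^sup>2) * gauss v ((fst e - fst f) * x + (snd e - snd f))"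
  let ?k = "\<lambda>v e f. sqrt pi * gauss (v + (fst e - fst f)\<^sup>2) (snd e - snd f)"
  have "has_bochner_integral lborel
      (\<lambda>x. \<Sum>e\<in>F. \<Sum>f\<in>F. w e * w f * (sqrt pi * (?q (2 * a) x e f - 2 * ?q (a + b) x e f + ?q (2 * b) x e f)))
      (\<Sum>e\<in>F. \<Sum>f\<in>F. w e * w f * (sqrt pi * (?k (2 * a) e f - 2 * ?k (a + b) e f + ?k (2 * b) e f)))"
    by (intro has_bochner_integral_sum has_bochner_integral_mult_right has_bochner_integral_add
        has_bochner_integral_diff gauss_affine_integral) (use a b in auto)
  moreover have "(\<Sum>e\<in>F. \<Sum>f\<in>F. w e * w f * (sqrt pi * (?q (2 * a) x e f - 2 * ?q (a + b) x e f + ?q (2 * b) x e f)))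
     = exp (- x\<^sup>2) * (\<Sum>e\<in>F. \<Sum>f\<in>F. w e * w f * (sqrt pi *
      (gauss (2 * a) ((fst e - fst f) * x + (snd e - snd f))
       - 2 * gauss (a + b) ((fst e - fst f) * x + (snd e - snd f))
       + gauss (2 * b) ((fst e - fst f) * x + (snd e - snd f)))))" for x
    unfolding sum_distrib_left by (intro sum.cong refl) (simp add: algebra_simps)
  moreover have "(\<Sum>e\<in>F. \<Sum>f\<in>F. w e * w f * (sqrt pi * (?k (2 * a) e f - 2 * ?k (a + b) e f + ?k (2 * b) e f)))
    = pi * (\<Sum>e\<in>F. \<Sum>f\<in>F. w e * w f *
      (gauss (2 * a + (fst e - fst f)\<^sup>2) (snd e - snd f)
       - 2 * gauss (a + b + (fst e - fst f)\<^sup>2) (snd e - snd f)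
       + gauss (2 * b + (fst e - fst f)\<^sup>2) (snd e - snd f)))"
  proof -
    have "sqrt pi * (sqrt pi * x - 2 * (sqrt pi * y) + sqrt pi * z) = pi * (x - 2 * y + z)" for x y z
    proof -
      have "sqrt pi * (sqrt pi * x - 2 * (sqrt pi * y) + sqrt pi * z) = (sqrt pi * sqrt pi) * (x - 2 * y + z)"
        by (simp only: algebra_simps)
      then show ?thesis by simp
    qed
    then show ?thesis
      unfolding sum_distrib_left by (intro sum.cong refl) (simp only: mult.left_commute)
  qed
  ultimately show ?thesis by (simp only:)
qed

text \<open>
  This is where the cancellation enters. The interaction of two lines in the second moment of a
  difference of densities is a second difference in the parameter of the Gaussian kernel. Already the
  bound for first differences gives a decay of order \<open>3\<close> in the distance \<open>(\<theta>, c)\<close> of the two lines,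
  which is sufficient because the lines have dimension \<open>\<tau> < 2\<close>.
\<close>

lemma gauss_second_difference_le:
  assumes "0 < a" "a \<le> b"
  shows "gauss (2 * a + \<theta>\<^sup>2) c - 2 * gauss (a + b + \<theta>\<^sup>2) c + gauss (2 * b + \<theta>\<^sup>2) c
    \<le> 54 * (b - a) / sqrt (2 * a + \<theta>\<^sup>2 + c\<^sup>2) ^ 3"
proof -
  define p where "p = 2 * a + \<theta>\<^sup>2"
  have p: "0 < p" using assms by (simp add: p_def add_pos_nonneg)
  have mono: "27 * d / sqrt (p' + c\<^sup>2) ^ 3 \<le> 27 * d / sqrt (p + c\<^sup>2) ^ 3" if "p \<le> p'" "0 \<le> d" for p' d
    using p that by (intro divide_left_mono power_mono mult_pos_pos zero_less_power) (auto simp: add_pos_nonneg)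
  have "\<bar>gauss (a + b + \<theta>\<^sup>2) c - gauss p c\<bar> \<le> 27 * (b - a) / sqrt (p + c\<^sup>2) ^ 3"
    using gauss_variance_diff_le[of p "a + b + \<theta>\<^sup>2" c] p assms by (simp add: p_def)
  moreover have "\<bar>gauss (2 * b + \<theta>\<^sup>2) c - gauss (a + b + \<theta>\<^sup>2) c\<bar> \<le> 27 * (b - a) / sqrt (a + b + \<theta>\<^sup>2 + c\<^sup>2) ^ 3"
    using gauss_variance_diff_le[of "a + b + \<theta>\<^sup>2" "2 * b + \<theta>\<^sup>2" c] assms by (simp add: add_pos_nonneg)
  moreover have "27 * (b - a) / sqrt (a + b + \<theta>\<^sup>2 + c\<^sup>2) ^ 3 \<le> 27 * (b - a) / sqrt (p + c\<^sup>2) ^ 3"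
    using assms by (intro mono) (auto simp: p_def)
  ultimately have "gauss p c - 2 * gauss (a + b + \<theta>\<^sup>2) c + gauss (2 * b + \<theta>\<^sup>2) c \<le> 2 * (27 * (b - a) / sqrt (p + c\<^sup>2) ^ 3)"
    by linarith
  then show ?thesis by (simp add: p_def)
qed

text \<open>
  Names of the half-open squares of side \<open>1 / B ^ i\<close>. They partition the plane of points as well as the
  plane of parameters \<open>(slope, intercept)\<close> of lines.
\<close>

definition cell :: "nat \<Rightarrow> nat \<Rightarrow> real \<times> real \<Rightarrow> int \<times> int" where
  "cell B i e = (\<lfloor>real B ^ i * fst e\<rfloor>, \<lfloor>real B ^ i * snd e\<rfloor>)"

lemma floor_mult_nat_div:
  assumes "0 < B"
  shows "\<lfloor>x\<rfloor> = \<lfloor>real B * x\<rfloor> div int B"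
proof -
  have "\<lfloor>(real B * x) / real_of_int (int B)\<rfloor> = \<lfloor>real B * x\<rfloor> div int B"
    by (rule floor_divide_real_eq_div) simp
  then show ?thesis using assms by simp
qed

lemma cell_refine:
  assumes "0 < B" "cell B (Suc i) x = cell B (Suc i) y"
  shows "cell B i x = cell B i y"
  using assms floor_mult_nat_div[OF assms(1), of "real B ^ i * fst x"]
    floor_mult_nat_div[OF assms(1), of "real B ^ i * fst y"]
    floor_mult_nat_div[OF assms(1), of "real B ^ i * snd x"]
    floor_mult_nat_div[OF assms(1), of "real B ^ i * snd y"]
  by (simp add: cell_def mult.assoc)

lemma floor_near:
  fixes x y N :: real
  assumes "0 < N" "\<bar>x - y\<bar> < 1 / N"
  shows "\<lfloor>N * y\<rfloor> \<in> {\<lfloor>N * x\<rfloor> - 1, \<lfloor>N * x\<rfloor>, \<lfloor>N * x\<rfloor> + 1}"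
proof -
  have "N * \<bar>x - y\<bar> < 1" using assms by (simp add: field_simps)
  moreover have "N * \<bar>x - y\<bar> = \<bar>N * x - N * y\<bar>" using assms(1) by (simp add: abs_mult right_diff_distrib[symmetric])
  ultimately show ?thesis by simp linarith
qed

lemma same_floor_dist:
  fixes x y N :: real
  assumes "0 < N" "\<lfloor>N * x\<rfloor> = \<lfloor>N * y\<rfloor>"
  shows "\<bar>x - y\<bar> < 1 / N"
proof -
  have "\<bar>N * x - N * y\<bar> < 1" using assms(2) by linarith
  moreover have "N * \<bar>x - y\<bar> = \<bar>N * x - N * y\<bar>" using assms(1) by (simp add: abs_mult right_diff_distrib[symmetric])
  ultimately show ?thesis using assms(1) by (simp add: field_simps)
qed

text \<open>
  A discrete \<open>\<tau>\<close>-dimensional measure on lines at scale \<open>1 / B ^ J\<close>. All parameters lie in one unit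
  square, so that the total mass is at most \<open>1\<close> and only distances below \<open>1\<close> occur.
\<close>

locale frostman_weights =
  fixes B J :: nat and \<tau> :: real and F :: "(real \<times> real) set" and w :: "real \<times> real \<Rightarrow> real"
  assumes B: "2 \<le> B" and tau: "0 < \<tau>" "\<tau> < 2" and fin: "finite F" and w: "\<And>e. 0 \<le> w e"
    and mass: "\<And>k q. k \<le> J \<Longrightarrow> (\<Sum>e\<in>{e\<in>F. cell B k e = q}. w e) \<le> real B powr (- (\<tau> * real k))"
    and unit_cell: "\<And>e f. e \<in> F \<Longrightarrow> f \<in> F \<Longrightarrow> cell B 0 e = cell B 0 f"
    and slope: "\<And>e. e \<in> F \<Longrightarrow> \<bar>fst e\<bar> \<le> 1"
begin

lemma Bpos: "0 < real B" using B by simp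

lemma total_le_1: "(\<Sum>e\<in>F. w e) \<le> 1"
proof (cases "F = {}")
  case False
  then obtain e where e: "e \<in> F" by blast
  have "F = {f\<in>F. cell B 0 f = cell B 0 e}" using unit_cell[OF _ e] by blast
  then show ?thesis using mass[of 0 "cell B 0 e"] B by simp
qed simp

lemma mass_near:
  assumes "k \<le> J"
  shows "(\<Sum>f\<in>{f\<in>F. \<bar>fst e - fst f\<bar> < 1 / real B ^ k \<and> \<bar>snd e - snd f\<bar> < 1 / real B ^ k}. w f)
    \<le> 9 * real B powr (- (\<tau> * real k))"
proof -
  let ?a = "\<lfloor>real B ^ k * fst e\<rfloor>" and ?b = "\<lfloor>real B ^ k * snd e\<rfloor>"
  let ?Q = "{?a - 1, ?a, ?a + 1} \<times> {?b - 1, ?b, ?b + 1}"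
  have "{f\<in>F. \<bar>fst e - fst f\<bar> < 1 / real B ^ k \<and> \<bar>snd e - snd f\<bar> < 1 / real B ^ k}
      \<subseteq> (\<Union>q\<in>?Q. {f\<in>F. cell B k f = q})"
  proof
    fix f assume f: "f \<in> {f\<in>F. \<bar>fst e - fst f\<bar> < 1 / real B ^ k \<and> \<bar>snd e - snd f\<bar> < 1 / real B ^ k}"
    have "0 < real B ^ k" using Bpos by simp
    then have "cell B k f \<in> ?Q"
      unfolding cell_def using f floor_near[of "real B ^ k"] by (intro SigmaI) blast+
    then show "f \<in> (\<Union>q\<in>?Q. {f\<in>F. cell B k f = q})" using f by blast
  qed
  then have "(\<Sum>f\<in>{f\<in>F. \<bar>fst e - fst f\<bar> < 1 / real B ^ k \<and> \<bar>snd e - snd f\<bar> < 1 / real B ^ k}. w f)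
      \<le> (\<Sum>f\<in>(\<Union>q\<in>?Q. {f\<in>F. cell B k f = q}). w f)"
    using fin w by (intro sum_mono2) auto
  also have "\<dots> \<le> (\<Sum>q\<in>?Q. \<Sum>f\<in>{f\<in>F. cell B k f = q}. w f)"
    using fin w by (intro sum_UN_le) auto
  also have "\<dots> \<le> (\<Sum>q\<in>?Q. real B powr (- (\<tau> * real k)))"
    using mass[OF assms] by (intro sum_mono) auto
  also have "\<dots> = 9 * real B powr (- (\<tau> * real k))"
    by (simp add: card_cartesian_product)
  finally show ?thesis .
qed

text \<open>
  A majorant of \<open>1 / p ^ 3\<close> by powers of \<open>B\<close> that turns the kernel sum into a sum over scales of masses of
  balls. Here \<open>p\<close> plays the role of \<open>r + d\<close> with \<open>r = 1 / B ^ i\<close>.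
\<close>

lemma inverse_cube_le_scales:
  fixes p d :: real
  assumes p: "1 / real B ^ i \<le> p" and d: "d \<le> p" "d < 1"
  shows "1 / p ^ 3 \<le> (\<Sum>k\<le>i. if d < 1 / real B ^ k then real B ^ (3 * (k + 1)) else 0)"
  using p
proof (induction i)
  case 0
  then have "1 / p ^ 3 \<le> 1" by simp
  also have "1 \<le> real B ^ 3" using B by simp
  finally show ?case using d by simp
next
  case (Suc i)
  let ?g = "\<lambda>k. if d < 1 / real B ^ k then real B ^ (3 * (k + 1)) else 0"
  have nn: "0 \<le> (\<Sum>k\<le>i. ?g k)" by (intro sum_nonneg) simp
  show ?case
  proof (cases "d < 1 / real B ^ Suc i")
    case True
    have pos: "0 < 1 / real B ^ Suc i" using Bpos by simp
    have p0: "0 < p" by (rule order_less_le_trans[OF pos Suc.prems])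
    have "1 / p \<le> 1 / (1 / real B ^ Suc i)"
      by (intro divide_left_mono Suc.prems mult_pos_pos p0 pos) simp
    then have "1 / p \<le> real B ^ Suc i" by simp
    then have "(1 / p) ^ 3 \<le> (real B ^ Suc i) ^ 3"
      using p0 by (intro power_mono) auto
    also have "\<dots> = real B ^ (3 * Suc i)" by (simp only: power_mult[symmetric] mult.commute)
    also have "\<dots> \<le> real B ^ (3 * (Suc i + 1))" using B by (intro power_increasing) auto
    finally have "1 / p ^ 3 \<le> ?g (Suc i)" using True by (simp add: power_one_over)
    then show ?thesis using nn by simp
  next
    case False
    show ?thesis
    proof (cases "1 / real B ^ i \<le> p")
      case True
      have "0 \<le> ?g (Suc i)" by simp
      then show ?thesis unfolding sum.atMost_Suc using Suc.IH[OF True] by linarith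
    next
      case False': False
      have pos: "0 < 1 / real B ^ Suc i" using Bpos by simp
      have "d < 1 / real B ^ i" using False' d by linarith
      have p0: "0 < p" by (rule order_less_le_trans[OF pos Suc.prems])
      have "1 / p \<le> 1 / (1 / real B ^ Suc i)"
        by (intro divide_left_mono Suc.prems mult_pos_pos p0 pos) simp
      then have "1 / p \<le> real B ^ Suc i" by simp
      then have "(1 / p) ^ 3 \<le> (real B ^ Suc i) ^ 3"
        using p0 by (intro power_mono) auto
      also have "\<dots> = real B ^ (3 * (i + 1))" by (simp only: power_mult[symmetric] mult.commute Suc_eq_plus1)
      finally have "1 / p ^ 3 \<le> ?g i" using \<open>d < 1 / real B ^ i\<close> by (simp add: power_one_over)
      also have "?g i \<le> (\<Sum>k\<le>i. ?g k)" by (rule member_le_sum) auto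
      also have "\<dots> \<le> (\<Sum>k\<le>Suc i. ?g k)" by (rule sum_mono2) auto
      finally show ?thesis .
    qed
  qed
qed

text \<open>
  The ball of radius \<open>B\<^bsup>-k\<^esup>\<close> contributes \<open>B\<^bsup>3(k+1)\<^esup> B\<^bsup>-\<tau>k\<^esup>\<close>. As \<open>\<tau> < 2\<close>, these terms
  grow geometrically with ratio at least \<open>2\<close>, and the smallest ball dominates.
\<close>

lemma kernel_sum_le:
  assumes i: "i \<le> J" and e: "e \<in> F" and p: "(1 / real B ^ i)\<^sup>2 \<le> p"
  shows "(\<Sum>f\<in>F. w f / sqrt (p + (fst e - fst f)\<^sup>2 + (snd e - snd f)\<^sup>2) ^ 3)
    \<le> 18 * real B ^ 3 * (real B powr (3 - \<tau>)) ^ i"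
proof -
  define d where "d f = max \<bar>fst e - fst f\<bar> \<bar>snd e - snd f\<bar>" for f :: "real \<times> real"
  have pointwise: "w f / sqrt (p + (fst e - fst f)\<^sup>2 + (snd e - snd f)\<^sup>2) ^ 3
     \<le> (\<Sum>k\<le>i. real B ^ (3 * (k + 1)) * (if d f < 1 / real B ^ k then w f else 0))" if f: "f \<in> F" for f
  proof -
    let ?p = "sqrt (p + (fst e - fst f)\<^sup>2 + (snd e - snd f)\<^sup>2)"
    have p0: "0 \<le> p" using p by (meson order_trans zero_le_power2)
    have "1 / real B ^ i \<le> ?p" using p Bpos by (intro real_le_rsqrt) (simp add: add_increasing2)
    moreover have "\<bar>fst e - fst f\<bar> \<le> ?p" "\<bar>snd e - snd f\<bar> \<le> ?p" using p0 by (auto intro!: real_le_rsqrt)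
    moreover have "d f < 1"
      using unit_cell[OF e f] same_floor_dist[of 1 "fst e" "fst f"] same_floor_dist[of 1 "snd e" "snd f"]
      by (simp add: d_def cell_def)
    ultimately have "1 / ?p ^ 3 \<le> (\<Sum>k\<le>i. if d f < 1 / real B ^ k then real B ^ (3 * (k + 1)) else 0)"
      by (intro inverse_cube_le_scales) (auto simp: d_def)
    then have "w f * (1 / ?p ^ 3) \<le> w f * (\<Sum>k\<le>i. if d f < 1 / real B ^ k then real B ^ (3 * (k + 1)) else 0)"
      using w by (intro mult_left_mono) auto
    also have "\<dots> = (\<Sum>k\<le>i. real B ^ (3 * (k + 1)) * (if d f < 1 / real B ^ k then w f else 0))"
      unfolding sum_distrib_left by (intro sum.cong refl) simp
    finally show ?thesis by simp
  qed
  have "(\<Sum>f\<in>F. w f / sqrt (p + (fst e - fst f)\<^sup>2 + (snd e - snd f)\<^sup>2) ^ 3)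
     \<le> (\<Sum>f\<in>F. \<Sum>k\<le>i. real B ^ (3 * (k + 1)) * (if d f < 1 / real B ^ k then w f else 0))"
    by (intro sum_mono pointwise)
  also have "\<dots> = (\<Sum>k\<le>i. real B ^ (3 * (k + 1)) * (\<Sum>f\<in>F. if d f < 1 / real B ^ k then w f else 0))"
    by (subst sum.swap) (simp add: sum_distrib_left)
  also have "\<dots> \<le> (\<Sum>k\<le>i. real B ^ (3 * (k + 1)) * (9 * real B powr (- (\<tau> * real k))))"
  proof (intro sum_mono mult_left_mono)
    fix k assume "k \<in> {..i}"
    then have k: "k \<le> J" using i by simp
    have "(\<Sum>f\<in>F. if d f < 1 / real B ^ k then w f else 0) = (\<Sum>f\<in>{f\<in>F. d f < 1 / real B ^ k}. w f)"
      using fin by (simp add: sum.inter_filter)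
    also have "\<dots> \<le> 9 * real B powr (- (\<tau> * real k))"
      using mass_near[OF k, of e] by (simp add: d_def)
    finally show "(\<Sum>f\<in>F. if d f < 1 / real B ^ k then w f else 0) \<le> 9 * real B powr (- (\<tau> * real k))" .
  qed simp
  also have "\<dots> = 9 * real B ^ 3 * (\<Sum>k\<le>i. (real B powr (3 - \<tau>)) ^ k)"
    unfolding sum_distrib_left
  proof (intro sum.cong refl)
    fix k
    have "(real B powr (3 - \<tau>)) ^ k = real B powr (real (3 * k)) * real B powr (- (\<tau> * real k))"
      using Bpos by (simp add: powr_realpow[symmetric] powr_powr powr_add[symmetric] algebra_simps)
    also have "real B powr (real (3 * k)) = real B ^ (3 * k)" by (rule powr_realpow[OF Bpos])
    finally show "real B ^ (3 * (k + 1)) * (9 * real B powr (- (\<tau> * real k))) = 9 * real B ^ 3 * (real B powr (3 - \<tau>)) ^ k"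
      by (simp add: power_add)
  qed
  also have "\<dots> \<le> 9 * real B ^ 3 * (2 * (real B powr (3 - \<tau>)) ^ i)"
  proof (intro mult_left_mono)
    define x where "x = real B powr (3 - \<tau>)"
    have "real B powr 1 \<le> real B powr (3 - \<tau>)" using B tau by (intro powr_mono) auto
    then have x: "2 \<le> x" using B by (simp add: x_def)
    show "(\<Sum>k\<le>i. x ^ k) \<le> 2 * x ^ i"
    proof (induction i)
      case (Suc i)
      have "2 * x ^ i \<le> x * x ^ i" using x by (intro mult_right_mono) auto
      then show ?case using Suc by simp
    qed simp
  qed simp
  finally show ?thesis by simp
qed

lemma energy_le:
  assumes i: "i \<le> J" and a: "0 < a" "a \<le> b" "(1 / real B ^ i)\<^sup>2 \<le> 2 * a"
  shows "(\<Sum>e\<in>F. \<Sum>f\<in>F. w e * w f *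
      (gauss (2 * a + (fst e - fst f)\<^sup>2) (snd e - snd f)
       - 2 * gauss (a + b + (fst e - fst f)\<^sup>2) (snd e - snd f)
       + gauss (2 * b + (fst e - fst f)\<^sup>2) (snd e - snd f)))
    \<le> 972 * (b - a) * real B ^ 3 * (real B powr (3 - \<tau>)) ^ i"
proof -
  let ?S = "18 * real B ^ 3 * (real B powr (3 - \<tau>)) ^ i"
  have "(\<Sum>e\<in>F. \<Sum>f\<in>F. w e * w f *
      (gauss (2 * a + (fst e - fst f)\<^sup>2) (snd e - snd f)
       - 2 * gauss (a + b + (fst e - fst f)\<^sup>2) (snd e - snd f)
       + gauss (2 * b + (fst e - fst f)\<^sup>2) (snd e - snd f)))
    \<le> (\<Sum>e\<in>F. \<Sum>f\<in>F. w e * w f * (54 * (b - a) / sqrt (2 * a + (fst e - fst f)\<^sup>2 + (snd e - snd f)\<^sup>2) ^ 3))"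
    by (intro sum_mono mult_left_mono gauss_second_difference_le a mult_nonneg_nonneg w)
  also have "\<dots> = 54 * (b - a) * (\<Sum>e\<in>F. w e * (\<Sum>f\<in>F. w f / sqrt (2 * a + (fst e - fst f)\<^sup>2 + (snd e - snd f)\<^sup>2) ^ 3))"
    unfolding sum_distrib_left by (intro sum.cong refl) simp
  also have "\<dots> \<le> 54 * (b - a) * (\<Sum>e\<in>F. w e * ?S)"
    using a by (intro mult_left_mono sum_mono kernel_sum_le i w) auto
  also have "(\<Sum>e\<in>F. w e * ?S) = (\<Sum>e\<in>F. w e) * ?S" by (simp only: sum_distrib_right)
  also have "54 * (b - a) * ((\<Sum>e\<in>F. w e) * ?S) \<le> 54 * (b - a) * (1 * ?S)"
    using a by (intro mult_left_mono mult_right_mono total_le_1) auto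
  also have "\<dots> = 972 * (b - a) * real B ^ 3 * (real B powr (3 - \<tau>)) ^ i"
    by (simp add: algebra_simps)
  finally show ?thesis .
qed

end

section \<open>Points of high line density\<close>

text \<open>
  Gaussian kernels satisfy a Harnack inequality only at the expense of a larger parameter:
  \<open>(z + h)\<^sup>2 \<le> 2 z\<^sup>2 + 2 h\<^sup>2\<close>, and the factor \<open>2\<close> is compensated by replacing \<open>v\<close> with \<open>2 v\<close>.
\<close>

lemma gauss_harnack:
  assumes v: "0 < v" and h: "\<bar>h\<bar> \<le> sqrt v / 2"
  shows "gauss v z \<le> 2 * gauss (2 * v) (z + h)"
proof -
  have h2: "h\<^sup>2 \<le> v / 4"
  proof -
    have "\<bar>h\<bar>\<^sup>2 \<le> (sqrt v / 2)\<^sup>2" using h by (intro power_mono) auto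
    then show ?thesis using v by (simp add: power_divide)
  qed
  have "0 \<le> (z - h)\<^sup>2" by simp
  then have "(z + h)\<^sup>2 \<le> 2 * z\<^sup>2 + 2 * h\<^sup>2" by (simp add: power2_sum power2_diff)
  then have "(z + h)\<^sup>2 \<le> 2 * z\<^sup>2 + v / 2" using h2 by linarith
  then have "(z + h)\<^sup>2 / (2 * v) \<le> (2 * z\<^sup>2 + v / 2) / (2 * v)"
    using v by (intro divide_right_mono) auto
  also have "\<dots> = z\<^sup>2 / v + 1 / 4" using v by (simp add: field_simps)
  finally have "- (z\<^sup>2 / v) \<le> 1 / 4 + - ((z + h)\<^sup>2 / (2 * v))" by linarith
  then have "exp (- (z\<^sup>2 / v)) \<le> exp (1 / 4) * exp (- ((z + h)\<^sup>2 / (2 * v)))"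
    unfolding exp_add[symmetric] exp_le_cancel_iff .
  also have "\<dots> \<le> sqrt 2 * exp (- ((z + h)\<^sup>2 / (2 * v)))"
  proof (intro mult_right_mono)
    have "exp (1 / 4 :: real) ^ 4 = exp 1" by (simp add: exp_of_nat_mult[symmetric])
    also have "\<dots> \<le> 4" using exp_le by simp
    also have "(4::real) = sqrt 2 ^ 4" using real_sqrt_pow2[of 2] by (simp add: power4_eq_xxxx)
    finally show "exp (1 / 4 :: real) \<le> sqrt 2" using power_mono_iff[of "exp (1 / 4 :: real)" "sqrt 2" 4] by simp
  qed simp
  finally have "exp (- (z\<^sup>2 / v)) / sqrt v \<le> sqrt 2 * exp (- ((z + h)\<^sup>2 / (2 * v))) / sqrt v"
    using v by (intro divide_right_mono) auto
  also have "\<dots> = 2 * (exp (- ((z + h)\<^sup>2 / (2 * v))) / (sqrt 2 * sqrt v))"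
  proof -
    have "sqrt 2 = 2 / sqrt (2::real)" by (simp add: real_div_sqrt)
    then show ?thesis by (metis times_divide_eq_right times_divide_eq_left divide_divide_eq_left mult.commute)
  qed
  finally show ?thesis by (simp add: gauss_def real_sqrt_mult)
qed

lemma has_bochner_integral_le:
  fixes f g :: "real \<Rightarrow> real"
  assumes "has_bochner_integral M f a" "has_bochner_integral M g b" "\<And>x. f x \<le> g x"
  shows "a \<le> b"
  using integral_mono[of M f g] assms
  by (metis has_bochner_integral_iff)

lemma floor_eq_indicator:
  fixes N :: real
  assumes "0 < N"
  shows "(if \<lfloor>N * x\<rfloor> = a then 1 else 0) = (indicator {real_of_int a / N ..< (real_of_int a + 1) / N} x :: real)"
proof -
  have "\<lfloor>N * x\<rfloor> = a \<longleftrightarrow> real_of_int a \<le> N * x \<and> N * x < real_of_int a + 1" by linarith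
  also have "\<dots> \<longleftrightarrow> x \<in> {real_of_int a / N ..< (real_of_int a + 1) / N}"
    using assms by (simp add: field_simps)
  finally show ?thesis by (simp add: indicator_def)
qed

lemma floor_cell_integral:
  fixes N :: real
  assumes "0 < N"
  shows "has_bochner_integral lborel (\<lambda>x. if \<lfloor>N * x\<rfloor> = a then 1 else 0 :: real) (1 / N)"
proof -
  have le: "real_of_int a / N \<le> (real_of_int a + 1) / N" using assms by (intro divide_right_mono) auto
  then have "measure lborel {real_of_int a / N ..< (real_of_int a + 1) / N} = 1 / N"
    by (simp add: add_divide_distrib)
  moreover have "has_bochner_integral lborel (indicator {real_of_int a / N ..< (real_of_int a + 1) / N} :: real \<Rightarrow> real)
      (measure lborel {real_of_int a / N ..< (real_of_int a + 1) / N})"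
    by (rule has_bochner_integral_real_indicator) (use le in simp_all)
  ultimately show ?thesis unfolding floor_eq_indicator[OF assms] by simp
qed

definition graph :: "real \<times> real \<Rightarrow> (real \<times> real) set" where
  "graph e = {p. snd p = fst e * fst p + snd e}"

context frostman_weights
begin

lemma slope_diff:
  assumes "e \<in> F" "\<bar>x - x'\<bar> \<le> d" "\<bar>y - y'\<bar> \<le> d"
  shows "\<bar>(y' - fst e * x' - snd e) - (y - fst e * x - snd e)\<bar> \<le> 2 * d"
proof -
  have "\<bar>fst e * (x - x')\<bar> \<le> 1 * d" unfolding abs_mult using assms slope[of e] by (intro mult_mono) auto
  moreover have "(y' - fst e * x' - snd e) - (y - fst e * x - snd e) = fst e * (x - x') - (y - y')"
    by (simp add: algebra_simps)
  ultimately show ?thesis using assms by linarith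
qed

lemma line_density_harnack:
  assumes v: "0 < v" and d: "\<bar>x - x'\<bar> \<le> sqrt v / 4" "\<bar>y - y'\<bar> \<le> sqrt v / 4"
  shows "line_density F w v x y \<le> 2 * line_density F w (2 * v) x' y'"
  unfolding line_density_def sum_distrib_left
proof (rule sum_mono)
  fix e assume e: "e \<in> F"
  define h where "h = (y' - fst e * x' - snd e) - (y - fst e * x - snd e)"
  have h: "\<bar>h\<bar> \<le> sqrt v / 2" using slope_diff[OF e d] by (simp add: h_def)
  have eq: "(y - fst e * x - snd e) + h = y' - fst e * x' - snd e" by (simp add: h_def)
  have "gauss v (y - fst e * x - snd e) \<le> 2 * gauss (2 * v) (y' - fst e * x' - snd e)"
    using gauss_harnack[OF v h, of "y - fst e * x - snd e"] unfolding eq .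
  then have "w e * gauss v (y - fst e * x - snd e) \<le> w e * (2 * gauss (2 * v) (y' - fst e * x' - snd e))"
    using w by (intro mult_left_mono)
  then show "w e * gauss v (y - fst e * x - snd e) \<le> 2 * (w e * gauss (2 * v) (y' - fst e * x' - snd e))"
    by (simp add: mult.left_commute)
qed

lemma mass_meeting_le_line_density:
  assumes r: "0 < r" and U: "\<And>x' y'. (x', y') \<in> U \<Longrightarrow> \<bar>x - x'\<bar> \<le> r / 4 \<and> \<bar>y - y'\<bar> \<le> r / 4"
  shows "(\<Sum>e\<in>{e\<in>F. graph e \<inter> U \<noteq> {}}. w e) \<le> 2 * r * line_density F w (2 * r\<^sup>2) x y"
proof -
  have "w e \<le> 2 * r * (w e * gauss (2 * r\<^sup>2) (y - fst e * x - snd e))" if "e \<in> {e\<in>F. graph e \<inter> U \<noteq> {}}" for e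
  proof -
    have "graph e \<inter> U \<noteq> {}" using that by simp
    then obtain q where q: "q \<in> graph e" "q \<in> U" by blast
    obtain x' y' where "q = (x', y')" by (cases q)
    with q have p: "(x', y') \<in> U" "y' = fst e * x' + snd e" by (auto simp: graph_def)
    have "\<bar>(y - fst e * x - snd e) - (y' - fst e * x' - snd e)\<bar> \<le> 2 * (r / 4)"
      using that U[OF p(1)] by (intro slope_diff) (auto simp: abs_minus_commute)
    then have "\<bar>y - fst e * x - snd e\<bar> \<le> sqrt (r\<^sup>2) / 2" using p r by simp
    from gauss_harnack[OF _ this, of 0] have "1 / r \<le> 2 * gauss (2 * r\<^sup>2) (y - fst e * x - snd e)"
      using r by (simp add: gauss_def)
    then have "r * (1 / r) \<le> r * (2 * gauss (2 * r\<^sup>2) (y - fst e * x - snd e))"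
      using r by (intro mult_left_mono) auto
    then have "w e * 1 \<le> w e * (r * (2 * gauss (2 * r\<^sup>2) (y - fst e * x - snd e)))"
      using w r by (intro mult_left_mono) auto
    then show ?thesis by (simp add: mult_ac)
  qed
  then have "(\<Sum>e\<in>{e\<in>F. graph e \<inter> U \<noteq> {}}. w e)
      \<le> (\<Sum>e\<in>{e\<in>F. graph e \<inter> U \<noteq> {}}. 2 * r * (w e * gauss (2 * r\<^sup>2) (y - fst e * x - snd e)))"
    by (rule sum_mono)
  also have "\<dots> \<le> (\<Sum>e\<in>F. 2 * r * (w e * gauss (2 * r\<^sup>2) (y - fst e * x - snd e)))"
    using fin w r by (intro sum_mono2) (auto intro!: mult_nonneg_nonneg gauss_nonneg)
  finally show ?thesis by (simp add: line_density_def sum_distrib_left)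
qed

lemma mass_meeting_le_line_density_wide:
  assumes r: "0 < r" and U: "\<And>x' y'. (x', y') \<in> U \<Longrightarrow> \<bar>x - x'\<bar> \<le> r \<and> \<bar>y - y'\<bar> \<le> r"
  shows "(\<Sum>e\<in>{e\<in>F. graph e \<inter> U \<noteq> {}}. w e) \<le> exp 4 * r * line_density F w (r\<^sup>2) x y"
proof -
  have "w e \<le> exp 4 * r * (w e * gauss (r\<^sup>2) (y - fst e * x - snd e))" if "e \<in> {e\<in>F. graph e \<inter> U \<noteq> {}}" for e
  proof -
    have "graph e \<inter> U \<noteq> {}" using that by simp
    then obtain q where q: "q \<in> graph e" "q \<in> U" by blast
    obtain x' y' where "q = (x', y')" by (cases q)
    with q have p: "(x', y') \<in> U" "y' = fst e * x' + snd e" by (auto simp: graph_def)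
    define z where "z = y - fst e * x - snd e"
    have "\<bar>(y - fst e * x - snd e) - (y' - fst e * x' - snd e)\<bar> \<le> 2 * r"
      using that U[OF p(1)] by (intro slope_diff) (auto simp: abs_minus_commute)
    then have "\<bar>z\<bar> \<le> 2 * r" using p by (simp add: z_def)
    then have "\<bar>z\<bar>\<^sup>2 \<le> (2 * r)\<^sup>2" by (intro power_mono) auto
    then have "z\<^sup>2 / r\<^sup>2 \<le> 4" using r by (simp add: field_simps power_mult_distrib)
    then have "1 \<le> exp 4 * exp (- (z\<^sup>2 / r\<^sup>2))" by (simp add: exp_add[symmetric])
    also have "\<dots> = exp 4 * r * gauss (r\<^sup>2) z" using r by (simp add: gauss_def)
    finally have "w e * 1 \<le> w e * (exp 4 * r * gauss (r\<^sup>2) z)" using w by (intro mult_left_mono) auto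
    then show ?thesis by (simp add: mult_ac z_def)
  qed
  then have "(\<Sum>e\<in>{e\<in>F. graph e \<inter> U \<noteq> {}}. w e)
      \<le> (\<Sum>e\<in>{e\<in>F. graph e \<inter> U \<noteq> {}}. exp 4 * r * (w e * gauss (r\<^sup>2) (y - fst e * x - snd e)))"
    by (rule sum_mono)
  also have "\<dots> \<le> (\<Sum>e\<in>F. exp 4 * r * (w e * gauss (r\<^sup>2) (y - fst e * x - snd e)))"
    using fin w r by (intro sum_mono2) (auto intro!: mult_nonneg_nonneg gauss_nonneg)
  finally show ?thesis by (simp add: line_density_def sum_distrib_left)
qed

text \<open>
  If the density jumps from at most \<open>T\<close> to more than \<open>8 T\<close> between two scales, then, by the Harnack
  inequality, the density with parameter \<open>2 * r\<^sup>2\<close> exceeds \<open>4 T\<close> and the one with half the coarser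
  parameter is at most \<open>2 T\<close> throughout a neighbourhood. Their difference is thus at least \<open>2 T\<close> and at
  least half of the larger one.
\<close>

lemma bad_point_difference:
  assumes B4: "4 \<le> B" and T: "1 \<le> T"
    and bad: "8 * T < line_density F w ((1 / real B ^ Suc i)\<^sup>2) x y" "line_density F w ((1 / real B ^ i)\<^sup>2) x y \<le> T"
    and near: "\<bar>x - x'\<bar> \<le> (1 / real B ^ Suc i) / 4" "\<bar>y - y'\<bar> \<le> (1 / real B ^ Suc i) / 4"
  shows "line_density F w (2 * (1 / real B ^ Suc i)\<^sup>2) x' y'
    \<le> 2 * (line_density F w (2 * (1 / real B ^ Suc i)\<^sup>2) x' y' - line_density F w ((1 / real B ^ i)\<^sup>2 / 2) x' y')\<^sup>2"
proof -
  define r where "r = 1 / real B ^ Suc i"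
  define R where "R = 1 / real B ^ i"
  have r: "0 < r" using Bpos by (simp add: r_def)
  have R: "R = real B * r" using Bpos by (simp add: r_def R_def)
  have Rpos: "0 < R" using Bpos by (simp add: R_def)
  have "line_density F w (r\<^sup>2) x y \<le> 2 * line_density F w (2 * r\<^sup>2) x' y'"
    by (rule line_density_harnack) (use near[folded r_def] r in simp_all)
  then have D1: "4 * T < line_density F w (2 * r\<^sup>2) x' y'" using bad(1)[folded r_def] by simp
  have rR: "r \<le> sqrt (R\<^sup>2 / 2)"
  proof (rule real_le_rsqrt)
    have "4\<^sup>2 \<le> (real B)\<^sup>2" using B4 by (intro power_mono) auto
    then have "2 * r\<^sup>2 \<le> (real B)\<^sup>2 * r\<^sup>2" by (intro mult_right_mono) auto
    then show "r\<^sup>2 \<le> R\<^sup>2 / 2" by (simp add: R power_mult_distrib)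
  qed
  have "line_density F w (R\<^sup>2 / 2) x' y' \<le> 2 * line_density F w (2 * (R\<^sup>2 / 2)) x y"
    by (rule line_density_harnack) (use near[folded r_def] rR Rpos in \<open>simp_all add: abs_minus_commute\<close>)
  then have D2: "line_density F w (R\<^sup>2 / 2) x' y' \<le> 2 * T" using bad(2)[folded R_def] by simp
  define D where "D = line_density F w (2 * r\<^sup>2) x' y' - line_density F w (R\<^sup>2 / 2) x' y'"
  have "1 \<le> D" "line_density F w (2 * r\<^sup>2) x' y' \<le> 2 * D" using D1 D2 T by (auto simp: D_def)
  moreover have "D * 1 \<le> D * D" using \<open>1 \<le> D\<close> by (intro mult_left_mono) auto
  ultimately show ?thesis unfolding r_def[symmetric] R_def[symmetric] D_def[symmetric] power2_eq_square[of D] by linarith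
qed

end

context frostman_weights
begin

lemma cell_indicator_integral:
  "has_bochner_integral lborel (\<lambda>y. if cell B k (x, y) = q then 1 else 0 :: real)
    ((if \<lfloor>real B ^ k * x\<rfloor> = fst q then 1 else 0) * (1 / real B ^ k))"
proof -
  have eq: "(if cell B k (x, y) = q then 1 else 0 :: real)
    = (if \<lfloor>real B ^ k * x\<rfloor> = fst q then 1 else 0) * (if \<lfloor>real B ^ k * y\<rfloor> = snd q then 1 else 0)" for y
    by (cases q) (simp add: cell_def)
  show ?thesis unfolding eq
    by (intro has_bochner_integral_mult_right floor_cell_integral zero_less_power Bpos)
qed

definition meeting :: "(real \<times> real) set \<Rightarrow> real" where
  "meeting U = (\<Sum>e\<in>{e\<in>F. graph e \<inter> U \<noteq> {}}. w e)"

lemma meeting_nonneg: "0 \<le> meeting U"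
  unfolding meeting_def by (intro sum_nonneg w)

text \<open>
  On a cell that contains a point where the density jumps, the mass of lines meeting the cell is at most
  \<open>4 r D\<^sup>2\<close> for the difference \<open>D\<close> of densities. Summation over the disjoint cells and integration over
  the plane compare the total with the second moment of \<open>D\<close>. Cells of level \<open>i + 2\<close> are used so
  that their side \<open>r / B\<close> is at most \<open>r / 4\<close>, as the Harnack inequality requires.
\<close>

lemma bad_cells_mass:
  assumes B4: "4 \<le> B" and i: "Suc i \<le> J" and T: "1 \<le> T" and K: "finite K"
    and bad: "\<And>q. q \<in> K \<Longrightarrow> \<exists>x y. cell B (i + 2) (x, y) = q \<and> \<bar>x\<bar> \<le> n \<and>
      8 * T < line_density F w ((1 / real B ^ Suc i)\<^sup>2) x y \<and> line_density F w ((1 / real B ^ i)\<^sup>2) x y \<le> T"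
  shows "(\<Sum>q\<in>K. meeting {p. cell B (i + 2) p = q})
    \<le> 3888 * pi * exp ((n + 1)\<^sup>2) * real B ^ 7 * (real B powr (2 - \<tau>)) ^ Suc i"
proof -
  define r where "r = 1 / real B ^ Suc i"
  define a where "a = 2 * r\<^sup>2"
  define b where "b = (1 / real B ^ i)\<^sup>2 / 2"
  define N where "N = real B ^ (i + 2)"
  define D where "D x y = line_density F w a x y - line_density F w b x y" for x y
  define E where "E = exp ((n + 1)\<^sup>2)"
  have r: "0 < r" using Bpos by (simp add: r_def)
  have N: "0 < N" using Bpos by (simp add: N_def)
  have rN: "r = real B / N" using Bpos by (simp add: r_def N_def)
  have a: "0 < a" using r by (simp add: a_def)
  have b_eq: "b = (real B)\<^sup>2 * r\<^sup>2 / 2" using Bpos by (simp add: b_def r_def power_divide power_mult_distrib)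
  have b: "0 < b" using r Bpos by (simp add: b_eq)
  have "4\<^sup>2 \<le> (real B)\<^sup>2" using B4 by (intro power_mono) auto
  then have "4 * r\<^sup>2 \<le> (real B)\<^sup>2 * r\<^sup>2" by (intro mult_right_mono) auto
  then have ab: "a \<le> b" by (simp add: a_def b_eq)
  have small: "1 / N \<le> r / 4" and N1: "1 / N \<le> 1"
  proof -
    show "1 / N \<le> r / 4" using B4 N by (simp add: rN field_simps)
    have "1 \<le> N" unfolding N_def using B by (intro one_le_power) simp
    then show "1 / N \<le> 1" by simp
  qed
  let ?ind = "\<lambda>q x y. if cell B (i + 2) (x, y) = q then 1 else 0 :: real"
  let ?m = "\<lambda>q. meeting {p. cell B (i + 2) p = q}"
  have pointwise: "(\<Sum>q\<in>K. ?m q * ?ind q x y) \<le> 4 * r * E * exp (- x\<^sup>2) * (D x y)\<^sup>2" for x y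
  proof (cases "cell B (i + 2) (x, y) \<in> K")
    case False
    then have "(\<Sum>q\<in>K. ?m q * ?ind q x y) = 0" by (intro sum.neutral) auto
    then show ?thesis using r by (simp add: E_def)
  next
    case True
    define q where "q = cell B (i + 2) (x, y)"
    have close: "\<bar>u - u'\<bar> \<le> 1 / N \<and> \<bar>v - v'\<bar> \<le> 1 / N"
      if "cell B (i + 2) (u, v) = q" "cell B (i + 2) (u', v') = q" for u u' v v'
      using that same_floor_dist[OF N, of u u'] same_floor_dist[OF N, of v v']
      unfolding cell_def N_def by (metis fst_conv less_imp_le snd_conv)
    obtain x0 y0 where p0: "cell B (i + 2) (x0, y0) = q" "\<bar>x0\<bar> \<le> n"
      "8 * T < line_density F w ((1 / real B ^ Suc i)\<^sup>2) x0 y0" "line_density F w ((1 / real B ^ i)\<^sup>2) x0 y0 \<le> T"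
      using bad[OF True] by (auto simp: q_def)
    have near: "\<bar>x0 - x\<bar> \<le> 1 / N" "\<bar>y0 - y\<bar> \<le> 1 / N" using close[OF p0(1), of x y] by (auto simp: q_def)
    have "?m q \<le> 2 * r * line_density F w a x y"
      unfolding meeting_def a_def
    proof (rule mass_meeting_le_line_density[OF r])
      fix x' y' assume "(x', y') \<in> {p. cell B (i + 2) p = q}"
      then show "\<bar>x - x'\<bar> \<le> r / 4 \<and> \<bar>y - y'\<bar> \<le> r / 4"
        using close[of x y x' y'] small by (auto simp: q_def)
    qed
    also have "\<dots> \<le> 2 * r * (2 * (D x y)\<^sup>2)"
    proof (intro mult_left_mono)
      show "line_density F w a x y \<le> 2 * (D x y)\<^sup>2"
        unfolding D_def a_def b_def r_def
        by (rule bad_point_difference[OF B4 T p0(3,4)]; fold r_def) (use near small in linarith)+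
    qed (use r in simp)
    finally have m: "?m q \<le> 4 * r * (D x y)\<^sup>2" by simp
    have "\<bar>x\<bar> \<le> n + 1" using near(1) p0(2) N1 by linarith
    then have "\<bar>x\<bar>\<^sup>2 \<le> (n + 1)\<^sup>2" by (intro power_mono) auto
    then have "1 \<le> E * exp (- x\<^sup>2)" by (simp add: E_def exp_add[symmetric])
    then have "4 * r * (D x y)\<^sup>2 * 1 \<le> 4 * r * (D x y)\<^sup>2 * (E * exp (- x\<^sup>2))"
      using r by (intro mult_left_mono) auto
    moreover have "(\<Sum>q\<in>K. ?m q * ?ind q x y) = ?m q"
    proof -
      have "(\<Sum>q'\<in>K. ?m q' * ?ind q' x y) = (\<Sum>q'\<in>K. if q = q' then ?m q' else 0)"
        by (intro sum.cong refl) (simp add: q_def)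
      also have "\<dots> = ?m q" using K True by (simp add: q_def)
      finally show ?thesis .
    qed
    ultimately show ?thesis using m by (simp add: mult_ac)
  qed
  let ?I = "\<lambda>x. \<Sum>e\<in>F. \<Sum>f\<in>F. w e * w f * (sqrt pi *
      (gauss (2 * a) ((fst e - fst f) * x + (snd e - snd f))
       - 2 * gauss (a + b) ((fst e - fst f) * x + (snd e - snd f))
       + gauss (2 * b) ((fst e - fst f) * x + (snd e - snd f))))"
  let ?e = "\<Sum>e\<in>F. \<Sum>f\<in>F. w e * w f *
      (gauss (2 * a + (fst e - fst f)\<^sup>2) (snd e - snd f)
       - 2 * gauss (a + b + (fst e - fst f)\<^sup>2) (snd e - snd f)
       + gauss (2 * b + (fst e - fst f)\<^sup>2) (snd e - snd f))"
  \<comment> \<open>The pointwise bound is integrated along vertical lines first, and then in \<open>x\<close>.\<close>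
  have slice: "(\<Sum>q\<in>K. ?m q * ((if \<lfloor>N * x\<rfloor> = fst q then 1 else 0) * (1 / N)))
      \<le> 4 * r * E * (exp (- x\<^sup>2) * ?I x)" for x
  proof (rule has_bochner_integral_le[OF _ _ pointwise])
    show "has_bochner_integral lborel (\<lambda>y. \<Sum>q\<in>K. ?m q * ?ind q x y)
      (\<Sum>q\<in>K. ?m q * ((if \<lfloor>N * x\<rfloor> = fst q then 1 else 0) * (1 / N)))"
      unfolding N_def by (intro has_bochner_integral_sum has_bochner_integral_mult_right cell_indicator_integral)
    have "has_bochner_integral lborel (\<lambda>y. (4 * r * E * exp (- x\<^sup>2)) * (D x y)\<^sup>2) ((4 * r * E * exp (- x\<^sup>2)) * ?I x)"
      unfolding D_def by (intro has_bochner_integral_mult_right line_density_diff_square_integral a b)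
    then show "has_bochner_integral lborel (\<lambda>y. 4 * r * E * exp (- x\<^sup>2) * (D x y)\<^sup>2) (4 * r * E * (exp (- x\<^sup>2) * ?I x))"
      by (simp only: mult.assoc)
  qed
  have "(\<Sum>q\<in>K. ?m q * (1 / N * (1 / N))) \<le> 4 * r * E * (pi * ?e)"
  proof (rule has_bochner_integral_le[OF _ _ slice])
    show "has_bochner_integral lborel (\<lambda>x. \<Sum>q\<in>K. ?m q * ((if \<lfloor>N * x\<rfloor> = fst q then 1 else 0) * (1 / N)))
      (\<Sum>q\<in>K. ?m q * (1 / N * (1 / N)))"
      by (intro has_bochner_integral_sum has_bochner_integral_mult_right has_bochner_integral_mult_left floor_cell_integral N)
    show "has_bochner_integral lborel (\<lambda>x. 4 * r * E * (exp (- x\<^sup>2) * ?I x)) (4 * r * E * (pi * ?e))"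
      by (intro has_bochner_integral_mult_right line_density_energy_integral a b)
  qed
  also have "\<dots> \<le> 4 * r * E * (pi * (972 * (b - a) * real B ^ 3 * (real B powr (3 - \<tau>)) ^ Suc i))"
  proof (intro mult_left_mono energy_le i a ab)
    show "(1 / real B ^ Suc i)\<^sup>2 \<le> 2 * a" unfolding a_def r_def[symmetric] by simp
  qed (use r in \<open>auto simp: E_def\<close>)
  also have "\<dots> \<le> 4 * r * E * (pi * (972 * ((real B)\<^sup>2 * r\<^sup>2) * real B ^ 3 * (real B powr (3 - \<tau>)) ^ Suc i))"
  proof (intro mult_left_mono mult_right_mono)
    have "0 \<le> (real B)\<^sup>2 * r\<^sup>2" by simp
    then show "b - a \<le> (real B)\<^sup>2 * r\<^sup>2" using a unfolding b_eq by linarith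
  qed (use r in \<open>auto simp: E_def\<close>)
  finally have "(\<Sum>q\<in>K. ?m q) * (1 / N)\<^sup>2 \<le> 4 * r * E * (pi * (972 * ((real B)\<^sup>2 * r\<^sup>2) * real B ^ 3 * (real B powr (3 - \<tau>)) ^ Suc i))"
    by (simp only: sum_distrib_right[symmetric] power2_eq_square)
  then have "((\<Sum>q\<in>K. ?m q) * (1 / N)\<^sup>2) * N\<^sup>2
      \<le> (4 * r * E * (pi * (972 * ((real B)\<^sup>2 * r\<^sup>2) * real B ^ 3 * (real B powr (3 - \<tau>)) ^ Suc i))) * N\<^sup>2"
    by (intro mult_right_mono) auto
  moreover have "((\<Sum>q\<in>K. ?m q) * (1 / N)\<^sup>2) * N\<^sup>2 = (\<Sum>q\<in>K. ?m q)" using N by (simp add: power_divide)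
  moreover have "(4 * r * E * (pi * (972 * ((real B)\<^sup>2 * r\<^sup>2) * real B ^ 3 * (real B powr (3 - \<tau>)) ^ Suc i))) * N\<^sup>2
     = 3888 * pi * E * real B ^ 7 * (r * (real B powr (3 - \<tau>)) ^ Suc i)"
  proof -
    have rN2: "r\<^sup>2 * N\<^sup>2 = (real B)\<^sup>2" using N by (simp add: rN power_divide)
    have "(4 * r * E * (pi * (972 * ((real B)\<^sup>2 * r\<^sup>2) * real B ^ 3 * (real B powr (3 - \<tau>)) ^ Suc i))) * N\<^sup>2
      = 3888 * pi * E * ((real B)\<^sup>2 * (r\<^sup>2 * N\<^sup>2) * real B ^ 3) * (r * (real B powr (3 - \<tau>)) ^ Suc i)"
      by (simp only: mult_ac)
    also have "(real B)\<^sup>2 * (r\<^sup>2 * N\<^sup>2) * real B ^ 3 = real B ^ 7"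
      unfolding rN2 by (simp only: power_add[symmetric]) simp
    finally show ?thesis .
  qed
  moreover have "r * (real B powr (3 - \<tau>)) ^ Suc i = (real B powr (2 - \<tau>)) ^ Suc i"
  proof -
    have "r = (real B powr (-1)) ^ Suc i" using Bpos by (simp add: r_def powr_minus_divide power_one_over)
    then have "r * (real B powr (3 - \<tau>)) ^ Suc i = (real B powr (-1) * real B powr (3 - \<tau>)) ^ Suc i"
      by (simp only: power_mult_distrib)
    also have "real B powr (-1) * real B powr (3 - \<tau>) = real B powr (2 - \<tau>)"
      by (simp only: powr_add[symmetric]) simp
    finally show ?thesis .
  qed
  ultimately show ?thesis by (simp only: E_def)
qed

end

section \<open>Counting incidences\<close>

lemma finite_cell_image:
  assumes "\<And>p. p \<in> X \<Longrightarrow> \<bar>fst p\<bar> \<le> n \<and> \<bar>snd p\<bar> \<le> n"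
  shows "finite (cell B k ` X)"
proof (rule finite_subset)
  let ?N = "real B ^ k"
  show "cell B k ` X \<subseteq> {\<lfloor>?N * - n\<rfloor>..\<lfloor>?N * n\<rfloor>} \<times> {\<lfloor>?N * - n\<rfloor>..\<lfloor>?N * n\<rfloor>}"
  proof
    fix q assume "q \<in> cell B k ` X"
    then obtain p where p: "p \<in> X" "q = cell B k p" by blast
    have "- n \<le> fst p" "fst p \<le> n" "- n \<le> snd p" "snd p \<le> n" using assms[OF p(1)] by auto
    then have "\<lfloor>?N * - n\<rfloor> \<le> \<lfloor>?N * fst p\<rfloor>" "\<lfloor>?N * fst p\<rfloor> \<le> \<lfloor>?N * n\<rfloor>"
        "\<lfloor>?N * - n\<rfloor> \<le> \<lfloor>?N * snd p\<rfloor>" "\<lfloor>?N * snd p\<rfloor> \<le> \<lfloor>?N * n\<rfloor>"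
      by (intro floor_mono mult_left_mono; simp)+
    then show "q \<in> {\<lfloor>?N * - n\<rfloor>..\<lfloor>?N * n\<rfloor>} \<times> {\<lfloor>?N * - n\<rfloor>..\<lfloor>?N * n\<rfloor>}"
      unfolding p(2) cell_def by simp
  qed
qed simp

lemma dist_prod_le: "dist p q \<le> \<bar>fst p - fst q\<bar> + \<bar>snd p - snd q\<bar>" for p q :: "real \<times> real"
  using sqrt_sum_squares_le_sum_abs[of "fst p - fst q" "snd p - snd q"]
  by (simp add: dist_prod_def dist_real_def)

lemma cell_diameter:
  assumes "0 < B"
  shows "bounded {p. cell B k p = q}" "diameter {p. cell B k p = q} \<le> 2 / real B ^ k"
proof -
  have N: "0 < real B ^ k" using assms by simp
  have d: "dist p p' \<le> 2 / real B ^ k" if "cell B k p = q" "cell B k p' = q" for p p'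
  proof -
    have "\<lfloor>real B ^ k * fst p\<rfloor> = \<lfloor>real B ^ k * fst p'\<rfloor>" "\<lfloor>real B ^ k * snd p\<rfloor> = \<lfloor>real B ^ k * snd p'\<rfloor>"
      using that by (auto simp: cell_def)
    from this[THEN same_floor_dist[OF N]] dist_prod_le[of p p'] show ?thesis by simp
  qed
  then show "bounded {p. cell B k p = q}" unfolding bounded_two_points by blast
  show "diameter {p. cell B k p = q} \<le> 2 / real B ^ k"
    using d by (intro diameter_dist_le) auto
qed

context frostman_weights
begin

text \<open>
  Double counting: each line \<open>e\<close> is charged the cost of those members of the cover that it meets.
\<close>

lemma weighted_incidence:
  assumes s: "0 < s" and P: "finite P" "\<And>S. S \<in> P \<Longrightarrow> bounded S" and Y: "Y \<subseteq> \<Union>P" and c: "0 \<le> c"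
    and rich: "\<And>e. e \<in> F \<Longrightarrow> ennreal c \<le> hcontent s (Y \<inter> graph e)"
  shows "c * (\<Sum>e\<in>F. w e) \<le> (\<Sum>S\<in>P. diameter S powr s * meeting S)"
proof -
  have inc: "c \<le> (\<Sum>S\<in>P. diameter S powr s * (if graph e \<inter> S \<noteq> {} then 1 else 0))" if e: "e \<in> F" for e
  proof -
    let ?P = "{S\<in>P. graph e \<inter> S \<noteq> {}}"
    have "Y \<inter> graph e \<subseteq> (\<Union>S\<in>?P. S)" using Y by blast
    then have "ennreal c \<le> hcontent s (\<Union>S\<in>?P. S)" using rich[OF e] hcontent_mono order_trans by blast
    also have "\<dots> \<le> (\<Sum>S\<in>?P. hcontent s S)" using P by (intro hcontent_UN_finite s) auto
    also have "\<dots> \<le> (\<Sum>S\<in>?P. ennreal (diameter S powr s))"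
      using P by (intro sum_mono hcontent_bounded_le s) auto
    also have "\<dots> = ennreal (\<Sum>S\<in>?P. diameter S powr s)" by (intro sum_ennreal) simp
    finally have "c \<le> (\<Sum>S\<in>?P. diameter S powr s)"
      by (subst (asm) ennreal_le_iff) (auto intro: sum_nonneg)
    also have "\<dots> = (\<Sum>S\<in>P. if graph e \<inter> S \<noteq> {} then diameter S powr s else 0)"
      using P by (intro sum.inter_filter) auto
    also have "\<dots> = (\<Sum>S\<in>P. diameter S powr s * (if graph e \<inter> S \<noteq> {} then 1 else 0))"
      by (intro sum.cong) auto
    finally show ?thesis .
  qed
  have "c * (\<Sum>e\<in>F. w e) = (\<Sum>e\<in>F. w e * c)" by (simp add: sum_distrib_left mult.commute)
  also have "\<dots> \<le> (\<Sum>e\<in>F. w e * (\<Sum>S\<in>P. diameter S powr s * (if graph e \<inter> S \<noteq> {} then 1 else 0)))"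
    by (intro sum_mono mult_left_mono inc w)
  also have "\<dots> = (\<Sum>S\<in>P. \<Sum>e\<in>F. diameter S powr s * (if graph e \<inter> S \<noteq> {} then w e else 0))"
    unfolding sum_distrib_left by (subst sum.swap) (intro sum.cong refl, simp)
  also have "\<dots> = (\<Sum>S\<in>P. diameter S powr s * meeting S)"
    using fin by (simp add: sum_distrib_left[symmetric] meeting_def sum.inter_filter)
  finally show ?thesis .
qed

lemma line_density_trivial: "0 < v \<Longrightarrow> line_density F w v x y \<le> 1 / sqrt v"
proof -
  assume v: "0 < v"
  have "line_density F w v x y \<le> (\<Sum>e\<in>F. w e * (1 / sqrt v))"
    unfolding line_density_def using v by (intro sum_mono mult_left_mono w) (auto simp: gauss_def intro!: divide_right_mono)
  also have "\<dots> = (\<Sum>e\<in>F. w e) * (1 / sqrt v)" by (simp only: sum_distrib_right)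
  also have "\<dots> \<le> 1 * (1 / sqrt v)" using v by (intro mult_right_mono total_le_1) auto
  finally show ?thesis by simp
qed

text \<open>
  The admissible density \<open>T i\<close> starts at scale \<open>i0\<close> with the trivial bound \<open>B ^ i0\<close> and grows by the
  factor \<open>8\<close> in each step. A point either exceeds it for the first time at some scale, and then it lies
  in a bad cell of this scale, or its density at scale \<open>J\<close> is at most \<open>T J\<close>, and then few lines meet
  the member of \<open>\<U>\<close> that contains it.
\<close>

lemma incidence_bound:
  assumes B4: "4 \<le> B" and s: "0 < s" and i0: "i0 \<le> J"
    and Y: "\<And>p. p \<in> Y \<Longrightarrow> \<bar>fst p\<bar> \<le> n \<and> \<bar>snd p\<bar> \<le> n"
    and U: "finite \<U>" "Y \<subseteq> \<Union>\<U>" "\<And>U. U \<in> \<U> \<Longrightarrow> bounded U \<and> diameter U \<le> 1 / real B ^ J"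
    and c: "0 \<le> c" and rich: "\<And>e. e \<in> F \<Longrightarrow> ennreal c \<le> hcontent s (Y \<inter> graph e)"
  shows "c * (\<Sum>e\<in>F. w e) \<le>
    3888 * pi * exp ((n + 1)\<^sup>2) * real B ^ 7 * (\<Sum>i\<in>{i0..<J}. (real B powr (2 - \<tau> - s)) ^ Suc i)
    + real (card \<U>) * ((1 / real B ^ J) powr s * (exp 4 * (1 / real B ^ J) * (8 ^ (J - i0) * real B ^ i0)))"
proof -
  define T where "T i = 8 ^ (i - i0) * real B ^ i0" for i
  define G where "G i p = line_density F w ((1 / real B ^ i)\<^sup>2) (fst p) (snd p)" for i and p :: "real \<times> real"
  define bad where "bad i p \<longleftrightarrow> 8 * T i < G (Suc i) p \<and> G i p \<le> T i" for i p
  define K where "K i = cell B (i + 2) ` {p\<in>Y. bad i p}" for i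
  define cellset where "cellset i q = {p. cell B (i + 2) p = q}" for i q
  define good where "good = {U\<in>\<U>. \<exists>p\<in>U. G J p \<le> T J}"
  let ?C = "3888 * pi * exp ((n + 1)\<^sup>2) * real B ^ 7"
  have B1: "1 \<le> real B" using B by simp
  have B0: "0 < B" using B by simp
  have T1: "1 \<le> T i" for i
    unfolding T_def using one_le_power[OF B1, of i0] one_le_power[of "8::real" "i - i0"]
    by (metis (no_types) mult_mono' mult_1_left one_le_numeral zero_le_one)
  have finK: "finite (K i)" for i
    unfolding K_def by (rule finite_cell_image[of _ n]) (use Y in auto)
  have trichotomy: "(\<exists>i\<in>{i0..<J}. bad i p) \<or> G J p \<le> T J" for p
  proof (cases "\<exists>i\<in>{i0..<J}. bad i p")
    case nb: False
    have "i \<le> J \<longrightarrow> G i p \<le> T i" if "i0 \<le> i" for i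
      using that
    proof (induction i rule: dec_induct)
      case base
      have "G i0 p \<le> 1 / sqrt ((1 / real B ^ i0)\<^sup>2)"
        unfolding G_def by (rule line_density_trivial) (use Bpos in simp)
      also have "\<dots> = T i0" using Bpos by (simp add: T_def)
      finally show ?case by simp
    next
      case (step i)
      show ?case
      proof
        assume "Suc i \<le> J"
        then have "G i p \<le> T i" "\<not> bad i p" using step nb by auto
        then have "G (Suc i) p \<le> 8 * T i" by (simp add: bad_def)
        also have "8 * T i = T (Suc i)" using step by (simp add: T_def Suc_diff_le)
        finally show "G (Suc i) p \<le> T (Suc i)" .
      qed
    qed
    then show ?thesis using i0 by simp
  qed blast
  let ?P = "(\<Union>i\<in>{i0..<J}. cellset i ` K i) \<union> good"
  have fin_good: "finite good" using U(1) by (simp add: good_def)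
  have cell_bd: "bounded (cellset i q)" "diameter (cellset i q) powr s \<le> (real B powr (- s)) ^ Suc i" for i q
  proof -
    show bd: "bounded (cellset i q)" unfolding cellset_def by (rule cell_diameter(1)[OF B0])
    have "diameter (cellset i q) \<le> 2 / real B ^ (i + 2)"
      unfolding cellset_def by (rule cell_diameter(2)[OF B0])
    also have "\<dots> \<le> 1 / real B ^ Suc i" using B B0 by (simp add: field_simps)
    finally have "diameter (cellset i q) powr s \<le> (1 / real B ^ Suc i) powr s"
      using s diameter_ge_0[OF bd] by (intro powr_mono2) auto
    also have "1 / real B ^ Suc i = real B powr (- real (Suc i))"
      using Bpos by (simp only: powr_minus_divide powr_realpow)
    also have "(real B powr (- real (Suc i))) powr s = (real B powr (- s)) ^ Suc i"
      using Bpos by (simp only: powr_powr powr_realpow[symmetric] powr_gt_zero) (simp add: algebra_simps)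
    finally show "diameter (cellset i q) powr s \<le> (real B powr (- s)) ^ Suc i" .
  qed
  have PY: "Y \<subseteq> \<Union>?P"
  proof
    fix p assume p: "p \<in> Y"
    show "p \<in> \<Union>?P"
    proof (cases "\<exists>i\<in>{i0..<J}. bad i p")
      case True
      then obtain i where "i \<in> {i0..<J}" "bad i p" by blast
      then have "cell B (i + 2) p \<in> K i" "p \<in> cellset i (cell B (i + 2) p)" 
        using p by (auto simp: K_def cellset_def)
      then show ?thesis using \<open>i \<in> {i0..<J}\<close> by blast
    next
      case False
      then have "G J p \<le> T J" using trichotomy by blast
      moreover obtain V where "V \<in> \<U>" "p \<in> V" using p U(2) by blast
      ultimately have "V \<in> good" by (auto simp: good_def)
      then show ?thesis using \<open>p \<in> V\<close> by blast
    qed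
  qed
  have fP: "finite ?P" using finK fin_good by blast
  have bP: "bounded S" if "S \<in> ?P" for S using that cell_bd(1) U(3) by (auto simp: good_def)
  have "c * (\<Sum>e\<in>F. w e) \<le> (\<Sum>S\<in>?P. diameter S powr s * meeting S)"
    by (rule weighted_incidence[OF s fP bP PY c rich])
  also have "\<dots> \<le> (\<Sum>S\<in>(\<Union>i\<in>{i0..<J}. cellset i ` K i). diameter S powr s * meeting S)
      + (\<Sum>S\<in>good. diameter S powr s * meeting S)"
    using finK fin_good meeting_nonneg by (subst sum_Un) (auto intro!: sum_nonneg)
  also have "\<dots> \<le> ?C * (\<Sum>i\<in>{i0..<J}. (real B powr (2 - \<tau> - s)) ^ Suc i)
      + real (card \<U>) * ((1 / real B ^ J) powr s * (exp 4 * (1 / real B ^ J) * T J))"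
  proof (rule add_mono)
    have "(\<Sum>S\<in>(\<Union>i\<in>{i0..<J}. cellset i ` K i). diameter S powr s * meeting S)
        \<le> (\<Sum>i\<in>{i0..<J}. \<Sum>S\<in>cellset i ` K i. diameter S powr s * meeting S)"
      using finK meeting_nonneg by (intro sum_UN_le) auto
    also have "\<dots> \<le> (\<Sum>i\<in>{i0..<J}. ?C * (real B powr (2 - \<tau> - s)) ^ Suc i)"
    proof (rule sum_mono)
      fix i assume i: "i \<in> {i0..<J}"
      have "(\<Sum>S\<in>cellset i ` K i. diameter S powr s * meeting S)
          \<le> (\<Sum>q\<in>K i. diameter (cellset i q) powr s * meeting (cellset i q))"
        using sum_image_le[OF finK[of i], of "\<lambda>S. diameter S powr s * meeting S" "cellset i"] meeting_nonneg
        by (simp add: comp_def)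
      also have "\<dots> \<le> (\<Sum>q\<in>K i. (real B powr (- s)) ^ Suc i * meeting (cellset i q))"
        by (intro sum_mono mult_right_mono cell_bd meeting_nonneg)
      also have "\<dots> = (real B powr (- s)) ^ Suc i * (\<Sum>q\<in>K i. meeting (cellset i q))"
        by (simp only: sum_distrib_left)
      also have "\<dots> \<le> (real B powr (- s)) ^ Suc i * (?C * (real B powr (2 - \<tau>)) ^ Suc i)"
      proof (rule mult_left_mono)
        show "(\<Sum>q\<in>K i. meeting (cellset i q)) \<le> ?C * (real B powr (2 - \<tau>)) ^ Suc i"
          unfolding cellset_def
        proof (rule bad_cells_mass[OF B4 _ T1 finK])
          show "Suc i \<le> J" using i by simp
          fix q assume "q \<in> K i"
          then obtain p where "p \<in> Y" "bad i p" "cell B (i + 2) p = q" by (auto simp: K_def)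
          then show "\<exists>x y. cell B (i + 2) (x, y) = q \<and> \<bar>x\<bar> \<le> n \<and>
            8 * T i < line_density F w ((1 / real B ^ Suc i)\<^sup>2) x y \<and> line_density F w ((1 / real B ^ i)\<^sup>2) x y \<le> T i"
            using Y[of p] unfolding bad_def G_def by (metis prod.collapse)
        qed
      qed simp
      also have "\<dots> = ?C * (real B powr (- s) * real B powr (2 - \<tau>)) ^ Suc i"
        by (simp only: power_mult_distrib mult_ac)
      also have "real B powr (- s) * real B powr (2 - \<tau>) = real B powr (2 - \<tau> - s)"
        by (simp add: powr_add[symmetric])
      finally show "(\<Sum>S\<in>cellset i ` K i. diameter S powr s * meeting S) \<le> ?C * (real B powr (2 - \<tau> - s)) ^ Suc i" .
    qed
    also have "\<dots> = ?C * (\<Sum>i\<in>{i0..<J}. (real B powr (2 - \<tau> - s)) ^ Suc i)" by (simp only: sum_distrib_left)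
    finally show "(\<Sum>S\<in>(\<Union>i\<in>{i0..<J}. cellset i ` K i). diameter S powr s * meeting S)
        \<le> ?C * (\<Sum>i\<in>{i0..<J}. (real B powr (2 - \<tau> - s)) ^ Suc i)" .
    let ?r = "1 / real B ^ J"
    have r: "0 < ?r" using Bpos by simp
    have "(\<Sum>S\<in>good. diameter S powr s * meeting S) \<le> (\<Sum>S\<in>good. ?r powr s * (exp 4 * ?r * T J))"
    proof (intro sum_mono mult_mono)
      fix S assume S: "S \<in> good"
      then have Sb: "bounded S" "diameter S \<le> ?r" using U(3) by (auto simp: good_def)
      then show "diameter S powr s \<le> ?r powr s" using s diameter_ge_0 by (intro powr_mono2) auto
      obtain p where p: "p \<in> S" "G J p \<le> T J" using S by (auto simp: good_def)
      have "meeting S \<le> exp 4 * ?r * line_density F w (?r\<^sup>2) (fst p) (snd p)"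
        unfolding meeting_def
      proof (rule mass_meeting_le_line_density_wide[OF r])
        fix x' y' assume "(x', y') \<in> S"
        then have "dist p (x', y') \<le> ?r"
          using diameter_bounded_bound[OF Sb(1) p(1)] Sb(2) by (meson order_trans)
        then show "\<bar>fst p - x'\<bar> \<le> ?r \<and> \<bar>snd p - y'\<bar> \<le> ?r"
          using dist_fst_le[of p "(x', y')"] dist_snd_le[of p "(x', y')"] by (simp add: dist_real_def)
      qed
      also have "\<dots> \<le> exp 4 * ?r * T J" using p(2) r unfolding G_def by (intro mult_left_mono) auto
      finally show "meeting S \<le> exp 4 * ?r * T J" .
    qed (use meeting_nonneg in auto)
    also have "\<dots> = real (card good) * (?r powr s * (exp 4 * ?r * T J))" by simp
    also have "\<dots> \<le> real (card \<U>) * (?r powr s * (exp 4 * ?r * T J))"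
    proof (rule mult_right_mono)
      show "real (card good) \<le> real (card \<U>)" using U(1) by (auto simp: good_def intro!: card_mono)
      show "0 \<le> ?r powr s * (exp 4 * ?r * T J)" using T1[of J] r by (intro mult_nonneg_nonneg) auto
    qed
    finally show "(\<Sum>S\<in>good. diameter S powr s * meeting S) \<le> real (card \<U>) * (?r powr s * (exp 4 * ?r * T J))" .
  qed
  finally show ?thesis by (simp only: T_def)
qed

end

lemma geometric_tail_le:
  fixes x :: real
  assumes x: "0 \<le> x" "x \<le> 1 / 2" and "m \<le> J"
  shows "(\<Sum>i\<in>{m..<J}. x ^ Suc i) \<le> 2 * x ^ Suc m"
proof -
  have "(\<Sum>i\<in>{m..<J}. x ^ Suc i) \<le> 2 * x ^ Suc m - 2 * x ^ Suc J"
    using \<open>m \<le> J\<close>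
  proof (induction J rule: dec_induct)
    case (step J)
    have "x * x ^ Suc J \<le> (1 / 2) * x ^ Suc J" using x by (intro mult_right_mono) auto
    then show ?case using step by simp
  qed simp
  also have "\<dots> \<le> 2 * x ^ Suc m" using x by simp
  finally show ?thesis .
qed

lemma large_base_exists:
  fixes \<alpha> \<beta> :: real
  assumes "0 < \<alpha>" "0 < \<beta>"
  shows "\<exists>B::nat. 4 \<le> B \<and> 8 \<le> real B powr \<alpha> \<and> 64 \<le> real B powr \<beta>"
proof -
  obtain B :: nat where B: "4 + 8 powr (1 / \<alpha>) + 64 powr (1 / \<beta>) < real B" using reals_Archimedean2 by blast
  have p: "0 \<le> 8 powr (1 / \<alpha>)" "0 \<le> 64 powr (1 / \<beta>)" by simp_all
  have le: "8 powr (1 / \<alpha>) \<le> real B" "64 powr (1 / \<beta>) \<le> real B" using B p by linarith+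
  have "(8 powr (1 / \<alpha>)) powr \<alpha> \<le> real B powr \<alpha>" using le p assms by (intro powr_mono2) auto
  moreover have "(64 powr (1 / \<beta>)) powr \<beta> \<le> real B powr \<beta>" using le p assms by (intro powr_mono2) auto
  moreover have "4 \<le> B" using B p by linarith
  ultimately show ?thesis using assms by (auto simp: powr_powr)
qed

text \<open>
  The quantitative core. For a suitable scale \<open>J\<close>, the incidence bound is violated: its left-hand side
  is at least a constant times \<open>4\<^bsup>-J\<^esup>\<close>, while both terms on the right are \<open>O(8\<^bsup>-J\<^esup>)\<close>. The bad
  cells start at \<open>i0 = J div q\<close>, a small fraction of \<open>J\<close>: large enough to make the sum of
  \<open>B\<^bsup>(2-\<tau>-s)i\<^esup>\<close> over \<open>i > i0\<close> tiny, and small enough that the factor \<open>B\<^bsup>i0\<^esup>\<close> does not spoil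
  the gain \<open>B\<^bsup>(u-s-1)J\<^esup>\<close> in the other term.
\<close>

lemma rich_lines_null_bounded:
  fixes A E :: "(real \<times> real) set"
  assumes s: "0 < s" and tau: "0 < \<tau>" "\<tau> < 2" and u: "0 < u" and st: "2 < s + \<tau>" and us: "u < s + 1"
    and A: "\<And>p. p \<in> A \<Longrightarrow> \<bar>fst p\<bar> \<le> n \<and> \<bar>snd p\<bar> \<le> n" and null: "hcontent u A = 0"
    and c: "0 < c" and rich: "\<And>e. e \<in> E \<Longrightarrow> ennreal c \<le> hcontent s (A \<inter> graph e)"
    and slope: "\<And>e. e \<in> E \<Longrightarrow> \<bar>fst e\<bar> \<le> 1"
    and unit_cell: "\<And>e f. e \<in> E \<Longrightarrow> f \<in> E \<Longrightarrow> \<lfloor>fst e\<rfloor> = \<lfloor>fst f\<rfloor> \<and> \<lfloor>snd e\<rfloor> = \<lfloor>snd f\<rfloor>"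
  shows "hcontent \<tau> E = 0"
proof (rule ccontr)
  assume "hcontent \<tau> E \<noteq> 0"
  then obtain c' where c': "0 < c'" "ennreal c' \<le> hcontent \<tau> E"
  proof (cases "hcontent \<tau> E")
    case (real r)
    then show ?thesis using that[of r] \<open>hcontent \<tau> E \<noteq> 0\<close> by (cases "r = 0") auto
  next
    case top
    then show ?thesis using that[of 1] by simp
  qed
  define \<beta> where "\<beta> = s + 1 - u"
  define \<gamma> where "\<gamma> = s + \<tau> - 2"
  have beta: "0 < \<beta>" and gamma: "0 < \<gamma>" using st us by (auto simp: \<beta>_def \<gamma>_def)
  obtain q :: nat where q: "0 < q" "1 / real q \<le> \<beta> / 2"
  proof -
    obtain k where "inverse (real (Suc k)) < \<beta> / 2" using reals_Archimedean[of "\<beta> / 2"] beta by auto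
    then show ?thesis using that[of "Suc k"] by (simp add: inverse_eq_divide)
  qed
  \<comment> \<open>The first lower bound makes the bad cells negligible, the second one the growth \<open>8 ^ J * B ^ i0\<close>.\<close>
  obtain B :: nat where B4: "4 \<le> B" and B8: "8 \<le> real B powr (\<gamma> / real q)" and B64: "64 \<le> real B powr (\<beta> / 2)"
    using large_base_exists[of "\<gamma> / real q" "\<beta> / 2"] beta gamma q by auto
  have Bpos: "0 < real B" and B1: "1 \<le> real B" and B2: "2 \<le> B" using B4 by auto
  define C where "C = 3888 * pi * exp ((n + 1)\<^sup>2) * real B ^ 7"
  have C: "0 \<le> C" by (simp add: C_def)
  \<comment> \<open>Collects the constants of the lower bound: \<open>1 / 4\<close> from each of the two pigeonhole steps, and \<open>2 powr (- \<tau>)\<close> from the diameter of cells.\<close>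
  define c3 where "c3 = c * c' * 2 powr (- \<tau>) / 16"
  have c3: "0 < c3" using c c' by (simp add: c3_def)
  obtain j0 :: nat where j0: "(2 * C + exp 4) * (1 / 2) ^ j0 < c3"
  proof -
    have "0 < c3 / (2 * C + exp 4)" using c3 C by (simp add: add_nonneg_pos)
    then obtain j where "(1 / 2) ^ j < c3 / (2 * C + exp 4)" using real_arch_pow_inv[of _ "1 / 2 :: real"] by auto
    then show ?thesis using that[of j] C by (simp add: field_simps add_nonneg_pos)
  qed
  obtain \<U> where \<U>: "A \<subseteq> (\<Union>j\<in>{j0..}. \<Union>(\<U> j))" "\<And>j. finite (\<U> j)"
    "\<And>j. real (card (\<U> j)) \<le> (real B powr u) ^ j"
    "\<And>j U. U \<in> \<U> j \<Longrightarrow> bounded U \<and> diameter U \<le> 1 / real B ^ j"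
    using null_cover_levels[OF u null B2, of j0] by blast
  \<comment> \<open>The part of \<open>A\<close> covered at scale \<open>j\<close>, and the lines on which this part is large.\<close>
  define Y where "Y j = (if j0 \<le> j then A \<inter> \<Union>(\<U> j) else {})" for j
  define E' where "E' j = {e\<in>E. ennreal (c * (1 / 2) ^ (j + 2)) \<le> hcontent s (Y j \<inter> graph e)}" for j
  have "E \<subseteq> (\<Union>j. E' j)"
  proof
    fix e assume e: "e \<in> E"
    have "A \<inter> graph e \<subseteq> (\<Union>j. Y j \<inter> graph e)"
    proof
      fix p assume p: "p \<in> A \<inter> graph e"
      then have "p \<in> (\<Union>j\<in>{j0..}. \<Union>(\<U> j))" using \<U>(1) by blast
      then obtain j where "j \<in> {j0..}" "p \<in> \<Union>(\<U> j)" by blast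
      then have "p \<in> Y j \<inter> graph e" using p by (simp add: Y_def)
      then show "p \<in> (\<Union>j. Y j \<inter> graph e)" by blast
    qed
    from hcontent_pigeonhole[OF c rich[OF e] this] show "e \<in> (\<Union>j. E' j)"
      using e by (auto simp: E'_def)
  qed
  \<comment> \<open>One scale \<open>J\<close> captures a \<open>2\<^bsup>-J\<^esup>\<close> fraction of the lines.\<close>
  from hcontent_pigeonhole[OF c' this] obtain J where J: "ennreal (c' * (1 / 2) ^ (J + 2)) \<le> hcontent \<tau> (E' J)" ..
  have c'J: "0 < c' * (1 / 2) ^ (J + 2)" and cJ: "0 < c * (1 / 2) ^ (J + 2)" using c c' by simp_all
  have jJ: "j0 \<le> J"
  proof (rule ccontr)
    assume "\<not> j0 \<le> J"
    then have "E' J = {}" using s cJ by (auto simp: E'_def Y_def)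
    then show False using J tau c'J by simp
  qed
  have E'E: "e \<in> E" if "e \<in> E' J" for e using that by (simp add: E'_def)
  define h where "h k = real B powr (- (\<tau> * real k))" for k
  have cell0: "cell B 0 e = cell B 0 f" if "e \<in> E" "f \<in> E" for e f
    using unit_cell[OF that] by (simp add: cell_def)
  have fin_cells: "finite (cell B J ` E' J)"
  proof (cases "E' J = {}")
    case False
    then obtain e0 where e0: "e0 \<in> E' J" by blast
    show ?thesis
    proof (rule finite_cell_image)
      fix e assume "e \<in> E' J"
      then have "\<bar>snd e - snd e0\<bar> < 1" "\<bar>fst e\<bar> \<le> 1"
        using same_floor_dist[of 1 "snd e" "snd e0"] unit_cell[of e e0] slope e0 E'E by auto
      then show "\<bar>fst e\<bar> \<le> \<bar>snd e0\<bar> + 1 \<and> \<bar>snd e\<bar> \<le> \<bar>snd e0\<bar> + 1" by linarith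
    qed
  qed simp
  have refine: "cell B i x = cell B i y" if "cell B (Suc i) x = cell B (Suc i) y" for i x y
    using cell_refine[OF _ that] B4 by simp
  have h0: "0 < h k" for k using Bpos by (simp add: h_def)
  have cell0': "cell B 0 e = cell B 0 f" if "e \<in> E' J" "f \<in> E' J" for e f
    using cell0 E'E that by blast
  have "\<exists>F w K. finite F \<and> F \<subseteq> E' J \<and> (\<forall>x. 0 \<le> w x) \<and>
    (\<forall>k q. 0 \<le> k \<longrightarrow> k \<le> J \<longrightarrow> (\<Sum>x\<in>{x\<in>F. cell B k x = q}. w x) \<le> h k) \<and>
    finite K \<and> (\<forall>x\<in>E' J. \<exists>(k, q)\<in>K. cell B k x = q) \<and> (\<Sum>(k, q)\<in>K. h k) \<le> (\<Sum>x\<in>F. w x)"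
  proof (rule discrete_frostman)
    show "cell B i x = cell B i y" if "cell B (Suc i) x = cell B (Suc i) y" for i x y
      using that by (rule refine)
    show "cell B 0 e = cell B 0 f" if "e \<in> E' J" "f \<in> E' J" for e f using that by (rule cell0')
  qed (rule h0 le0 fin_cells)+
  then obtain F w K where F: "finite F" "F \<subseteq> E' J" and w: "\<forall>x. 0 \<le> w x"
    and mass: "\<forall>k q. 0 \<le> k \<longrightarrow> k \<le> J \<longrightarrow> (\<Sum>x\<in>{x\<in>F. cell B k x = q}. w x) \<le> h k"
    and K: "finite K" "\<forall>x\<in>E' J. \<exists>(k, q)\<in>K. cell B k x = q" "(\<Sum>(k, q)\<in>K. h k) \<le> (\<Sum>x\<in>F. w x)"
    by (elim exE conjE) (rule that; assumption)
  interpret frostman_weights B J \<tau> F w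
  proof
    show "2 \<le> B" by (rule B2)
    show "(\<Sum>e\<in>{e\<in>F. cell B k e = q}. w e) \<le> real B powr (- (\<tau> * real k))" if "k \<le> J" for k q
      using mass that unfolding h_def by blast
    show "cell B 0 e = cell B 0 f" if "e \<in> F" "f \<in> F" for e f using cell0' F that by blast
    show "\<bar>fst e\<bar> \<le> 1" if "e \<in> F" for e using slope E'E F that by blast
  qed (use tau F w in auto)
  have total: "c' * (1 / 2) ^ (J + 2) * 2 powr (- \<tau>) \<le> (\<Sum>e\<in>F. w e)"
  proof -
    have "E' J \<subseteq> (\<Union>a\<in>K. {x. cell B (fst a) x = snd a})"
    proof
      fix e assume "e \<in> E' J"
      then obtain k q where "(k, q) \<in> K" "cell B k e = q" using K(2) by blast
      then show "e \<in> (\<Union>a\<in>K. {x. cell B (fst a) x = snd a})" by force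
    qed
    then have "ennreal (c' * (1 / 2) ^ (J + 2)) \<le> hcontent \<tau> (\<Union>a\<in>K. {x. cell B (fst a) x = snd a})"
      using J hcontent_mono order_trans by blast
    also have "\<dots> \<le> (\<Sum>a\<in>K. hcontent \<tau> {x. cell B (fst a) x = snd a})"
      by (rule hcontent_UN_finite[OF tau(1) K(1)])
    also have "\<dots> \<le> (\<Sum>a\<in>K. ennreal ((2 / real B ^ fst a) powr \<tau>))"
      using B4 by (intro sum_mono hcontent_bounded_le tau cell_diameter) auto
    also have "\<dots> = (\<Sum>a\<in>K. ennreal (2 powr \<tau> * h (fst a)))"
    proof (intro sum.cong refl arg_cong[of _ _ ennreal])
      fix a :: "nat \<times> int \<times> int"
      have "(2 / real B ^ fst a) powr \<tau> = 2 powr \<tau> * (real B powr (- real (fst a))) powr \<tau>"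
        using Bpos by (simp add: powr_divide powr_minus_divide powr_realpow)
      then show "(2 / real B ^ fst a) powr \<tau> = 2 powr \<tau> * h (fst a)"
        by (simp add: h_def powr_powr mult.commute)
    qed
    also have "\<dots> = ennreal (\<Sum>a\<in>K. 2 powr \<tau> * h (fst a))"
      using h0 by (intro sum_ennreal) (simp add: less_imp_le)
    finally have "c' * (1 / 2) ^ (J + 2) \<le> (\<Sum>a\<in>K. 2 powr \<tau> * h (fst a))"
      using h0 by (subst (asm) ennreal_le_iff) (auto intro!: sum_nonneg simp: less_imp_le)
    also have "\<dots> = 2 powr \<tau> * (\<Sum>(k, q)\<in>K. h k)" by (simp add: sum_distrib_left case_prod_unfold)
    also have "\<dots> \<le> 2 powr \<tau> * (\<Sum>e\<in>F. w e)" by (intro mult_left_mono K) simp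
    finally have "c' * (1 / 2) ^ (J + 2) * 2 powr (- \<tau>) \<le> 2 powr \<tau> * (\<Sum>e\<in>F. w e) * 2 powr (- \<tau>)"
      by (intro mult_right_mono) auto
    also have "\<dots> = (2 powr \<tau> * 2 powr (- \<tau>)) * (\<Sum>e\<in>F. w e)" by (simp only: mult_ac)
    also have "2 powr \<tau> * 2 powr (- \<tau>) = (1::real)" by (simp add: powr_add[symmetric])
    finally show ?thesis by simp
  qed
  define i0 where "i0 = J div q"
  have i0: "i0 \<le> J" by (simp add: i0_def)
  have YU: "Y J \<subseteq> \<Union>(\<U> J)" and YA: "Y J \<subseteq> A" by (auto simp: Y_def)
  have "c * (1 / 2) ^ (J + 2) * (\<Sum>e\<in>F. w e) \<le>
    C * (\<Sum>i\<in>{i0..<J}. (real B powr (2 - \<tau> - s)) ^ Suc i)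
    + real (card (\<U> J)) * ((1 / real B ^ J) powr s * (exp 4 * (1 / real B ^ J) * (8 ^ (J - i0) * real B ^ i0)))"
    unfolding C_def
  proof (rule incidence_bound[OF B4 s i0 _ \<U>(2) YU \<U>(4)])
    show "\<bar>fst p\<bar> \<le> n \<and> \<bar>snd p\<bar> \<le> n" if "p \<in> Y J" for p using A YA that by blast
    show "ennreal (c * (1 / 2) ^ (J + 2)) \<le> hcontent s (Y J \<inter> graph e)" if "e \<in> F" for e
      using F that by (auto simp: E'_def)
  qed (use cJ in auto)
  also have "\<dots> \<le> C * (2 * (1 / 8) ^ J) + exp 4 * (1 / 8) ^ J"
  proof (rule add_mono)
    define y where "y = real B powr (- (\<gamma> / real q))"
    have y: "0 \<le> y" "y \<le> 1 / 8"
      unfolding y_def powr_minus_divide using B8 by (auto intro!: frac_le[of 1 1 8, simplified])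
    have x: "real B powr (2 - \<tau> - s) = y ^ q"
    proof -
      have "0 < y" using Bpos by (simp add: y_def)
      then have "y ^ q = y powr real q" by (rule powr_realpow[symmetric])
      also have "\<dots> = real B powr (- (\<gamma> / real q) * real q)" unfolding y_def by (rule powr_powr)
      finally have "y ^ q = real B powr (- (\<gamma> / real q) * real q)" .
      moreover have "- (\<gamma> / real q) * real q = 2 - \<tau> - s" using q by (simp add: \<gamma>_def)
      ultimately show ?thesis by simp
    qed
    have "y ^ q \<le> y ^ 1" using y q by (intro power_decreasing) auto
    then have "(\<Sum>i\<in>{i0..<J}. (y ^ q) ^ Suc i) \<le> 2 * (y ^ q) ^ Suc i0"
      using y by (intro geometric_tail_le i0) auto
    also have "(y ^ q) ^ Suc i0 = y ^ (q * Suc i0)" by (simp only: power_mult)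
    also have "y ^ (q * Suc i0) \<le> y ^ J"
    proof (rule power_decreasing)
      show "J \<le> q * Suc i0"
        using mult_div_mod_eq[of q J] mod_less_divisor[OF q(1), of J] unfolding i0_def mult_Suc_right by linarith
    qed (use y in auto)
    also have "y ^ J \<le> (1 / 8) ^ J" using y by (intro power_mono) auto
    finally show "C * (\<Sum>i\<in>{i0..<J}. (real B powr (2 - \<tau> - s)) ^ Suc i) \<le> C * (2 * (1 / 8) ^ J)"
      unfolding x using C by (intro mult_left_mono) auto
    have r: "(1 / real B ^ J) = (real B powr (-1)) ^ J" using Bpos by (simp add: powr_minus_divide power_one_over)
    have rs: "(1 / real B ^ J) powr s = (real B powr (- s)) ^ J"
      using Bpos by (simp add: powr_divide powr_realpow[symmetric] powr_powr powr_minus_divide mult.commute power_one_over)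
    have e8: "(8::real) ^ (J - i0) \<le> 8 ^ J" by (intro power_increasing) auto
    have Bi0: "real B ^ i0 \<le> (real B powr (\<beta> / 2)) ^ J"
    proof -
      have "i0 * q \<le> J" by (simp add: i0_def)
      then have "real i0 * real q \<le> real J" by (simp only: of_nat_mult[symmetric] of_nat_le_iff)
      then have "real i0 \<le> real J * (1 / real q)" using q by (simp add: field_simps)
      also have "\<dots> \<le> real J * (\<beta> / 2)" by (intro mult_left_mono q) simp
      finally have "real B powr real i0 \<le> real B powr (real J * (\<beta> / 2))" using B1 by (intro powr_mono) auto
      then show ?thesis using Bpos by (simp add: powr_realpow[symmetric] powr_powr mult.commute)
    qed
    have "real (card (\<U> J)) * ((1 / real B ^ J) powr s * (exp 4 * (1 / real B ^ J) * (8 ^ (J - i0) * real B ^ i0)))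
      \<le> (real B powr u) ^ J * ((real B powr (- s)) ^ J * (exp 4 * (real B powr (-1)) ^ J * (8 ^ J * (real B powr (\<beta> / 2)) ^ J)))"
      unfolding rs r[symmetric]
      by (intro mult_mono \<U>(3) e8 Bi0 order_refl mult_nonneg_nonneg) auto
    also have "\<dots> = exp 4 * (8 * (real B powr u * real B powr (- s) * real B powr (-1) * real B powr (\<beta> / 2))) ^ J"
      by (simp only: power_mult_distrib mult_ac)
    also have "real B powr u * real B powr (- s) * real B powr (-1) * real B powr (\<beta> / 2) = real B powr (- (\<beta> / 2))"
      unfolding powr_add[symmetric] by (rule arg_cong[of _ _ "(powr) (real B)"]) (simp add: \<beta>_def field_simps)
    also have "exp 4 * (8 * real B powr (- (\<beta> / 2))) ^ J \<le> exp 4 * (1 / 8) ^ J"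
    proof (intro mult_left_mono power_mono)
      show "8 * real B powr (- (\<beta> / 2)) \<le> 1 / 8"
        unfolding powr_minus_divide using frac_le[OF _ order_refl _ B64, of 1] by simp
    qed auto
    finally show "real (card (\<U> J)) * ((1 / real B ^ J) powr s * (exp 4 * (1 / real B ^ J) * (8 ^ (J - i0) * real B ^ i0)))
      \<le> exp 4 * (1 / 8) ^ J" .
  qed
  also have "\<dots> = (2 * C + exp 4) * (1 / 2) ^ J * (1 / 4) ^ J"
  proof -
    have "(1 / 8 :: real) ^ J = (1 / 2) ^ J * (1 / 4) ^ J" by (simp add: power_mult_distrib[symmetric])
    then show ?thesis by (simp add: algebra_simps)
  qed
  also have "\<dots> < c3 * (1 / 4) ^ J"
  proof (rule mult_strict_right_mono)
    have "(1 / 2 :: real) ^ J \<le> (1 / 2) ^ j0" using jJ by (intro power_decreasing) auto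
    then have "(2 * C + exp 4) * (1 / 2) ^ J \<le> (2 * C + exp 4) * (1 / 2) ^ j0"
      using C by (intro mult_left_mono) (auto simp: add_nonneg_nonneg)
    then show "(2 * C + exp 4) * (1 / 2) ^ J < c3" using j0 by linarith
  qed simp
  also have "c3 * (1 / 4) ^ J = c * (1 / 2) ^ (J + 2) * (c' * (1 / 2) ^ (J + 2) * 2 powr (- \<tau>))"
  proof -
    have "(1 / 4 :: real) ^ J = (1 / 2) ^ J * (1 / 2) ^ J" by (simp add: power_mult_distrib[symmetric])
    then show ?thesis by (simp add: c3_def power_add power2_eq_square)
  qed
  also have "\<dots> \<le> c * (1 / 2) ^ (J + 2) * (\<Sum>e\<in>F. w e)"
    using cJ by (intro mult_left_mono total) auto
  finally show False by simp
qed

section \<open>From parameters to lines\<close>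

lemma ennreal_pos_ge_inverse:
  assumes "x \<noteq> (0 :: ennreal)"
  shows "\<exists>m. ennreal (1 / real (Suc m)) \<le> x"
proof (cases x)
  case (real r)
  then have "0 < r" using assms by (cases "r = 0") auto
  then obtain m where "inverse (real (Suc m)) < r" using reals_Archimedean by blast
  then show ?thesis using real by (intro exI[of _ m]) (simp add: inverse_eq_divide ennreal_leI)
qed simp

text \<open>
  Countable decomposition: into points of bounded norm, lines of quantitatively positive content, and
  unit squares of parameters.
\<close>

lemma rich_lines_null:
  fixes A E :: "(real \<times> real) set"
  assumes s: "0 < s" and tau: "0 < \<tau>" "\<tau> < 2" and u: "0 < u" and st: "2 < s + \<tau>" and us: "u < s + 1"
    and null: "hcontent u A = 0"
    and rich: "\<And>e. e \<in> E \<Longrightarrow> hcontent s (A \<inter> graph e) \<noteq> 0"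
    and slope: "\<And>e. e \<in> E \<Longrightarrow> \<bar>fst e\<bar> \<le> 1"
  shows "hcontent \<tau> E = 0"
proof -
  define A' where "A' n = {p\<in>A. \<bar>fst p\<bar> \<le> real n \<and> \<bar>snd p\<bar> \<le> real n}" for n
  define E' where "E' i = (case from_nat i :: nat \<times> int \<times> int of (n, a, b) \<Rightarrow>
    {e\<in>E. ennreal (1 / real (Suc n)) \<le> hcontent s (A' n \<inter> graph e) \<and> \<lfloor>fst e\<rfloor> = a \<and> \<lfloor>snd e\<rfloor> = b})" for i
  have A'_mono: "A' n \<subseteq> A' m" if "n \<le> m" for n m using that by (auto simp: A'_def)
  have "E \<subseteq> (\<Union>i. E' i)"
  proof
    fix e assume e: "e \<in> E"
    have "A \<inter> graph e \<subseteq> (\<Union>n. A' n \<inter> graph e)"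
    proof
      fix p assume p: "p \<in> A \<inter> graph e"
      obtain n :: nat where "max \<bar>fst p\<bar> \<bar>snd p\<bar> \<le> real n" using real_arch_simple by blast
      then show "p \<in> (\<Union>n. A' n \<inter> graph e)" using p by (auto simp: A'_def intro!: exI[of _ n])
    qed
    then have "hcontent s (\<Union>n. A' n \<inter> graph e) \<noteq> 0"
      using rich[OF e] hcontent_mono by (metis le_zero_eq)
    then obtain n where "hcontent s (A' n \<inter> graph e) \<noteq> 0"
      using hcontent_UN_null[of s "\<lambda>n. A' n \<inter> graph e"] by blast
    then obtain m where m: "ennreal (1 / real (Suc m)) \<le> hcontent s (A' n \<inter> graph e)"
      using ennreal_pos_ge_inverse by blast
    define k where "k = max n m"
    have "ennreal (1 / real (Suc k)) \<le> ennreal (1 / real (Suc m))"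
      by (intro ennreal_leI frac_le) (auto simp: k_def)
    also note m
    also have "hcontent s (A' n \<inter> graph e) \<le> hcontent s (A' k \<inter> graph e)"
      using A'_mono[of n k] by (intro hcontent_mono) (auto simp: k_def)
    finally have "e \<in> E' (to_nat (k, \<lfloor>fst e\<rfloor>, \<lfloor>snd e\<rfloor>))" using e by (simp add: E'_def)
    then show "e \<in> (\<Union>i. E' i)" by blast
  qed
  moreover have "hcontent \<tau> (\<Union>i. E' i) = 0"
  proof (rule hcontent_UN_null)
    fix i
    obtain n a b where i: "(from_nat i :: nat \<times> int \<times> int) = (n, a, b)" by (metis prod_cases3)
    show "hcontent \<tau> (E' i) = 0"
    proof (rule rich_lines_null_bounded[OF s tau u st us])
      show "\<bar>fst p\<bar> \<le> real n \<and> \<bar>snd p\<bar> \<le> real n" if "p \<in> A' n" for p using that by (simp add: A'_def)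
      have "hcontent u (A' n) \<le> hcontent u A" by (intro hcontent_mono) (auto simp: A'_def)
      then show "hcontent u (A' n) = 0" using null by simp
      show "ennreal (1 / real (Suc n)) \<le> hcontent s (A' n \<inter> graph e)" if "e \<in> E' i" for e
        using that by (simp add: E'_def i)
      show "\<bar>fst e\<bar> \<le> 1" if "e \<in> E' i" for e using that slope by (simp add: E'_def i)
      show "\<lfloor>fst e\<rfloor> = \<lfloor>fst f\<rfloor> \<and> \<lfloor>snd e\<rfloor> = \<lfloor>snd f\<rfloor>" if "e \<in> E' i" "f \<in> E' i" for e f
        using that by (simp add: E'_def i)
    qed simp
  qed
  ultimately show ?thesis using hcontent_mono by (metis le_zero_eq)
qed

text \<open>
  A linear isometry of coordinate pairs onto the plane. It is used twice, as the identity and with the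
  coordinates exchanged, so that every line is a graph of slope at most \<open>1\<close> in one of the two charts.
\<close>

locale line_chart =
  fixes f :: "real \<times> real \<Rightarrow> real ^ 2"
  assumes linear: "linear f" and inner: "\<And>p q. f p \<bullet> f q = p \<bullet> q" and surj: "surj f"
begin

lemma norm_chart: "norm (f p) = norm p"
  by (simp add: norm_eq_sqrt_inner inner)

lemma dist_chart: "dist (f p) (f q) = dist p q"
  by (simp add: dist_norm linear_diff[OF linear, symmetric] norm_chart)

lemma inj_chart: "inj f"
  by (rule injI) (metis dist_chart dist_eq_0_iff)

lemma chart_scaleR: "c *\<^sub>R f p = f (c *\<^sub>R p)"
  by (simp add: linear_scale[OF linear])

lemma direction_graph:
  assumes l: "line_points l = f ` graph e"
  shows "direction l = range (\<lambda>r. r *\<^sub>R f (1, fst e))"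
proof (intro equalityI subsetI)
  fix z assume "z \<in> direction l"
  then obtain x x' where "z = f (x, fst e * x + snd e) - f (x', fst e * x' + snd e)"
    unfolding direction_def l graph_def by force
  then have "z = (x - x') *\<^sub>R f (1, fst e)"
    by (simp add: linear_diff[OF linear, symmetric] chart_scaleR algebra_simps)
  then show "z \<in> range (\<lambda>r. r *\<^sub>R f (1, fst e))" by blast
next
  fix z assume "z \<in> range (\<lambda>r. r *\<^sub>R f (1, fst e))"
  then obtain r where "z = r *\<^sub>R f (1, fst e)" by blast
  then have "z = f (r, fst e * r + snd e) - f (0, fst e * 0 + snd e)"
    by (simp add: linear_diff[OF linear, symmetric] chart_scaleR algebra_simps)
  moreover have "f (r, fst e * r + snd e) \<in> line_points l" "f (0, fst e * 0 + snd e) \<in> line_points l"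
    unfolding l graph_def by auto
  ultimately show "z \<in> direction l" unfolding direction_def by blast
qed

lemma closest_point_direction_graph:
  assumes l: "line_points l = f ` graph e"
  shows "closest_point (direction l) x = (1 / (1 + (fst e)\<^sup>2) * (x \<bullet> f (1, fst e))) *\<^sub>R f (1, fst e)"
proof (rule closest_point_subspace_eqI[OF direction_subspace])
  let ?d = "f (1, fst e)"
  have dd: "?d \<bullet> ?d = 1 + (fst e)\<^sup>2" by (simp add: inner power2_eq_square)
  have pos: "1 + (fst e)\<^sup>2 \<noteq> 0" by (smt (verit) zero_le_power2)
  show "(1 / (1 + (fst e)\<^sup>2) * (x \<bullet> ?d)) *\<^sub>R ?d \<in> direction l" unfolding direction_graph[OF l] by blast
  fix v assume "v \<in> direction l"
  then obtain r where v: "v = r *\<^sub>R ?d" unfolding direction_graph[OF l] by blast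
  show "(x - (1 / (1 + (fst e)\<^sup>2) * (x \<bullet> ?d)) *\<^sub>R ?d) \<bullet> v = 0"
    using pos by (simp add: v inner_diff_left dd)
qed

lemma closest_point_graph:
  assumes l: "line_points l = f ` graph e"
  shows "closest_point (line_points l) 0 = (1 / (1 + (fst e)\<^sup>2) * snd e) *\<^sub>R f (- fst e, 1)"
proof -
  let ?q = "1 + (fst e)\<^sup>2"
  let ?z = "(1 / ?q * snd e) *\<^sub>R (- fst e, 1 :: real)"
  have pos: "0 < ?q" by (smt (verit) zero_le_power2)
  have "?z \<in> graph e" using pos by (simp add: graph_def field_simps power2_eq_square)
  then have "f ?z \<in> line_points l" unfolding l by blast
  moreover have "dist 0 (f ?z) \<le> dist 0 v" if v: "v \<in> line_points l" for v
  proof -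
    obtain p where p: "v = f p" "snd p = fst e * fst p + snd e" using v unfolding l graph_def by blast
    have "(norm ?z)\<^sup>2 = (snd e)\<^sup>2 / ?q"
    proof -
      have "(norm (- fst e, 1 :: real))\<^sup>2 = ?q"
        unfolding power2_norm_eq_inner by (simp add: power2_eq_square)
      then have "(norm ?z)\<^sup>2 = (1 / ?q * snd e)\<^sup>2 * ?q"
        unfolding norm_scaleR power_mult_distrib power2_abs by simp
      also have "\<dots> = (snd e)\<^sup>2 / ?q" using pos by (simp add: power2_eq_square)
      finally show ?thesis .
    qed
    also have "\<dots> \<le> (norm p)\<^sup>2"
    proof -
      have "(norm p)\<^sup>2 = (fst p)\<^sup>2 + (snd p)\<^sup>2"
        unfolding power2_norm_eq_inner by (cases p) (simp add: power2_eq_square)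
      moreover have "?q * ((fst p)\<^sup>2 + (snd p)\<^sup>2) = (snd e)\<^sup>2 + (fst p + fst e * snd p)\<^sup>2"
        unfolding p(2) by (simp add: power2_eq_square algebra_simps)
      ultimately have "(snd e)\<^sup>2 \<le> (norm p)\<^sup>2 * ?q" by (simp add: mult.commute)
      then show ?thesis using pos by (simp add: pos_divide_le_eq)
    qed
    finally have "norm ?z \<le> norm p" by (simp add: power2_le_iff_abs_le)
    then show ?thesis by (simp add: p(1) norm_chart)
  qed
  moreover have "convex (line_points l)" by (rule affine_imp_convex[OF line_points_affine])
  ultimately have "f ?z = closest_point (line_points l) 0"
    by (intro closest_point_unique line_points_closed) auto
  then show ?thesis by (simp add: chart_scaleR)
qed

text \<open>
  The metric on lines is locally dominated by the distance of the parameters, because the projection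
  \<open>x \<mapsto> (x \<bullet> d) d / (1 + m\<^sup>2)\<close> onto the direction \<open>d = (1, m)\<close> and the foot point
  \<open>k (- m, 1) / (1 + m\<^sup>2)\<close> are Lipschitz in \<open>(m, k)\<close>. So null sets of parameters give null sets of
  lines.
\<close>

lemma dist_line_le:
  assumes l: "line_points l = f ` graph e" and l': "line_points l' = f ` graph e'"
    and m: "\<bar>fst e\<bar> \<le> 1" "\<bar>fst e'\<bar> \<le> 1" and k: "\<bar>snd e'\<bar> \<le> n"
  shows "dist l l' \<le> (14 + 5 * n) * dist e e'"
proof -
  define d where "d e = f (1, fst e)" for e :: "real \<times> real"
  define g where "g e = f (- fst e, 1)" for e :: "real \<times> real"
  define q where "q e = 1 / (1 + (fst e)\<^sup>2)" for e :: "real \<times> real"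
  define D where "D = \<bar>fst e - fst e'\<bar>"
  define K where "K = \<bar>snd e - snd e'\<bar>"
  have n: "0 \<le> n" using k by linarith
  have D0: "0 \<le> D" and K0: "0 \<le> K" by (simp_all add: D_def K_def)
  have unit2: "norm (1 :: real, x) \<le> 2" "norm (- x, 1 :: real) \<le> 2" if "\<bar>x\<bar> \<le> 1" for x :: real
  proof -
    have "norm (1 :: real, x) \<le> 1 + \<bar>x\<bar>" "norm (- x, 1 :: real) \<le> \<bar>x\<bar> + 1"
      using norm_Pair_le[of "1::real" x] norm_Pair_le[of "- x" "1::real"] by simp_all
    then show "norm (1 :: real, x) \<le> 2" "norm (- x, 1 :: real) \<le> 2" using that by linarith+
  qed
  have nd: "norm (d e) \<le> 2" "norm (d e') \<le> 2" "norm (g e) \<le> 2" "norm (g e') \<le> 2"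
    unfolding d_def g_def norm_chart using unit2 m by blast+
  have dd: "norm (d e - d e') = D" "norm (g e - g e') = D"
    unfolding d_def g_def linear_diff[OF linear, symmetric] norm_chart
    by (simp_all add: D_def norm_Pair)
  have q01: "0 \<le> q x" "q x \<le> 1" for x unfolding q_def by (simp_all add: divide_le_eq add_pos_nonneg)
  have qq: "\<bar>q e - q e'\<bar> \<le> 2 * D"
  proof -
    have ne: "1 + (fst x)\<^sup>2 \<noteq> 0" for x :: "real \<times> real" by (smt (verit) zero_le_power2)
    have "q e - q e' = q e * q e' * ((fst e' - fst e) * (fst e' + fst e))"
      unfolding q_def using ne[of e] ne[of e'] by (simp add: field_simps power2_eq_square)
    then have "\<bar>q e - q e'\<bar> = q e * q e' * (D * \<bar>fst e' + fst e\<bar>)"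
      using q01 by (simp add: abs_mult D_def abs_minus_commute)
    also have "\<dots> \<le> 1 * 1 * (D * 2)"
      using m q01 D0 by (intro mult_mono mult_nonneg_nonneg) auto
    finally show ?thesis by simp
  qed
  have triangle: "norm (x + y + z) \<le> norm x + norm y + norm z" for x y z :: "real ^ 2"
    by (rule order_trans[OF norm_triangle_ineq add_right_mono[OF norm_triangle_ineq]])
  have "onorm (\<lambda>x. closest_point (direction l) x - closest_point (direction l') x) \<le> 12 * D"
  proof (rule onorm_bound)
    fix x
    have "closest_point (direction l) x - closest_point (direction l') x
        = (q e * (x \<bullet> d e)) *\<^sub>R d e - (q e' * (x \<bullet> d e')) *\<^sub>R d e'"
      unfolding closest_point_direction_graph[OF l] closest_point_direction_graph[OF l'] d_def q_def ..
    also have "\<dots> = ((q e - q e') * (x \<bullet> d e)) *\<^sub>R d e + (q e' * (x \<bullet> (d e - d e'))) *\<^sub>R d e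
        + (q e' * (x \<bullet> d e')) *\<^sub>R (d e - d e')"
      by (simp add: algebra_simps inner_diff_right)
    finally have "norm (closest_point (direction l) x - closest_point (direction l') x)
        \<le> norm (((q e - q e') * (x \<bullet> d e)) *\<^sub>R d e) + norm ((q e' * (x \<bullet> (d e - d e'))) *\<^sub>R d e)
          + norm ((q e' * (x \<bullet> d e')) *\<^sub>R (d e - d e'))"
      by (simp only: triangle)
    also have "\<dots> \<le> (2 * D * (norm x * 2)) * 2 + (1 * (norm x * D)) * 2 + (1 * (norm x * 2)) * D"
    proof (intro add_mono)
      have ip: "\<bar>x \<bullet> v\<bar> \<le> norm x * c" if "norm v \<le> c" for v c
        using Cauchy_Schwarz_ineq2[of x v] mult_left_mono[OF that, of "norm x"] by simp
      show "norm (((q e - q e') * (x \<bullet> d e)) *\<^sub>R d e) \<le> (2 * D * (norm x * 2)) * 2"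
        unfolding norm_scaleR abs_mult by (intro mult_mono qq ip nd) (use D0 in auto)
      show "norm ((q e' * (x \<bullet> (d e - d e'))) *\<^sub>R d e) \<le> (1 * (norm x * D)) * 2"
        unfolding norm_scaleR abs_mult abs_of_nonneg[OF q01(1)]
        by (intro mult_mono q01 ip nd) (use D0 dd q01 in auto)
      show "norm ((q e' * (x \<bullet> d e')) *\<^sub>R (d e - d e')) \<le> (1 * (norm x * 2)) * D"
        unfolding norm_scaleR abs_mult abs_of_nonneg[OF q01(1)] dd
        by (intro mult_mono q01 ip nd) (use D0 q01 in auto)
    qed
    finally show "norm (closest_point (direction l) x - closest_point (direction l') x) \<le> 12 * D * norm x"
      by (simp add: algebra_simps)
  qed (use D0 in simp)
  moreover have "dist (closest_point (line_points l) 0) (closest_point (line_points l') 0) \<le> 2 * K + 5 * n * D"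
  proof -
    have "closest_point (line_points l) 0 - closest_point (line_points l') 0
        = (q e * snd e) *\<^sub>R g e - (q e' * snd e') *\<^sub>R g e'"
      unfolding closest_point_graph[OF l] closest_point_graph[OF l'] g_def q_def ..
    also have "\<dots> = (q e * (snd e - snd e')) *\<^sub>R g e + ((q e - q e') * snd e') *\<^sub>R g e
        + (q e' * snd e') *\<^sub>R (g e - g e')"
      by (simp add: algebra_simps)
    finally have "dist (closest_point (line_points l) 0) (closest_point (line_points l') 0)
        \<le> norm ((q e * (snd e - snd e')) *\<^sub>R g e) + norm (((q e - q e') * snd e') *\<^sub>R g e)
          + norm ((q e' * snd e') *\<^sub>R (g e - g e'))"
      unfolding dist_norm by (simp only: triangle)
    also have "\<dots> \<le> (1 * K) * 2 + (2 * D * n) * 2 + (1 * n) * D"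
    proof (intro add_mono)
      show "norm ((q e * (snd e - snd e')) *\<^sub>R g e) \<le> (1 * K) * 2"
        unfolding norm_scaleR abs_mult abs_of_nonneg[OF q01(1)] K_def[symmetric]
        by (intro mult_mono q01 nd) (use K0 q01 in auto)
      show "norm (((q e - q e') * snd e') *\<^sub>R g e) \<le> (2 * D * n) * 2"
        unfolding norm_scaleR abs_mult by (intro mult_mono qq k nd) (use D0 n in auto)
      show "norm ((q e' * snd e') *\<^sub>R (g e - g e')) \<le> (1 * n) * D"
        unfolding norm_scaleR abs_mult abs_of_nonneg[OF q01(1)] dd
        by (intro mult_mono q01 k) (use D0 n q01 in auto)
    qed
    finally show ?thesis by (simp add: algebra_simps)
  qed
  ultimately have "dist l l' \<le> (12 + 5 * n) * D + 2 * K"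
    unfolding dist_line_def by (simp add: algebra_simps)
  also have "\<dots> \<le> (12 + 5 * n) * dist e e' + 2 * dist e e'"
    using dist_fst_le[of e e'] dist_snd_le[of e e'] n
    by (intro add_mono mult_left_mono) (auto simp: D_def K_def dist_real_def)
  finally show ?thesis by (simp add: algebra_simps)
qed

lemma rich_lines_null_chart:
  fixes A :: "(real ^ 2) set" and L :: "line set"
  assumes s: "0 < s" and tau: "0 < \<tau>" "\<tau> < 2" and u: "0 < u" and st: "2 < s + \<tau>" and us: "u < s + 1"
    and null: "hcontent u A = 0"
    and rich: "\<And>l. l \<in> L \<Longrightarrow> hcontent s (A \<inter> line_points l) \<noteq> 0"
    and chart: "\<And>l. l \<in> L \<Longrightarrow> \<exists>e. \<bar>fst e\<bar> \<le> 1 \<and> line_points l = f ` graph e"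
  shows "hcontent \<tau> L = 0"
proof -
  define E where "E = {e. \<bar>fst e\<bar> \<le> 1 \<and> (\<exists>l\<in>L. line_points l = f ` graph e)}"
  have "hcontent \<tau> E = 0"
  proof (rule rich_lines_null[OF s tau u st us])
    have "1-lipschitz_on A (inv f)"
      by (rule lipschitz_onI) (simp_all add: dist_chart[symmetric] surj_f_inv_f[OF surj])
    then have "hcontent u (inv f ` A) = 0" using null by (rule hcontent_lipschitz_null[OF u])
    moreover have "inv f ` A = f -` A" by (rule bij_vimage_eq_inv_image[symmetric]) (simp add: bij_def inj_chart surj)
    ultimately show "hcontent u (f -` A) = 0" by simp
    show "\<bar>fst e\<bar> \<le> 1" if "e \<in> E" for e using that by (simp add: E_def)
    show "hcontent s (f -` A \<inter> graph e) \<noteq> 0" if e: "e \<in> E" for e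
    proof
      assume "hcontent s (f -` A \<inter> graph e) = 0"
      moreover have "1-lipschitz_on (f -` A \<inter> graph e) f"
        by (rule lipschitz_onI) (simp_all add: dist_chart)
      ultimately have "hcontent s (f ` (f -` A \<inter> graph e)) = 0" by (intro hcontent_lipschitz_null[OF s])
      moreover obtain l where l: "l \<in> L" "line_points l = f ` graph e" using e by (auto simp: E_def)
      moreover have "f ` (f -` A \<inter> graph e) = A \<inter> line_points l" unfolding l(2) by blast
      ultimately show False using rich[OF l(1)] by simp
    qed
  qed
  define E' where "E' n = {e\<in>E. \<bar>snd e\<bar> \<le> real n}" for n :: nat
  \<comment> \<open>Evaluated only at parameters of given lines, where \<open>Abs_line\<close> is known to invert \<open>line_points\<close>.\<close>
  define \<Lambda> where "\<Lambda> e = Abs_line (f ` graph e)" for e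
  have \<Lambda>: "line_points (\<Lambda> e) = f ` graph e" if e: "e \<in> E" for e
  proof -
    obtain l where l: "line_points l = f ` graph e" using e by (auto simp: E_def)
    show ?thesis unfolding \<Lambda>_def l[symmetric] by (simp only: line_points_inverse)
  qed
  have "hcontent \<tau> (\<Lambda> ` E' n) = 0" for n
  proof (rule hcontent_lipschitz_null[OF tau(1)])
    show "(14 + 5 * real n)-lipschitz_on (E' n) \<Lambda>"
    proof (rule lipschitz_onI)
      fix e e' assume "e \<in> E' n" "e' \<in> E' n"
      then have "e \<in> E" "e' \<in> E" "\<bar>snd e'\<bar> \<le> real n" by (auto simp: E'_def)
      then show "dist (\<Lambda> e) (\<Lambda> e') \<le> (14 + 5 * real n) * dist e e'"
        by (intro dist_line_le \<Lambda>) (auto simp: E_def)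
    qed simp
    have "hcontent \<tau> (E' n) \<le> hcontent \<tau> E" by (intro hcontent_mono) (auto simp: E'_def)
    then show "hcontent \<tau> (E' n) = 0" using \<open>hcontent \<tau> E = 0\<close> by simp
  qed
  then have "hcontent \<tau> (\<Union>n. \<Lambda> ` E' n) = 0" by (rule hcontent_UN_null)
  moreover have "L \<subseteq> (\<Union>n. \<Lambda> ` E' n)"
  proof
    fix l assume l: "l \<in> L"
    obtain e where e: "\<bar>fst e\<bar> \<le> 1" "line_points l = f ` graph e" using chart[OF l] by blast
    obtain n :: nat where "\<bar>snd e\<bar> \<le> real n" using real_arch_simple by blast
    then have "e \<in> E' n" using e l by (auto simp: E'_def E_def)
    moreover have "\<Lambda> e = l" unfolding \<Lambda>_def e(2)[symmetric] by (rule line_points_inverse)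
    ultimately show "l \<in> (\<Union>n. \<Lambda> ` E' n)" by blast
  qed
  ultimately show ?thesis using hcontent_mono by (metis le_zero_eq)
qed

end

lemma hcontent_null_mono_exponent:
  assumes s: "0 < s" "s \<le> u" and null: "hcontent s A = 0"
  shows "hcontent u A = 0"
proof -
  have "hcontent u A \<le> 0"
  proof (rule ennreal_le_epsilon)
    fix e :: real assume e: "0 < e"
    define e' where "e' = min e 1"
    have "hcontent s A < ennreal e'" using null e by (simp add: e'_def)
    from hcontent_less_cover[OF this] obtain U :: "nat \<Rightarrow> 'a set" where
      cover: "A \<subseteq> (\<Union>i. U i) \<and> (\<forall>i. bounded (U i)) \<and> (\<Sum>i. ennreal (diameter (U i) powr s)) < ennreal e'" ..
    have le: "diameter (U i) powr u \<le> diameter (U i) powr s" for i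
    proof -
      have "ennreal (diameter (U i) powr s) \<le> (\<Sum>i. ennreal (diameter (U i) powr s))"
        by (rule ennreal_le_suminf)
      also have "\<dots> < ennreal e'" using cover by blast
      also have "\<dots> \<le> ennreal 1" by (intro ennreal_leI) (simp add: e'_def)
      finally have "diameter (U i) powr s < 1 powr s" by (simp add: ennreal_less_iff)
      then have "diameter (U i) \<le> 1" using powr_mono2[of s 1 "diameter (U i)"] s by linarith
      moreover have "0 \<le> diameter (U i)" using cover diameter_ge_0 by blast
      ultimately show ?thesis using s by (cases "diameter (U i) = 0") (auto intro: powr_mono')
    qed
    have "hcontent u A \<le> (\<Sum>i. ennreal (diameter (U i) powr u))" using cover by (intro hcontent_le) blast+
    also have "\<dots> \<le> (\<Sum>i. ennreal (diameter (U i) powr s))"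
      using le by (intro suminf_le ennreal_leI) auto
    also have "\<dots> \<le> ennreal e'" using cover by (blast intro: less_imp_le)
    also have "\<dots> \<le> ennreal e" by (intro ennreal_leI) (simp add: e'_def)
    finally show "hcontent u A \<le> 0 + ennreal e" by simp
  qed
  then show ?thesis by simp
qed

lemma hausdorff_dim_le:
  assumes "0 < s" "hcontent s A = 0"
  shows "hausdorff_dim A \<le> ereal s"
  unfolding hausdorff_dim_def using assms hausdorff_measure_eq_0_iff_hcontent[of s A]
  by (intro Inf_lower) auto

lemma hcontent_null_above_dim:
  assumes "0 < hausdorff_dim A" "hausdorff_dim A < ereal u"
  shows "hcontent u A = 0"
proof -
  obtain s where s: "0 \<le> s" "hausdorff_measure s A = 0" "s < u"
    using assms(2) unfolding hausdorff_dim_def Inf_less_iff by auto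
  have "hausdorff_dim A \<le> ereal s" unfolding hausdorff_dim_def using s by (intro Inf_lower) auto
  then have "0 < s" using assms(1) s(1) by (cases "s = 0") (auto simp: zero_ereal_def)
  then show ?thesis using s hausdorff_measure_eq_0_iff_hcontent hcontent_null_mono_exponent by (metis less_imp_le)
qed

definition plane_chart :: "real \<times> real \<Rightarrow> real ^ 2" where
  "plane_chart p = vector [fst p, snd p]"

definition swapped_chart :: "real \<times> real \<Rightarrow> real ^ 2" where
  "swapped_chart p = vector [snd p, fst p]"

interpretation plane_chart: line_chart plane_chart
proof (rule line_chart.intro)
  show "linear plane_chart" by (rule linearI) (simp_all add: plane_chart_def vec_eq_iff forall_2)
  show "plane_chart p \<bullet> plane_chart q = p \<bullet> q" for p q
    by (simp add: plane_chart_def inner_vec_def sum_2 inner_prod_def)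
  show "surj plane_chart"
    by (rule surjI[of _ "\<lambda>v. (v $ 1, v $ 2)"]) (simp add: plane_chart_def vec_eq_iff forall_2)
qed

interpretation swapped_chart: line_chart swapped_chart
proof (rule line_chart.intro)
  show "linear swapped_chart" by (rule linearI) (simp_all add: swapped_chart_def vec_eq_iff forall_2)
  show "swapped_chart p \<bullet> swapped_chart q = p \<bullet> q" for p q
    by (simp add: swapped_chart_def inner_vec_def sum_2 inner_prod_def)
  show "surj swapped_chart"
    by (rule surjI[of _ "\<lambda>v. (v $ 2, v $ 1)"]) (simp add: swapped_chart_def vec_eq_iff forall_2)
qed

lemma (in line_chart) affine_hull_eq_graph:
  assumes ne: "fst b \<noteq> fst a" and steep: "\<bar>snd b - snd a\<bar> \<le> \<bar>fst b - fst a\<bar>"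
  shows "\<exists>e. \<bar>fst e\<bar> \<le> 1 \<and> affine hull {f a, f b} = f ` graph e"
proof -
  define m where "m = (snd b - snd a) / (fst b - fst a)"
  define k where "k = snd a - m * fst a"
  have m1: "\<bar>m\<bar> \<le> 1" using ne steep by (simp add: m_def divide_le_eq)
  have mb: "snd b - snd a = m * (fst b - fst a)" using ne by (simp add: m_def)
  have hull: "u *\<^sub>R f a + v *\<^sub>R f b = f (u *\<^sub>R a + v *\<^sub>R b)" for u v
    by (simp add: linear_add[OF linear] linear_scale[OF linear])
  have "affine hull {f a, f b} = f ` graph (m, k)"
  proof (intro equalityI subsetI)
    fix z assume "z \<in> affine hull {f a, f b}"
    then obtain u v where uv: "u + v = 1" "z = u *\<^sub>R f a + v *\<^sub>R f b" unfolding affine_hull_2 by auto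
    have u: "u = 1 - v" using uv by simp
    have "snd (u *\<^sub>R a + v *\<^sub>R b) = snd a + v * (snd b - snd a)" by (simp add: u algebra_simps)
    also have "\<dots> = m * fst (u *\<^sub>R a + v *\<^sub>R b) + k" by (simp add: mb u k_def algebra_simps)
    finally show "z \<in> f ` graph (m, k)" unfolding uv(2) hull graph_def by simp
  next
    fix z assume "z \<in> f ` graph (m, k)"
    then obtain p where p: "z = f p" "snd p = m * fst p + k" unfolding graph_def by auto
    define v where "v = (fst p - fst a) / (fst b - fst a)"
    have v: "v * (fst b - fst a) = fst p - fst a" using ne by (simp add: v_def)
    have "fst ((1 - v) *\<^sub>R a + v *\<^sub>R b) = fst a + v * (fst b - fst a)" by (simp add: algebra_simps)
    then have 1: "fst ((1 - v) *\<^sub>R a + v *\<^sub>R b) = fst p" using v by simp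
    have "snd ((1 - v) *\<^sub>R a + v *\<^sub>R b) = snd a + v * (snd b - snd a)" by (simp add: algebra_simps)
    also have "\<dots> = snd a + m * (v * (fst b - fst a))" by (simp add: mb mult.left_commute)
    also have "\<dots> = snd p" unfolding v p(2) k_def by (simp add: algebra_simps)
    finally have "(1 - v) *\<^sub>R a + v *\<^sub>R b = p" using 1 by (simp add: prod_eq_iff)
    then have "z = (1 - v) *\<^sub>R f a + v *\<^sub>R f b" unfolding hull p(1) by simp
    then show "z \<in> affine hull {f a, f b}" unfolding affine_hull_2 by force
  qed
  then show ?thesis using m1 by (intro exI[of _ "(m, k)"]) simp
qed

lemma line_in_chart:
  "(\<exists>e. \<bar>fst e\<bar> \<le> 1 \<and> line_points l = plane_chart ` graph e) \<or>
   (\<exists>e. \<bar>fst e\<bar> \<le> 1 \<and> line_points l = swapped_chart ` graph e)"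
proof -
  obtain a where a: "a \<in> line_points l" using line_points_nonempty by blast
  have "line_points l \<noteq> {a}" using line_points_aff_dim[of l] by auto
  then obtain b where b: "b \<in> line_points l" "b \<noteq> a" using a by blast
  have "affine hull {a, b} = line_points l"
  proof (rule affine_dim_equal)
    show "affine hull {a, b} \<subseteq> line_points l"
      using a b by (intro hull_minimal line_points_affine) auto
    show "aff_dim (affine hull {a, b}) = aff_dim (line_points l)"
      using b by (simp add: line_points_aff_dim aff_dim_2)
  qed (use line_points_affine in auto)
  then have l: "line_points l = affine hull {a, b}" ..
  show ?thesis
  proof (cases "\<bar>b $ 2 - a $ 2\<bar> \<le> \<bar>b $ 1 - a $ 1\<bar>")
    case True
    have "plane_chart (v $ 1, v $ 2) = v" for v by (simp add: plane_chart_def vec_eq_iff forall_2)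
    moreover have "b $ 1 \<noteq> a $ 1" using True b(2) by (auto simp: vec_eq_iff forall_2)
    ultimately show ?thesis
      using plane_chart.affine_hull_eq_graph[of "(b $ 1, b $ 2)" "(a $ 1, a $ 2)"] True unfolding l by simp
  next
    case False
    have "swapped_chart (v $ 2, v $ 1) = v" for v by (simp add: swapped_chart_def vec_eq_iff forall_2)
    moreover have "b $ 2 \<noteq> a $ 2" using False by auto
    ultimately show ?thesis
      using swapped_chart.affine_hull_eq_graph[of "(b $ 2, b $ 1)" "(a $ 2, a $ 1)"] False unfolding l by simp
  qed
qed

lemma rich_lines_null_plane:
  fixes A :: "(real ^ 2) set" and L :: "line set"
  assumes s: "0 < s" and tau: "0 < \<tau>" "\<tau> < 2" and u: "0 < u" and st: "2 < s + \<tau>" and us: "u < s + 1"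
    and null: "hcontent u A = 0"
    and rich: "\<And>l. l \<in> L \<Longrightarrow> hcontent s (A \<inter> line_points l) \<noteq> 0"
  shows "hcontent \<tau> L = 0"
proof -
  define L1 where "L1 = {l\<in>L. \<exists>e. \<bar>fst e\<bar> \<le> 1 \<and> line_points l = plane_chart ` graph e}"
  define L2 where "L2 = {l\<in>L. \<exists>e. \<bar>fst e\<bar> \<le> 1 \<and> line_points l = swapped_chart ` graph e}"
  have "hcontent \<tau> L1 = 0"
    by (rule plane_chart.rich_lines_null_chart[OF s tau u st us null]) (auto simp: L1_def rich)
  moreover have "hcontent \<tau> L2 = 0"
    by (rule swapped_chart.rich_lines_null_chart[OF s tau u st us null]) (auto simp: L2_def rich)
  moreover have "L \<subseteq> L1 \<union> L2" using line_in_chart by (auto simp: L1_def L2_def)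
  then have "hcontent \<tau> L \<le> hcontent \<tau> (L1 \<union> L2)" by (rule hcontent_mono)
  moreover have "\<dots> \<le> hcontent \<tau> L1 + hcontent \<tau> L2" by (rule hcontent_Un[OF tau(1)])
  ultimately show ?thesis by simp
qed

text \<open>
  Of the order of \<open>(2 ^ k * n)\<^sup>2\<close> cells of diameter at most \<open>2 / 2 ^ k\<close> cover the square, and the exponent
  \<open>3\<close> beats the number of cells.
\<close>

lemma hcontent_3_square_null:
  assumes "0 < n"
  shows "hcontent 3 {p :: real \<times> real. \<bar>fst p\<bar> \<le> real n \<and> \<bar>snd p\<bar> \<le> real n} = 0" (is "hcontent 3 ?X = 0")
proof -
  have bound: "hcontent 3 ?X \<le> ennreal (72 * (real n)\<^sup>2 * (1 / 2) ^ k)" for k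
  proof -
    let ?N = "(2::int) ^ k * int n"
    have sub: "cell 2 k ` ?X \<subseteq> {- ?N..?N} \<times> {- ?N..?N}"
    proof
      fix q assume "q \<in> cell 2 k ` ?X"
      then obtain p where p: "\<bar>fst p\<bar> \<le> real n" "\<bar>snd p\<bar> \<le> real n" "q = cell 2 k p" by blast
      have fl: "- ?N \<le> \<lfloor>real 2 ^ k * x\<rfloor> \<and> \<lfloor>real 2 ^ k * x\<rfloor> \<le> ?N" if "\<bar>x\<bar> \<le> real n" for x
      proof -
        have "2 ^ k * x \<le> 2 ^ k * real n" "2 ^ k * (- real n) \<le> 2 ^ k * x"
          using that by (intro mult_left_mono; simp)+
        then show ?thesis unfolding floor_le_iff le_floor_iff
          by (simp only: of_int_mult of_int_power of_int_minus of_int_numeral of_int_of_nat_eq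
              of_nat_numeral mult_minus_right simp_thms)
      qed
      show "q \<in> {- ?N..?N} \<times> {- ?N..?N}" unfolding p(3) cell_def using fl[OF p(1)] fl[OF p(2)] by simp
    qed
    have N1: "1 \<le> ?N" using assms by (simp add: int_one_le_iff_zero_less)
    have fin: "finite (cell 2 k ` ?X)" by (rule finite_subset[OF sub]) simp
    have "card (cell 2 k ` ?X) \<le> card ({- ?N..?N} \<times> {- ?N..?N})" by (rule card_mono[OF _ sub]) simp
    also have "\<dots> = nat (2 * ?N + 1) * nat (2 * ?N + 1)" by (simp add: card_cartesian_product mult.commute)
    finally have "real (card (cell 2 k ` ?X)) \<le> real (nat (2 * ?N + 1)) * real (nat (2 * ?N + 1))"
      by (simp only: of_nat_mult[symmetric] of_nat_le_iff)
    also have "\<dots> = (2 * real_of_int ?N + 1) * (2 * real_of_int ?N + 1)" using N1 by simp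
    also have "\<dots> \<le> (3 * real_of_int ?N) * (3 * real_of_int ?N)"
    proof -
      have one: "1 \<le> real_of_int ?N" using N1 by linarith
      show ?thesis by (intro mult_mono; use one in linarith)
    qed
    finally have card: "real (card (cell 2 k ` ?X)) \<le> 9 * (real n)\<^sup>2 * 2 ^ k * 2 ^ k"
      by (simp add: power2_eq_square algebra_simps)
    have "hcontent 3 ?X \<le> hcontent 3 (\<Union>q\<in>cell 2 k ` ?X. {p. cell 2 k p = q})" by (rule hcontent_mono) auto
    also have "\<dots> \<le> (\<Sum>q\<in>cell 2 k ` ?X. hcontent 3 {p. cell 2 k p = q})" by (rule hcontent_UN_finite[OF _ fin]) simp
    also have "\<dots> \<le> (\<Sum>q\<in>cell 2 k ` ?X. ennreal ((2 / real 2 ^ k) powr 3))"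
      by (intro sum_mono hcontent_bounded_le cell_diameter) auto
    also have "\<dots> = ennreal (real (card (cell 2 k ` ?X)) * (2 / 2 ^ k) ^ 3)"
      by (simp add: powr_numeral ennreal_mult ennreal_of_nat_eq_real_of_nat)
    also have "\<dots> \<le> ennreal (9 * (real n)\<^sup>2 * 2 ^ k * 2 ^ k * (2 / 2 ^ k) ^ 3)"
      by (intro ennreal_leI mult_right_mono card) simp
    also have "9 * (real n)\<^sup>2 * 2 ^ k * 2 ^ k * (2 / 2 ^ k) ^ 3 = 72 * (real n)\<^sup>2 * (1 / 2) ^ k"
      by (simp add: power3_eq_cube field_simps)
    finally show ?thesis .
  qed
  have "hcontent 3 ?X \<le> 0"
  proof (rule ennreal_le_epsilon)
    fix e :: real assume e: "0 < e"
    have n2: "0 < 72 * (real n)\<^sup>2" using assms by simp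
    then have "0 < e / (72 * (real n)\<^sup>2)" using e by simp
    then obtain k where "(1 / 2) ^ k < e / (72 * (real n)\<^sup>2)" using real_arch_pow_inv[of _ "1 / 2 :: real"] by auto
    then have "72 * (real n)\<^sup>2 * (1 / 2) ^ k \<le> e" using n2 by (simp add: field_simps)
    then show "hcontent 3 ?X \<le> 0 + ennreal e" using bound[of k] by (simp add: ennreal_leI order_trans)
  qed
  then show ?thesis by simp
qed

text \<open>
  A crude bound is enough: it guarantees \<open>0 \<le> 3 - t\<close>, so that every exponent \<open>\<tau> > 3 - t\<close> is positive.
\<close>

lemma hausdorff_dim_plane_le_3:
  fixes A :: "(real ^ 2) set"
  shows "hausdorff_dim A \<le> 3"
proof -
  let ?X = "\<lambda>n. {p :: real \<times> real. \<bar>fst p\<bar> \<le> real (Suc n) \<and> \<bar>snd p\<bar> \<le> real (Suc n)}"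
  have "hcontent 3 (\<Union>n. ?X n) = 0" by (rule hcontent_UN_null) (rule hcontent_3_square_null, simp)
  moreover have "(\<Union>n. ?X n) = UNIV"
  proof -
    have "p \<in> (\<Union>n. ?X n)" for p :: "real \<times> real"
    proof -
      obtain n :: nat where "max \<bar>fst p\<bar> \<bar>snd p\<bar> \<le> real n" using real_arch_simple by blast
      then show ?thesis by (auto intro!: exI[of _ n])
    qed
    then show ?thesis by blast
  qed
  ultimately have "hcontent 3 (UNIV :: (real \<times> real) set) = 0" by simp
  moreover have "1-lipschitz_on UNIV plane_chart" by (rule lipschitz_onI) (simp_all add: plane_chart.dist_chart)
  ultimately have "hcontent 3 (range plane_chart) = 0" by (intro hcontent_lipschitz_null) auto
  then have "hcontent 3 A = 0"
    using hcontent_mono[of A "range plane_chart" 3] plane_chart.surj by simp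
  then show ?thesis using hausdorff_dim_le[of 3 A] by simp
qed

theorem corollary1p7:
  fixes A :: "(real ^ 2) set" and t :: real and L :: "line set"
  assumes "hausdorff_dim A = ereal t" and "t > 1"
    and "\<And>l. l \<in> L \<Longrightarrow> hausdorff_dim (A \<inter> line_points l) > ereal (t - 1)"
  shows "hausdorff_dim L \<le> ereal (3 - t)"
proof (rule ccontr)
  assume "\<not> ?thesis"
  then obtain \<tau>0 where \<tau>0: "ereal (3 - t) < ereal \<tau>0" "ereal \<tau>0 < hausdorff_dim L"
    using ereal_dense2[of "ereal (3 - t)" "hausdorff_dim L"] by (auto simp: not_le)
  have t3: "t \<le> 3" using hausdorff_dim_plane_le_3[of A] assms(1) by simp
  \<comment> \<open>The second entry lies strictly between \<open>3 - t\<close> and \<open>2\<close>, as \<open>t > 1\<close>.\<close>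
  define \<tau> where "\<tau> = min \<tau>0 ((5 - t) / 2)"
  have tau: "0 < \<tau>" "\<tau> < 2" "3 - t < \<tau>" "\<tau> \<le> \<tau>0" 
    using \<tau>0(1) assms(2) t3 by (auto simp: \<tau>_def min_def field_simps)
  define s where "s n = t - 1 + 1 / real (Suc n)" for n
  define L' where "L' n = {l\<in>L. ereal (s n) < hausdorff_dim (A \<inter> line_points l)}" for n
  have "L \<subseteq> (\<Union>n. L' n)"
  proof
    fix l assume l: "l \<in> L"
    obtain v where v: "ereal (t - 1) < ereal v" "ereal v < hausdorff_dim (A \<inter> line_points l)"
      using ereal_dense2[OF assms(3)[OF l]] by blast
    then obtain n where "inverse (real (Suc n)) < v - (t - 1)" using reals_Archimedean[of "v - (t - 1)"] by auto
    then have "ereal (s n) < ereal v" by (simp add: s_def inverse_eq_divide)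
    from order_less_trans[OF this v(2)] have "l \<in> L' n" using l by (simp add: L'_def)
    then show "l \<in> (\<Union>n. L' n)" by blast
  qed
  moreover have "hcontent \<tau> (\<Union>n. L' n) = 0"
  proof (rule hcontent_UN_null)
    fix n
    define \<eta> where "\<eta> = 1 / real (Suc n)"
    define u where "u = t + \<eta> / 2"
    have eta: "0 < \<eta>" by (simp add: \<eta>_def)
    have s_eq: "s n = t - 1 + \<eta>" by (simp add: s_def \<eta>_def)
    have s0: "0 < s n" "2 < s n + \<tau>" "u < s n + 1" "t < u"
      unfolding s_eq u_def using eta assms(2) tau by linarith+
    have "hcontent u A = 0"
      using assms(1,2) s0 by (intro hcontent_null_above_dim) (simp_all add: zero_ereal_def)
    moreover have "hcontent (s n) (A \<inter> line_points l) \<noteq> 0" if "l \<in> L' n" for l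
      using that hausdorff_dim_le[OF s0(1), of "A \<inter> line_points l"] by (auto simp: L'_def)
    ultimately show "hcontent \<tau> (L' n) = 0"
      using s0 tau assms(2) by (intro rich_lines_null_plane[of "s n" \<tau> u A]) auto
  qed
  ultimately have "hcontent \<tau> L = 0" using hcontent_mono by (metis le_zero_eq)
  then have "hausdorff_dim L \<le> ereal \<tau>" by (rule hausdorff_dim_le[OF tau(1)])
  also have "\<dots> \<le> ereal \<tau>0" using tau by simp
  finally show False using \<tau>0(2) by simp
qed

end
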